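(* Let $\Phi\in\mathcal{A}_d^*$ be an $\mathcal{A}_d$-Henkin functional. Then there exists $\Psi\in\mathcal{M}_{d*}$ such that $\Psi|_{\mathcal{A}_d}=\Phi$ and $\|\Psi\|_{\mathcal{M}_d^*}=\|\Phi\|_{\mathcal{A}_d^*}$. Moreover, there exists an anti-holomorphic function $\phi$ on $\mathbb{B}_d$ such that, if for $0\le r<1$ we put $\phi_r(z)=\phi(rz)$ and define $\Psi_r\in\mathcal{A}_d^*$ as integration against the measure $\phi_r\,d\sigma$, that is, $\Psi_r(f)=\int_{\mathbb{S}_d} f\,\phi_r\,d\sigma$ for $f\in\mathcal{A}_d$, then \[ \lim_{r\to1}\|\Phi-\Psi_r\|_{\mathcal{A}_d^*}=0 . \]
   Context: Let $d\ge1$ be an integer, $\mathbb{B}_d$ the open unit ball of $\mathbb{C}^d$, $\mathbb{S}_d$ the unit sphere, and $\sigma$ the unique rotation invariant Borel probability measure on $\mathbb{S}_d$. The Drury-Arveson space $H^2_d$ is the reproducing kernel Hilbert space of analytic functions on $\mathbb{B}_d$ with kernel $k(w,z)=1/(1-\langle w,z\rangle)$. Its multiplier algebra $\mathcal{M}_d$ consists of all analytic functions $f$ on $\mathbb{B}_d$ with $fH^2_d\subset H^2_d$; $f$ is identified with the multiplication operator $M_f\in B(H^2_d)$ and $\|f\|_{\mathcal{M}_d}=\|M_f\|$. $\mathcal{M}_d$ is WOT-closed, with predual $\mathcal{M}_{d*}=B(H^2_d)_*/(\mathcal{M}_d)_\perp$, regarded as the space of weak-$*$ continuous functionals on $\mathcal{M}_d$.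 $\mathcal{A}_d$ is the norm closure of the polynomials in $\mathcal{M}_d$, with norm $\|f\|_{\mathcal{A}_d}=\|f\|_{\mathcal{M}_d}$; its elements extend continuously to $\overline{\mathbb{B}_d}$. A functional $\Phi\in\mathcal{A}_d^*$ is an $\mathcal{A}_d$-Henkin functional if $\lim_{n}\Phi(f_n)=0$ whenever $\{f_n\}_n\subset\mathcal{A}_d$ is a sequence converging weak-$*$ to $0$ in $\mathcal{M}_d$. *)

theory Defs
  imports "HOL-Probability.Probability" "HOL-Library.Function_Algebras"
begin

text \<open>
  Points of $C^d$ are elements of \<^typ>\<open>complex ^ 'n\<close>, with $d$ the number of elements of the
  (nonempty) finite index type. Functions on the open unit ball are represented by total
  functions that vanish off the ball, so that equality of functions is equality on the ball.
  The sum, difference and product of functions are the pointwise ones.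
\<close>

definition supported_on :: "'a set \<Rightarrow> ('a \<Rightarrow> complex) \<Rightarrow> bool" where
  "supported_on X f \<longleftrightarrow> (\<forall>z. z \<notin> X \<longrightarrow> f z = 0)"

definition restrict0 :: "'a set \<Rightarrow> ('a \<Rightarrow> complex) \<Rightarrow> 'a \<Rightarrow> complex" where
  "restrict0 X f = (\<lambda>z. if z \<in> X then f z else 0)"

definition cscale :: "complex \<Rightarrow> ('a \<Rightarrow> complex) \<Rightarrow> 'a \<Rightarrow> complex" where
  "cscale c f = (\<lambda>z. c * f z)"


section \<open>Hilbert spaces of functions\<close>

definition csubspace :: "('a \<Rightarrow> complex) set \<Rightarrow> bool" where
  "csubspace V \<longleftrightarrow>
     0 \<in> V \<and> (\<forall>f\<in>V. \<forall>g\<in>V. f + g \<in> V) \<and> (\<forall>c. \<forall>f\<in>V. cscale c f \<in> V)"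

definition ip_norm :: "(('a \<Rightarrow> complex) \<Rightarrow> ('a \<Rightarrow> complex) \<Rightarrow> complex) \<Rightarrow> ('a \<Rightarrow> complex) \<Rightarrow> real" where
  "ip_norm ip f = sqrt (Re (ip f f))"

definition inner_product_on ::
    "('a \<Rightarrow> complex) set \<Rightarrow> (('a \<Rightarrow> complex) \<Rightarrow> ('a \<Rightarrow> complex) \<Rightarrow> complex) \<Rightarrow> bool" where
  "inner_product_on H ip \<longleftrightarrow>
     (\<forall>f\<in>H. \<forall>g\<in>H. \<forall>h\<in>H. ip (f + g) h = ip f h + ip g h) \<and>
     (\<forall>c. \<forall>f\<in>H. \<forall>h\<in>H. ip (cscale c f) h = c * ip f h) \<and>
     (\<forall>f\<in>H. \<forall>g\<in>H. ip g f = cnj (ip f g)) \<and>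
     (\<forall>f\<in>H. f \<noteq> 0 \<longrightarrow> Re (ip f f) > 0)"

definition hilbert_function_space ::
    "('a \<Rightarrow> complex) set \<Rightarrow> (('a \<Rightarrow> complex) \<Rightarrow> ('a \<Rightarrow> complex) \<Rightarrow> complex) \<Rightarrow> bool" where
  "hilbert_function_space H ip \<longleftrightarrow>
     csubspace H \<and> inner_product_on H ip \<and>
     (\<forall>F :: nat \<Rightarrow> 'a \<Rightarrow> complex.
        (\<forall>n. F n \<in> H) \<and>
        (\<forall>e>0. \<exists>N. \<forall>m\<ge>N. \<forall>n\<ge>N. ip_norm ip (F m - F n) < e) \<longrightarrow>
        (\<exists>f\<in>H. (\<lambda>n. ip_norm ip (F n - f)) \<longlonglongrightarrow> 0))"

definition rkhs ::
    "'a set \<Rightarrow> ('a \<Rightarrow> 'a \<Rightarrow> complex) \<Rightarrow> ('a \<Rightarrow> complex) set \<Rightarrow>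
     (('a \<Rightarrow> complex) \<Rightarrow> ('a \<Rightarrow> complex) \<Rightarrow> complex) \<Rightarrow> bool" where
  "rkhs X k H ip \<longleftrightarrow>
     hilbert_function_space H ip \<and> (\<forall>f\<in>H. supported_on X f) \<and>
     (\<forall>z\<in>X. restrict0 X (\<lambda>w. k w z) \<in> H \<and>
             (\<forall>f\<in>H. ip f (restrict0 X (\<lambda>w. k w z)) = f z))"


section \<open>Duals and bounded operators\<close>

text \<open>A functional on a subspace is a total map of which only the values on the subspace matter.\<close>

definition dual_norm ::
    "('a \<Rightarrow> complex) set \<Rightarrow> (('a \<Rightarrow> complex) \<Rightarrow> real) \<Rightarrow> (('a \<Rightarrow> complex) \<Rightarrow> complex) \<Rightarrow> real" where
  "dual_norm V nrm \<Phi> = (SUP f\<in>{f \<in> V. nrm f \<le> 1}. cmod (\<Phi> f))"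

definition dual_space ::
    "('a \<Rightarrow> complex) set \<Rightarrow> (('a \<Rightarrow> complex) \<Rightarrow> real) \<Rightarrow> (('a \<Rightarrow> complex) \<Rightarrow> complex) set" where
  "dual_space V nrm = {\<Phi>.
     (\<forall>f\<in>V. \<forall>g\<in>V. \<Phi> (f + g) = \<Phi> f + \<Phi> g) \<and>
     (\<forall>c. \<forall>f\<in>V. \<Phi> (cscale c f) = c * \<Phi> f) \<and>
     (\<exists>C. \<forall>f\<in>V. cmod (\<Phi> f) \<le> C * nrm f)}"

definition bounded_operators ::
    "('a \<Rightarrow> complex) set \<Rightarrow> (('a \<Rightarrow> complex) \<Rightarrow> ('a \<Rightarrow> complex) \<Rightarrow> complex) \<Rightarrow>
     (('a \<Rightarrow> complex) \<Rightarrow> ('a \<Rightarrow> complex)) set" where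
  "bounded_operators H ip = {T.
     (\<forall>f\<in>H. T f \<in> H) \<and>
     (\<forall>f\<in>H. \<forall>g\<in>H. T (f + g) = T f + T g) \<and>
     (\<forall>c. \<forall>f\<in>H. T (cscale c f) = cscale c (T f)) \<and>
     (\<exists>C. \<forall>f\<in>H. ip_norm ip (T f) \<le> C * ip_norm ip f)}"

definition operator_norm ::
    "('a \<Rightarrow> complex) set \<Rightarrow> (('a \<Rightarrow> complex) \<Rightarrow> ('a \<Rightarrow> complex) \<Rightarrow> complex) \<Rightarrow>
     (('a \<Rightarrow> complex) \<Rightarrow> ('a \<Rightarrow> complex)) \<Rightarrow> real" where
  "operator_norm H ip T = (SUP g\<in>{g \<in> H. ip_norm ip g \<le> 1}. ip_norm ip (T g))"

text \<open>
  The predual of the algebra of bounded operators: the normal functionals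
  $T \mapsto \sum_n \langle T x_n, y_n\rangle$ with $\sum_n \|x_n\|^2$ and $\sum_n \|y_n\|^2$
  finite, i.e. the pairings with trace class operators.
\<close>

definition operators_predual ::
    "('a \<Rightarrow> complex) set \<Rightarrow> (('a \<Rightarrow> complex) \<Rightarrow> ('a \<Rightarrow> complex) \<Rightarrow> complex) \<Rightarrow>
     ((('a \<Rightarrow> complex) \<Rightarrow> ('a \<Rightarrow> complex)) \<Rightarrow> complex) set" where
  "operators_predual H ip = {\<Lambda>.
     \<exists>x y :: nat \<Rightarrow> 'a \<Rightarrow> complex.
       (\<forall>n. x n \<in> H \<and> y n \<in> H) \<and>
       summable (\<lambda>n. (ip_norm ip (x n))\<^sup>2) \<and> summable (\<lambda>n. (ip_norm ip (y n))\<^sup>2) \<and>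
       (\<forall>T\<in>bounded_operators H ip. \<Lambda> T = (\<Sum>n. ip (T (x n)) (y n)))}"


section \<open>The Drury--Arveson space and its multipliers\<close>

definition cinner_vec :: "complex ^ 'n \<Rightarrow> complex ^ 'n \<Rightarrow> complex" where
  "cinner_vec w z = (\<Sum>i\<in>UNIV. w $ i * cnj (z $ i))"

definition analytic_on_ball :: "(complex ^ 'n \<Rightarrow> complex) \<Rightarrow> bool" where
  "analytic_on_ball f \<longleftrightarrow>
     (\<forall>z\<in>ball 0 1. \<exists>f'. (f has_derivative f') (at z) \<and> (\<forall>c v. f' (c *s v) = c * f' v))"

definition antiholomorphic_on_ball :: "(complex ^ 'n \<Rightarrow> complex) \<Rightarrow> bool" where
  "antiholomorphic_on_ball f \<longleftrightarrow> analytic_on_ball (\<lambda>z. cnj (f z))"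

text \<open>
  By the Moore--Aronszajn theorem exactly one space \<open>H\<close> and one inner product (as a map on pairs
  of elements of \<open>H\<close>) satisfy the following predicate.
\<close>

definition drury_arveson ::
    "(complex ^ 'n \<Rightarrow> complex) set \<Rightarrow>
     ((complex ^ 'n \<Rightarrow> complex) \<Rightarrow> (complex ^ 'n \<Rightarrow> complex) \<Rightarrow> complex) \<Rightarrow> bool" where
  "drury_arveson H ip \<longleftrightarrow>
     rkhs (ball 0 1) (\<lambda>w z. 1 / (1 - cinner_vec w z)) H ip \<and> (\<forall>f\<in>H. analytic_on_ball f)"

definition multiplication_op :: "('a \<Rightarrow> complex) \<Rightarrow> ('a \<Rightarrow> complex) \<Rightarrow> ('a \<Rightarrow> complex)" where
  "multiplication_op f = (\<lambda>g. f * g)"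

text \<open>Multiplication operators are automatically bounded, by the closed graph theorem.\<close>

definition multiplier_algebra ::
    "(complex ^ 'n \<Rightarrow> complex) set \<Rightarrow> (complex ^ 'n \<Rightarrow> complex) set" where
  "multiplier_algebra H = {f.
     supported_on (ball 0 1) f \<and> analytic_on_ball f \<and> (\<forall>g\<in>H. multiplication_op f g \<in> H)}"

definition multiplier_norm ::
    "('a \<Rightarrow> complex) set \<Rightarrow> (('a \<Rightarrow> complex) \<Rightarrow> ('a \<Rightarrow> complex) \<Rightarrow> complex) \<Rightarrow>
     ('a \<Rightarrow> complex) \<Rightarrow> real" where
  "multiplier_norm H ip f = operator_norm H ip (multiplication_op f)"

text \<open>
  The quotient of the predual of the bounded operators by the preannihilator of the multiplier
  algebra, as a space of functionals: restrictions of normal functionals to multipliers.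
\<close>

definition multiplier_predual ::
    "(complex ^ 'n \<Rightarrow> complex) set \<Rightarrow>
     ((complex ^ 'n \<Rightarrow> complex) \<Rightarrow> (complex ^ 'n \<Rightarrow> complex) \<Rightarrow> complex) \<Rightarrow>
     ((complex ^ 'n \<Rightarrow> complex) \<Rightarrow> complex) set" where
  "multiplier_predual H ip = {\<Psi>.
     \<exists>\<Lambda>\<in>operators_predual H ip. \<forall>f\<in>multiplier_algebra H. \<Psi> f = \<Lambda> (multiplication_op f)}"

definition multiplier_weakstar_null ::
    "(complex ^ 'n \<Rightarrow> complex) set \<Rightarrow>
     ((complex ^ 'n \<Rightarrow> complex) \<Rightarrow> (complex ^ 'n \<Rightarrow> complex) \<Rightarrow> complex) \<Rightarrow>
     (nat \<Rightarrow> complex ^ 'n \<Rightarrow> complex) \<Rightarrow> bool" where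
  "multiplier_weakstar_null H ip F \<longleftrightarrow>
     (\<forall>\<Psi>\<in>multiplier_predual H ip. (\<lambda>n. \<Psi> (F n)) \<longlonglongrightarrow> 0)"

definition polynomial_fun :: "(complex ^ 'n \<Rightarrow> complex) \<Rightarrow> bool" where
  "polynomial_fun p \<longleftrightarrow>
     (\<exists>(A :: ('n \<Rightarrow> nat) set) c. finite A \<and>
        (\<forall>z. p z = (\<Sum>\<alpha>\<in>A. c \<alpha> * (\<Prod>i\<in>UNIV. (z $ i) ^ \<alpha> i))))"

definition ball_algebra ::
    "(complex ^ 'n \<Rightarrow> complex) set \<Rightarrow>
     ((complex ^ 'n \<Rightarrow> complex) \<Rightarrow> (complex ^ 'n \<Rightarrow> complex) \<Rightarrow> complex) \<Rightarrow>
     (complex ^ 'n \<Rightarrow> complex) set" where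
  "ball_algebra H ip = {f \<in> multiplier_algebra H.
     \<forall>e>0. \<exists>p. polynomial_fun p \<and> multiplier_norm H ip (f - restrict0 (ball 0 1) p) < e}"

definition henkin_functional ::
    "(complex ^ 'n \<Rightarrow> complex) set \<Rightarrow>
     ((complex ^ 'n \<Rightarrow> complex) \<Rightarrow> (complex ^ 'n \<Rightarrow> complex) \<Rightarrow> complex) \<Rightarrow>
     ((complex ^ 'n \<Rightarrow> complex) \<Rightarrow> complex) \<Rightarrow> bool" where
  "henkin_functional H ip \<Phi> \<longleftrightarrow>
     \<Phi> \<in> dual_space (ball_algebra H ip) (multiplier_norm H ip) \<and>
     (\<forall>F. (\<forall>n. F n \<in> ball_algebra H ip) \<and> multiplier_weakstar_null H ip F \<longrightarrow>
          (\<lambda>n. \<Phi> (F n)) \<longlonglongrightarrow> 0)"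


section \<open>The sphere\<close>

definition rotation_invariant_prob :: "(complex ^ 'n) measure \<Rightarrow> bool" where
  "rotation_invariant_prob \<sigma> \<longleftrightarrow>
     sets \<sigma> = sets (restrict_space borel (sphere 0 1)) \<and> prob_space \<sigma> \<and>
     (\<forall>U. orthogonal_transformation U \<longrightarrow> distr \<sigma> \<sigma> U = \<sigma>)"

text \<open>The values on the sphere of the continuous extension of \<open>f\<close> to the closed ball.\<close>

definition boundary_value :: "(complex ^ 'n \<Rightarrow> complex) \<Rightarrow> complex ^ 'n \<Rightarrow> complex" where
  "boundary_value f \<zeta> = Lim (at \<zeta> within ball 0 1) f"

definition integration_functional ::
    "(complex ^ 'n) measure \<Rightarrow> (complex ^ 'n \<Rightarrow> complex) \<Rightarrow> (complex ^ 'n \<Rightarrow> complex) \<Rightarrow> complex" where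
  "integration_functional \<sigma> h f = (\<integral>\<zeta>. boundary_value f \<zeta> * h \<zeta> \<partial>\<sigma>)"

end

theory Submission
  imports Defs
begin

text \<open>
  The theorem follows from the dilations \<open>f \<mapsto> dil r f\<close>, \<open>dil r f z = f (r z)\<close>, and from the Hahn--Banach
  theorem.

  Dilations are contractive on multipliers (\<open>dil_mnorm\<close>), and for \<open>r < 1\<close> they send every element
  of \<open>H\<close> into the ball algebra (\<open>dil_A\<close>). Let \<open>defect r\<close> be the norm of
  \<open>f \<mapsto> \<Phi> f - \<Phi> (dil r f)\<close> on the ball algebra. It tends to zero as \<open>r\<close> tends to one
  (\<open>defect_tendsto\<close>): for almost extremal \<open>f n\<close> and \<open>r n\<close> tending to one, the differences
  \<open>f n - dil (r n) (f n)\<close> are bounded and tend to zero pointwise, hence weak-*, and \<open>\<Phi>\<close> is Henkin.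
  Both assertions are consequences of this convergence in norm.

  The Henkin extension. Each functional \<open>f \<mapsto> \<Phi> (dil r f)\<close> is defined on all multipliers and even
  has the form \<open>f \<mapsto> ip f y\<close> with \<open>y\<close> in \<open>H\<close>. Since \<open>dil r\<close> and \<open>dil s\<close> commute and contract, two
  such functionals differ by at most \<open>defect r + defect s\<close> in norm over the multipliers, too. So
  they converge in norm, to a functional of norm at most that of \<open>\<Phi>\<close> which extends \<open>\<Phi>\<close>. The
  limit is weak-* continuous because the predual is complete. In the present terms: a finite-rank
  functional of norm less than \<open>C\<close> on the multipliers has a representation of trace norm
  less than \<open>C\<close> (\<open>quotient_norm\<close>), so that a fast convergent telescoping series can be
  represented term by term and reassembled (\<open>normal_series\<close>). The lemma \<open>quotient_norm\<close> is a
  Hahn--Banach argument: the functionals on the predual are the multipliers.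

  The density. Let \<open>f = \<Sum>m. hpart m f\<close> be the expansion into homogeneous polynomials. Rotation
  invariance alone shows that integrating \<open>f\<close> against \<open>\<langle>z, \<cdot>\<rangle>^m\<close> gives \<open>hpart m f z\<close> times a number
  \<open>moment m\<close> that does not depend on \<open>z\<close> (\<open>szego\<close>). Therefore \<open>\<phi> z = \<Sum>m. \<Phi> (\<langle>\<cdot>, z\<rangle>^m) / moment m\<close>
  satisfies \<open>\<integral> f \<phi>\<^sub>r d\<sigma> = \<Sum>m. r^m \<Phi> (hpart m f) = \<Phi> (dil r f)\<close>. The moments decay slower
  than any geometric sequence since \<open>\<sigma>\<close> charges some cap of any given size, and the moments do not
  depend on its centre; this makes \<open>\<phi>\<close> converge in the ball.

  The estimates for polynomials rest on one inequality, \<open>row_contraction\<close>: with monomials indexed by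
  words, the operators of multiplication by the monomials of degree \<open>m\<close> form a row contraction,
  because \<open>\<langle>w, z\<rangle>^m k(w, z)\<close> differs from \<open>k(w, z) = 1 / (1 - \<langle>w, z\<rangle>)\<close> by a positive definite
  kernel.
\<close>

section \<open>Hilbert spaces of functions\<close>

lemma cscale_apply [simp]: "cscale c f z = c * f z"
  by (simp add: cscale_def)

lemma cscale_alg: "cscale a (cscale b f) = cscale (a * b) f" "cscale 1 f = f" "cscale 0 f = 0"
  "cscale a (f + g) = cscale a f + cscale a g" "cscale a (f - g) = cscale a f - cscale a g"
  "cscale (a + b) f = cscale a f + cscale b f" "cscale (-1) f = - f" "cscale a 0 = 0"
  by (auto simp: fun_eq_iff algebra_simps)

lemma diff_cscale: "f - g = f + cscale (-1) (g :: 'a \<Rightarrow> complex)"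
  by (auto simp: fun_eq_iff)

lemma sum_fun_apply: "(\<Sum>i\<in>S. F i) z = (\<Sum>i\<in>S. (F i z :: complex))"
  by (induction S rule: infinite_finite_induct) auto

locale hilbert_functions =
  fixes H :: "('a \<Rightarrow> complex) set" and ip :: "('a \<Rightarrow> complex) \<Rightarrow> ('a \<Rightarrow> complex) \<Rightarrow> complex"
  assumes hilbert: "hilbert_function_space H ip"
begin

abbreviation nrm :: "('a \<Rightarrow> complex) \<Rightarrow> real" where "nrm \<equiv> ip_norm ip"

lemma zero_mem [simp]: "0 \<in> H"
  and add_mem [simp]: "\<And>f g. f \<in> H \<Longrightarrow> g \<in> H \<Longrightarrow> f + g \<in> H"
  and scale_mem [simp]: "\<And>c f. f \<in> H \<Longrightarrow> cscale c f \<in> H"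
  using hilbert unfolding hilbert_function_space_def csubspace_def by blast+

lemma uminus_mem [simp]: "f \<in> H \<Longrightarrow> - f \<in> H"
  using scale_mem[of f "-1"] by (simp only: cscale_alg)

lemma diff_mem [simp]: "f \<in> H \<Longrightarrow> g \<in> H \<Longrightarrow> f - g \<in> H"
  by (metis add_mem scale_mem diff_cscale)

lemma sum_mem: "(\<And>i. i \<in> S \<Longrightarrow> v i \<in> H) \<Longrightarrow> (\<Sum>i\<in>S. v i) \<in> H"
  by (induction S rule: infinite_finite_induct) auto

lemma inner: "inner_product_on H ip"
  using hilbert by (simp add: hilbert_function_space_def)

lemmas inner_unfolded = inner[unfolded inner_product_on_def]

lemma ip_add_left: "f \<in> H \<Longrightarrow> g \<in> H \<Longrightarrow> h \<in> H \<Longrightarrow> ip (f + g) h = ip f h + ip g h"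
  by (rule inner_unfolded[THEN conjunct1, rule_format])

lemma ip_scale_left: "f \<in> H \<Longrightarrow> h \<in> H \<Longrightarrow> ip (cscale c f) h = c * ip f h"
  by (rule inner_unfolded[THEN conjunct2, THEN conjunct1, rule_format])

lemma ip_sym: "f \<in> H \<Longrightarrow> g \<in> H \<Longrightarrow> ip g f = cnj (ip f g)"
  by (rule inner_unfolded[THEN conjunct2, THEN conjunct2, THEN conjunct1, rule_format])

lemma ip_pos: "f \<in> H \<Longrightarrow> f \<noteq> 0 \<Longrightarrow> Re (ip f f) > 0"
  by (rule inner_unfolded[THEN conjunct2, THEN conjunct2, THEN conjunct2, rule_format])

lemma ip_add_right: "f \<in> H \<Longrightarrow> g \<in> H \<Longrightarrow> h \<in> H \<Longrightarrow> ip h (f + g) = ip h f + ip h g"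
  using ip_add_left[of f g h] ip_sym[of h "f + g"] ip_sym[of h f] ip_sym[of h g]
  by (metis add_mem complex_cnj_add complex_cnj_cnj)

lemma ip_scale_right: "f \<in> H \<Longrightarrow> h \<in> H \<Longrightarrow> ip h (cscale c f) = cnj c * ip h f"
  using ip_scale_left[of f h c] ip_sym[of h f] ip_sym[of h "cscale c f"]
  by (metis scale_mem complex_cnj_cnj complex_cnj_mult)

lemma ip_zero_left [simp]: "h \<in> H \<Longrightarrow> ip 0 h = 0"
  using ip_scale_left[of 0 h 0] by (simp add: cscale_alg)

lemma ip_zero_right [simp]: "h \<in> H \<Longrightarrow> ip h 0 = 0"
  using ip_scale_right[of 0 h 0] by (simp add: cscale_alg)

lemma ip_diff_left: "f \<in> H \<Longrightarrow> g \<in> H \<Longrightarrow> h \<in> H \<Longrightarrow> ip (f - g) h = ip f h - ip g h"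
  by (simp only: diff_cscale ip_add_left ip_scale_left scale_mem) simp

lemma ip_diff_right: "f \<in> H \<Longrightarrow> g \<in> H \<Longrightarrow> h \<in> H \<Longrightarrow> ip h (f - g) = ip h f - ip h g"
  by (simp only: diff_cscale ip_add_right ip_scale_right scale_mem) simp

lemma ip_sum_left: "(\<And>i. i \<in> S \<Longrightarrow> v i \<in> H) \<Longrightarrow> h \<in> H \<Longrightarrow> ip (\<Sum>i\<in>S. v i) h = (\<Sum>i\<in>S. ip (v i) h)"
  by (induction S rule: infinite_finite_induct) (auto simp: ip_add_left sum_mem)

lemma ip_sum_right: "(\<And>i. i \<in> S \<Longrightarrow> v i \<in> H) \<Longrightarrow> h \<in> H \<Longrightarrow> ip h (\<Sum>i\<in>S. v i) = (\<Sum>i\<in>S. ip h (v i))"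
  by (induction S rule: infinite_finite_induct) (auto simp: ip_add_right sum_mem)

lemma ip_self_Re: assumes "f \<in> H" shows "Re (ip f f) \<ge> 0"
  using ip_pos[OF assms] by (cases "f = 0") auto

lemma nrm_ge0 [simp]: "f \<in> H \<Longrightarrow> nrm f \<ge> 0"
  by (simp add: ip_norm_def ip_self_Re)

lemma nrm_sq: "f \<in> H \<Longrightarrow> (nrm f)\<^sup>2 = Re (ip f f)"
  by (simp add: ip_norm_def ip_self_Re)

lemma ip_self: assumes "f \<in> H" shows "ip f f = of_real ((nrm f)\<^sup>2)"
proof -
  have "ip f f = cnj (ip f f)" using ip_sym assms by blast
  then have "Im (ip f f) = 0" by (metis cnj.sel(2) equal_neg_zero)
  then show ?thesis using nrm_sq[OF assms] by (simp add: complex_eq_iff)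
qed

lemma nrm_eq_0: "f \<in> H \<Longrightarrow> nrm f = 0 \<longleftrightarrow> f = 0"
  using ip_pos[of f] ip_zero_left[OF zero_mem] by (cases "f = 0") (simp_all add: ip_norm_def)

lemma nrm_zero [simp]: "nrm 0 = 0"
  using nrm_eq_0[OF zero_mem] by simp

lemma nrm_sq_add: assumes "f \<in> H" "g \<in> H"
  shows "(nrm (f + g))\<^sup>2 = (nrm f)\<^sup>2 + 2 * Re (ip f g) + (nrm g)\<^sup>2"
proof -
  have "Re (ip g f) = Re (ip f g)" using ip_sym[OF assms] by simp
  then show ?thesis using assms by (simp add: nrm_sq ip_add_left ip_add_right)
qed

lemma nrm_sq_diff: assumes "f \<in> H" "g \<in> H"
  shows "(nrm (f - g))\<^sup>2 = (nrm f)\<^sup>2 - 2 * Re (ip f g) + (nrm g)\<^sup>2"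
proof -
  have "Re (ip g f) = Re (ip f g)" using ip_sym[OF assms] by simp
  then show ?thesis using assms by (simp add: nrm_sq ip_diff_left ip_diff_right)
qed

lemma nrm_scale: assumes "f \<in> H" shows "nrm (cscale c f) = cmod c * nrm f"
proof -
  have "ip (cscale c f) (cscale c f) = c * cnj c * ip f f"
    using assms by (simp add: ip_scale_left ip_scale_right mult.assoc)
  also have "\<dots> = of_real ((cmod c)\<^sup>2) * ip f f"
    by (simp only: complex_norm_square)
  finally have "(nrm (cscale c f))\<^sup>2 = (cmod c * nrm f)\<^sup>2"
    using assms by (simp add: nrm_sq power_mult_distrib)
  then show ?thesis using assms by (simp add: power2_eq_iff_nonneg)
qed

lemma nrm_minus: "f \<in> H \<Longrightarrow> nrm (- f) = nrm f"
  using nrm_scale[of f "-1"] by (simp add: cscale_alg)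

lemma nrm_diff_commute: "f \<in> H \<Longrightarrow> g \<in> H \<Longrightarrow> nrm (f - g) = nrm (g - f)"
  using nrm_minus[of "f - g"] by simp

lemma cauchy_schwarz: assumes "f \<in> H" "g \<in> H" shows "cmod (ip f g) \<le> nrm f * nrm g"
proof (cases "g = 0")
  case False
  then have g: "nrm g > 0" using nrm_eq_0[of g] nrm_ge0[of g] assms by linarith
  define a where "a = ip f g / of_real ((nrm g)\<^sup>2)"
  have "ip f (cscale a g) = of_real ((cmod (ip f g))\<^sup>2 / (nrm g)\<^sup>2)"
  proof -
    have "ip f (cscale a g) = (ip f g * cnj (ip f g)) / of_real ((nrm g)\<^sup>2)"
      using assms by (simp add: ip_scale_right a_def)
    then show ?thesis by (simp only: complex_norm_square[symmetric] of_real_divide)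
  qed
  moreover have "(nrm (cscale a g))\<^sup>2 = (cmod (ip f g))\<^sup>2 / (nrm g)\<^sup>2"
    using g assms by (simp add: nrm_scale a_def norm_divide norm_power norm_mult power_divide power2_eq_square)
  ultimately have "(nrm (f - cscale a g))\<^sup>2 = (nrm f)\<^sup>2 - (cmod (ip f g))\<^sup>2 / (nrm g)\<^sup>2"
    using assms by (simp add: nrm_sq_diff)
  then have "(cmod (ip f g))\<^sup>2 / (nrm g)\<^sup>2 \<le> (nrm f)\<^sup>2"
    using zero_le_power2[of "nrm (f - cscale a g)"] by linarith
  then have "(cmod (ip f g))\<^sup>2 \<le> (nrm f * nrm g)\<^sup>2"
    using g by (simp only: pos_divide_le_eq zero_less_power power_mult_distrib)
  then show ?thesis
    by (rule power2_le_imp_le) (use assms in simp)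
next
  case True
  then show ?thesis using assms by (simp add: ip_zero_right)
qed

lemma nrm_triangle: assumes "f \<in> H" "g \<in> H" shows "nrm (f + g) \<le> nrm f + nrm g"
proof -
  have "Re (ip f g) \<le> nrm f * nrm g"
    using cauchy_schwarz[OF assms] complex_Re_le_cmod[of "ip f g"] by linarith
  then have "(nrm (f + g))\<^sup>2 \<le> (nrm f + nrm g)\<^sup>2"
    by (simp add: nrm_sq_add[OF assms] power2_sum)
  then show ?thesis
    by (rule power2_le_imp_le) (use assms in simp)
qed

lemma nrm_triangle_diff: "f \<in> H \<Longrightarrow> g \<in> H \<Longrightarrow> nrm (f - g) \<le> nrm f + nrm g"
  using nrm_triangle[of f "- g"] by (simp add: nrm_minus)

lemma nrm_sum: "(\<And>i. i \<in> S \<Longrightarrow> v i \<in> H) \<Longrightarrow> nrm (\<Sum>i\<in>S. v i) \<le> (\<Sum>i\<in>S. nrm (v i))"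
proof (induction S rule: infinite_finite_induct)
  case (insert x F)
  have "nrm (v x + sum v F) \<le> nrm (v x) + nrm (sum v F)"
    using insert.prems by (intro nrm_triangle sum_mem) auto
  also have "nrm (sum v F) \<le> (\<Sum>i\<in>F. nrm (v i))" using insert by blast
  finally show ?case by (simp only: sum.insert[OF insert.hyps(1,2)])
qed simp_all

lemma tendsto_ip_left:
  assumes "\<And>n. s n \<in> H" "u \<in> H" "h \<in> H" "(\<lambda>n. nrm (s n - u)) \<longlonglongrightarrow> 0"
  shows "(\<lambda>n. ip (s n) h) \<longlonglongrightarrow> ip u h"
proof -
  have "cmod (ip (s n) h - ip u h) \<le> nrm (s n - u) * nrm h" for n
    using cauchy_schwarz[OF diff_mem[OF assms(1)[of n] assms(2)] assms(3)]
    by (simp only: ip_diff_left[OF assms(1)[of n] assms(2,3)])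
  then have "(\<lambda>n. ip (s n) h - ip u h) \<longlonglongrightarrow> 0"
    by (rule Lim_null_comparison[OF always_eventually[OF allI] tendsto_mult_left_zero[OF assms(4)]])
  then show ?thesis by (rule LIM_zero_cancel)
qed

lemma tendsto_ip_right:
  assumes "\<And>n. s n \<in> H" "u \<in> H" "h \<in> H" "(\<lambda>n. nrm (s n - u)) \<longlonglongrightarrow> 0"
  shows "(\<lambda>n. ip h (s n)) \<longlonglongrightarrow> ip h u"
proof -
  have "ip h (s n) = cnj (ip (s n) h)" "ip h u = cnj (ip u h)" for n
    by (intro ip_sym assms)+
  then show ?thesis using tendsto_cnj[OF tendsto_ip_left[OF assms]] by simp
qed

lemma tendsto_nrm:
  assumes "\<And>n. s n \<in> H" "u \<in> H" "(\<lambda>n. nrm (s n - u)) \<longlonglongrightarrow> 0"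
  shows "(\<lambda>n. nrm (s n)) \<longlonglongrightarrow> nrm u"
proof -
  have "\<bar>nrm (s n) - nrm u\<bar> \<le> nrm (s n - u)" for n
  proof -
    have "nrm (s n - u + u) \<le> nrm (s n - u) + nrm u" "nrm (s n - (s n - u)) \<le> nrm (s n) + nrm (s n - u)"
      by (intro nrm_triangle nrm_triangle_diff diff_mem assms)+
    then show ?thesis by (simp only: diff_add_cancel diff_diff_eq2 add_diff_cancel_left') 
  qed
  then have "(\<lambda>n. nrm (s n) - nrm u) \<longlonglongrightarrow> 0"
    by (intro Lim_null_comparison[OF always_eventually[OF allI] assms(3)]) (simp only: real_norm_def)
  then show ?thesis by (rule LIM_zero_cancel)
qed

lemma complete:
  assumes "\<And>n. s n \<in> H" "\<And>e. e > 0 \<Longrightarrow> \<exists>N. \<forall>m\<ge>N. \<forall>n\<ge>N. nrm (s m - s n) < e"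
  obtains u where "u \<in> H" "(\<lambda>n. nrm (s n - u)) \<longlonglongrightarrow> 0"
  using hilbert assms unfolding hilbert_function_space_def by blast

lemma abs_convergent_series:
  assumes v: "\<And>n. v n \<in> H" and sm: "summable (\<lambda>n. nrm (v n))"
  obtains u where "u \<in> H" "(\<lambda>n. nrm ((\<Sum>i<n. v i) - u)) \<longlonglongrightarrow> 0"
proof (rule complete)
  show "(\<Sum>i<n. v i) \<in> H" for n by (intro sum_mem v)
  fix e :: real assume "e > 0"
  then obtain N where N: "\<And>m n. m \<ge> N \<Longrightarrow> norm (\<Sum>i=m..<n. nrm (v i)) < e"
    using summable_Cauchy sm by metis
  have *: "nrm ((\<Sum>i<m. v i) - (\<Sum>i<n. v i)) < e" if "N \<le> n" "n \<le> m" for m n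
  proof -
    have "(\<Sum>i<m. v i) - (\<Sum>i<n. v i) = (\<Sum>i=n..<m. v i)"
      using sum_diff_nat_ivl[of 0 n m v] that by (simp add: lessThan_atLeast0)
    then show ?thesis using nrm_sum[of "{n..<m}" v] N[OF that(1), of m] v by auto
  qed
  then show "\<exists>N. \<forall>m\<ge>N. \<forall>n\<ge>N. nrm ((\<Sum>i<m. v i) - (\<Sum>i<n. v i)) < e"
  proof (intro exI[of _ N] allI impI)
    fix m n assume mn: "m \<ge> N" "n \<ge> N"
    have "nrm ((\<Sum>i<m. v i) - (\<Sum>i<n. v i)) = nrm ((\<Sum>i<n. v i) - (\<Sum>i<m. v i))"
      by (intro nrm_diff_commute sum_mem v)
    then show "nrm ((\<Sum>i<m. v i) - (\<Sum>i<n. v i)) < e"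
      using *[of m n] *[of n m] mn by (cases "m \<le> n") simp_all
  qed
qed (rule that)

text \<open>Riesz representation. A functional is given by its graph, so that single-valuedness need
  not be known in advance: it follows from the bound. The representing vector minimises
  \<open>\<parallel>x\<parallel>\<^sup>2/2 - Re l\<close> over the graph; minimising sequences are Cauchy by the parallelogram law.\<close>

lemma riesz:
  assumes C: "C \<ge> 0" and G: "\<And>x l. (x, l) \<in> G \<Longrightarrow> x \<in> H" "(0, 0) \<in> G"
    and add: "\<And>x l y m. (x, l) \<in> G \<Longrightarrow> (y, m) \<in> G \<Longrightarrow> (x + y, l + m) \<in> G"
    and scl: "\<And>x l c. (x, l) \<in> G \<Longrightarrow> (cscale c x, c * l) \<in> G"
    and bd: "\<And>x l. (x, l) \<in> G \<Longrightarrow> cmod l \<le> C * nrm x"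
  obtains u s where "u \<in> H" "nrm u \<le> C" "\<And>x l. (x, l) \<in> G \<Longrightarrow> ip x u = l"
    "\<And>n. s n \<in> fst ` G" "(\<lambda>n::nat. nrm (s n - u)) \<longlonglongrightarrow> 0"
proof -
  define J where "J = (\<lambda>(x, l). (nrm x)\<^sup>2 / 2 - Re l)"
  have low: "J g \<ge> - (C\<^sup>2 / 2)" if "g \<in> G" for g
  proof -
    obtain x l where g: "g = (x, l)" by fastforce
    have "Re l \<le> C * nrm x"
      using bd[OF that[unfolded g]] complex_Re_le_cmod[of l] by linarith
    moreover have "0 \<le> (nrm x - C)\<^sup>2" by simp
    ultimately show ?thesis by (simp add: J_def g power2_diff mult.commute)
  qed
  define m where "m = Inf (J ` G)"
  have bdd: "bdd_below (J ` G)" using low by (rule bdd_belowI2)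
  have mle: "m \<le> J g" if "g \<in> G" for g
    unfolding m_def using bdd that by (simp add: cInf_lower)
  have "\<exists>g\<in>G. J g < m + 1 / (real n + 1)" for n
    using cInf_lessD[of "J ` G" "m + 1 / (real n + 1)"] G(2) m_def by fastforce
  then obtain g where g: "\<And>n. g n \<in> G" "\<And>n. J (g n) < m + 1 / (real n + 1)" by metis
  define s where "s = (\<lambda>n. fst (g n))"
  define t where "t = (\<lambda>n. snd (g n))"
  have st: "(s n, t n) \<in> G" for n using g(1) by (simp add: s_def t_def)
  have sH: "s n \<in> H" for n using st G(1) by blast
  have Jst: "J (s n, t n) < m + 1 / (real n + 1)" for n using g(2) by (simp add: s_def t_def)
  have inv0: "(\<lambda>n. 1 / (real n + 1)) \<longlonglongrightarrow> 0"
    using LIMSEQ_inverse_real_of_nat by (simp add: inverse_eq_divide add.commute)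
  have gap: "(nrm (s i - s j))\<^sup>2 \<le> 4 * (1 / (real i + 1) + 1 / (real j + 1))" for i j
  proof -
    \<comment> \<open>the midpoint of two almost minimisers is again in the graph: parallelogram law\<close>
    have "(cscale (1/2) (s i + s j), 1/2 * (t i + t j)) \<in> G" by (intro scl add st)
    then have "m \<le> J (cscale (1/2) (s i + s j), 1/2 * (t i + t j))" by (rule mle)
    also have "\<dots> = ((nrm (s i))\<^sup>2 + 2 * Re (ip (s i) (s j)) + (nrm (s j))\<^sup>2) / 8 - Re (t i) / 2 - Re (t j) / 2"
      using sH by (simp add: J_def nrm_scale power_mult_distrib nrm_sq_add power_divide)
        (simp add: add_divide_distrib)
    finally have "m \<le> ((nrm (s i))\<^sup>2 + 2 * Re (ip (s i) (s j)) + (nrm (s j))\<^sup>2) / 8 - Re (t i) / 2 - Re (t j) / 2" .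
    moreover have "8 * M \<le> A + B - 4 * T - 4 * U" if "M \<le> (A + B) / 8 - T / 2 - U / 2" for A B M T U :: real
      using that by (simp add: field_simps)
    ultimately have "8 * m \<le> (nrm (s i))\<^sup>2 + 2 * Re (ip (s i) (s j)) + (nrm (s j))\<^sup>2 - 4 * Re (t i) - 4 * Re (t j)"
      by blast
    then have "(nrm (s i - s j))\<^sup>2 \<le> 4 * (J (s i, t i) + J (s j, t j) - 2 * m)"
      using sH by (simp add: J_def nrm_sq_diff)
    then show ?thesis using Jst[of i] Jst[of j] by (simp add: algebra_simps)
  qed
  obtain u where u: "u \<in> H" "(\<lambda>n. nrm (s n - u)) \<longlonglongrightarrow> 0"
  proof (rule complete[OF sH])
    fix e :: real assume e: "e > 0"
    have "\<forall>\<^sub>F n in sequentially. 1 / (real n + 1) < e\<^sup>2 / 8"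
      using order_tendstoD(2)[OF inv0, of "e\<^sup>2 / 8"] e by simp
    then obtain N where N: "\<And>n. n \<ge> N \<Longrightarrow> 1 / (real n + 1) < e\<^sup>2 / 8"
      unfolding eventually_sequentially by blast
    have "nrm (s i - s j) < e" if "i \<ge> N" "j \<ge> N" for i j
    proof -
      have "(nrm (s i - s j))\<^sup>2 \<le> 4 * (1 / (real i + 1) + 1 / (real j + 1))" by (rule gap)
      also have "\<dots> < 4 * (e\<^sup>2 / 8 + e\<^sup>2 / 8)" using N[OF that(1)] N[OF that(2)] by (intro mult_strict_left_mono add_strict_mono) auto
      finally have "(nrm (s i - s j))\<^sup>2 < e\<^sup>2" by simp
      then show ?thesis using e power2_less_imp_less[of _ e] by simp
    qed
    then show "\<exists>N. \<forall>i\<ge>N. \<forall>j\<ge>N. nrm (s i - s j) < e" by blast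
  qed
  have rep: "ip x u = l" if xl: "(x, l) \<in> G" for x l
  proof -
    have x: "x \<in> H" using xl G by blast
    define d where "d = ip x u - l"
    have var: "0 \<le> Re (c * d) + (cmod c * nrm x)\<^sup>2 / 2" for c
    proof -
      have 1: "- (1 / (real n + 1)) \<le> Re (c * ip x (s n) - c * l) + (cmod c * nrm x)\<^sup>2 / 2" for n
      proof -
        have "m \<le> J (cscale c x + s n, c * l + t n)" by (intro mle add scl st xl)
        also have "\<dots> = J (s n, t n) + Re (c * ip x (s n) - c * l) + (cmod c * nrm x)\<^sup>2 / 2"
          using sH x by (simp add: J_def nrm_sq_add nrm_scale ip_scale_left add_divide_distrib)
        finally show ?thesis using Jst[of n] by linarith
      qed
      have "(\<lambda>n. Re (c * ip x (s n) - c * l) + (cmod c * nrm x)\<^sup>2 / 2)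
          \<longlonglongrightarrow> Re (c * ip x u - c * l) + (cmod c * nrm x)\<^sup>2 / 2"
        by (intro tendsto_intros tendsto_ip_right sH u x)
      then have "- 0 \<le> Re (c * ip x u - c * l) + (cmod c * nrm x)\<^sup>2 / 2"
        by (rule tendsto_le[OF _ _ tendsto_minus[OF inv0], rotated]) (use 1 in auto)
      then show ?thesis by (simp add: d_def algebra_simps)
    qed
    have "d = 0"
    proof (rule ccontr)
      assume d: "d \<noteq> 0"
      \<comment> \<open>a step small enough for the linear term of the variation to win\<close>
      define a where "a = 1 / (1 + (nrm x)\<^sup>2)"
      have a: "a > 0" "a * (nrm x)\<^sup>2 < 1"
        using x by (auto simp: a_def field_simps add_pos_nonneg)
      have "Re (of_real (- a) * cnj d * d) = - a * (cmod d)\<^sup>2"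
        unfolding cmod_power2 by (simp add: power2_eq_square algebra_simps)
      then have "a * (cmod d)\<^sup>2 \<le> (a * cmod d * nrm x)\<^sup>2 / 2"
        using var[of "of_real (- a) * cnj d"] a by (simp add: norm_mult)
      also have "\<dots> = (a * (cmod d)\<^sup>2) * (a * (nrm x)\<^sup>2) / 2" by (simp add: power2_eq_square)
      also have "\<dots> < a * (cmod d)\<^sup>2"
      proof -
        have "(a * (cmod d)\<^sup>2) * (a * (nrm x)\<^sup>2) < (a * (cmod d)\<^sup>2) * 1"
          using a d by (intro mult_strict_left_mono) auto
        moreover have "0 < a * (cmod d)\<^sup>2" using a d by simp
        ultimately show ?thesis by linarith
      qed
      finally show False by simp
    qed
    then show ?thesis by (simp add: d_def)
  qed
  have "nrm u * nrm u \<le> C * nrm u"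
  proof (rule tendsto_le[of sequentially])
    show "(\<lambda>n. C * nrm (s n)) \<longlonglongrightarrow> C * nrm u" by (intro tendsto_intros tendsto_nrm sH u)
    have "(\<lambda>n. cmod (ip (s n) u)) \<longlonglongrightarrow> cmod (ip u u)"
      by (intro tendsto_norm tendsto_ip_left sH u)
    then show "(\<lambda>n. cmod (ip (s n) u)) \<longlonglongrightarrow> nrm u * nrm u"
      using ip_self[OF u(1)] by (simp add: power2_eq_square norm_mult u)
    show "\<forall>\<^sub>F n in sequentially. cmod (ip (s n) u) \<le> C * nrm (s n)"
      using rep[OF st] bd[OF st] by simp
  qed simp
  then have "nrm u \<le> C"
    using C nrm_ge0[OF u(1)] by (cases "nrm u = 0") auto
  then show ?thesis
    using that[of u s] u rep st by (metis fst_conv image_eqI)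
qed

end

section \<open>Reproducing kernels and multipliers\<close>

locale reproducing_space =
  fixes X :: "'a set" and k :: "'a \<Rightarrow> 'a \<Rightarrow> complex" and H ip
  assumes rk: "rkhs X k H ip"

sublocale reproducing_space \<subseteq> hilbert_functions H ip
  using rk by unfold_locales (simp add: rkhs_def)

context reproducing_space
begin

definition kern :: "'a \<Rightarrow> 'a \<Rightarrow> complex" where "kern z = restrict0 X (\<lambda>w. k w z)"

definition comb :: "'a set \<Rightarrow> ('a \<Rightarrow> complex) \<Rightarrow> 'a \<Rightarrow> complex" where
  "comb S c = (\<Sum>z\<in>S. cscale (c z) (kern z))"

lemma supp: "f \<in> H \<Longrightarrow> z \<notin> X \<Longrightarrow> f z = 0"
  using rk by (simp add: rkhs_def supported_on_def)

lemma kern_mem [simp]: "z \<in> X \<Longrightarrow> kern z \<in> H"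
  using rk by (simp add: rkhs_def kern_def)

lemma reproduce: "f \<in> H \<Longrightarrow> z \<in> X \<Longrightarrow> ip f (kern z) = f z"
  using rk by (simp add: rkhs_def kern_def)

lemma reproduce': "f \<in> H \<Longrightarrow> z \<in> X \<Longrightarrow> ip (kern z) f = cnj (f z)"
  using ip_sym[of f "kern z"] reproduce[of f z] kern_mem[of z] by metis

lemma tendsto_eval:
  assumes "\<And>n. s n \<in> H" "u \<in> H" "(\<lambda>n. nrm (s n - u)) \<longlonglongrightarrow> 0"
  shows "(\<lambda>n. s n z) \<longlonglongrightarrow> u z"
proof (cases "z \<in> X")
  case True
  have "(\<lambda>n. ip (s n) (kern z)) \<longlonglongrightarrow> ip u (kern z)"
    by (rule tendsto_ip_left[OF assms(1,2) kern_mem[OF True] assms(3)])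
  then show ?thesis by (simp only: reproduce[OF assms(1) True] reproduce[OF assms(2) True])
next
  case False
  show ?thesis by (simp only: supp[OF assms(1) False] supp[OF assms(2) False] tendsto_const)
qed

lemma comb_mem: "S \<subseteq> X \<Longrightarrow> comb S c \<in> H"
  unfolding comb_def by (intro sum_mem scale_mem kern_mem) auto

lemma ip_comb: assumes "S \<subseteq> X" "f \<in> H" shows "ip (comb S c) f = (\<Sum>z\<in>S. c z * cnj (f z))"
proof -
  have "ip (comb S c) f = (\<Sum>z\<in>S. ip (cscale (c z) (kern z)) f)"
    unfolding comb_def using assms by (intro ip_sum_left scale_mem kern_mem) auto
  also have "\<dots> = (\<Sum>z\<in>S. c z * cnj (f z))"
    using assms by (intro sum.cong refl) (simp add: ip_scale_left reproduce' subset_iff)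
  finally show ?thesis .
qed

lemma comb_apply: "z \<in> X \<Longrightarrow> comb S c z = (\<Sum>w\<in>S. c w * k z w)"
  by (simp add: comb_def sum_fun_apply kern_def restrict0_def)

lemma k_sym: assumes "z \<in> X" "w \<in> X" shows "k w z = cnj (k z w)"
proof -
  have "kern z w = cnj (kern w z)"
    using ip_sym[OF kern_mem kern_mem, OF assms(2,1)]
    by (simp only: reproduce[OF kern_mem] assms)
  then show ?thesis using assms by (simp add: kern_def restrict0_def)
qed

lemma nrm_comb_sq:
  assumes "S \<subseteq> X"
  shows "of_real ((nrm (comb S c))\<^sup>2) = (\<Sum>z\<in>S. \<Sum>w\<in>S. c z * cnj (c w) * k w z)"
proof -
  have "of_real ((nrm (comb S c))\<^sup>2) = (\<Sum>z\<in>S. c z * cnj (comb S c z))"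
    unfolding ip_self[OF comb_mem[OF assms], symmetric] by (rule ip_comb[OF assms comb_mem[OF assms]])
  also have "\<dots> = (\<Sum>z\<in>S. \<Sum>w\<in>S. c z * cnj (c w) * k w z)"
  proof (intro sum.cong refl)
    fix z assume "z \<in> S"
    then have "z \<in> X" using assms by blast
    have "cnj (comb S c z) = (\<Sum>w\<in>S. cnj (c w) * k w z)"
      unfolding comb_apply[OF \<open>z \<in> X\<close>] cnj_sum using \<open>z \<in> X\<close> assms
      by (intro sum.cong refl) (simp only: complex_cnj_mult k_sym[OF \<open>z \<in> X\<close> subsetD[OF assms]])
    then show "c z * cnj (comb S c z) = (\<Sum>w\<in>S. c z * cnj (c w) * k w z)"
      by (simp add: sum_distrib_left mult.assoc)
  qed
  finally show ?thesis .
qed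

lemma comb_extend:
  assumes "finite T" "S \<subseteq> T" shows "comb S c = comb T (\<lambda>z. if z \<in> S then c z else 0)"
  unfolding comb_def
  by (rule sum.mono_neutral_cong_left) (use assms in \<open>auto simp: cscale_alg(3)\<close>)

lemma comb_add: "comb S c + comb S d = comb S (\<lambda>z. c z + d z)"
  by (simp only: comb_def sum.distrib[symmetric] cscale_alg(6))

lemma comb_scale: "cscale a (comb S c) = comb S (\<lambda>z. a * c z)"
  by (auto simp: fun_eq_iff comb_def sum_fun_apply sum_distrib_left mult.assoc)

text \<open>Riesz representation for the functional that sends \<open>kern z\<close> to \<open>cnj (h z)\<close>. Kernel functions may be
  linearly dependent, which is why the graph form of \<open>riesz\<close> is used.\<close>

lemma membership:
  assumes supp: "supported_on X h" and C: "C \<ge> 0"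
    and bd: "\<And>S c. finite S \<Longrightarrow> S \<subseteq> X \<Longrightarrow> cmod (\<Sum>z\<in>S. c z * cnj (h z)) \<le> C * nrm (comb S c)"
  shows "h \<in> H" "nrm h \<le> C"
proof -
  define L where "L = (\<lambda>S c. \<Sum>z\<in>S. c z * cnj (h z))"
  have L_ext: "L S c = L T (\<lambda>z. if z \<in> S then c z else 0)" if "finite T" "S \<subseteq> T" for S T c
    unfolding L_def by (rule sum.mono_neutral_cong_left) (use that in auto)
  define G where "G = {(comb S c, L S c) | S c. finite S \<and> S \<subseteq> X}"
  have GI: "(comb S c, L S c) \<in> G" if "finite S" "S \<subseteq> X" for S c using that by (auto simp: G_def)
  obtain u where u: "u \<in> H" "nrm u \<le> C" and rep: "\<And>x l. (x, l) \<in> G \<Longrightarrow> ip x u = l"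
  proof (rule riesz[of C G])
    show "(0, 0) \<in> G" using GI[of "{}" "\<lambda>_. 0"] by (simp add: comb_def L_def)
    show "x \<in> H" if "(x, l) \<in> G" for x l using that by (auto simp: G_def comb_mem)
    show "cmod l \<le> C * nrm x" if "(x, l) \<in> G" for x l using that bd by (auto simp: G_def L_def)
    show "(cscale a x, a * l) \<in> G" if xl: "(x, l) \<in> G" for a x l
    proof -
      obtain S c where S: "x = comb S c" "l = L S c" "finite S" "S \<subseteq> X"
        using xl unfolding G_def by blast
      have "a * L S c = L S (\<lambda>z. a * c z)" by (simp add: L_def sum_distrib_left mult.assoc)
      then show ?thesis using GI[OF S(3,4)] by (simp add: S comb_scale)
    qed
    show "(x + y, l + m) \<in> G" if xl: "(x, l) \<in> G" and ym: "(y, m) \<in> G" for x l y m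
    proof -
      obtain S c where S: "x = comb S c" "l = L S c" "finite S" "S \<subseteq> X"
        using xl unfolding G_def by blast
      obtain T d where T: "y = comb T d" "m = L T d" "finite T" "T \<subseteq> X"
        using ym unfolding G_def by blast
      let ?c = "\<lambda>z. if z \<in> S then c z else 0" and ?d = "\<lambda>z. if z \<in> T then d z else 0"
      have fin: "finite (S \<union> T)" using S T by simp
      have "x + y = comb (S \<union> T) ?c + comb (S \<union> T) ?d"
        unfolding S(1) T(1) using comb_extend[OF fin, of S c] comb_extend[OF fin, of T d] by simp
      moreover have "l + m = L (S \<union> T) ?c + L (S \<union> T) ?d"
        unfolding S(2) T(2) using L_ext[OF fin, of S c] L_ext[OF fin, of T d] by simp
      moreover have "\<dots> = L (S \<union> T) (\<lambda>z. ?c z + ?d z)"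
        by (simp only: L_def sum.distrib[symmetric] distrib_right)
      ultimately show ?thesis using GI[OF fin, of "\<lambda>z. ?c z + ?d z"] S T by (simp only: comb_add Un_least)
    qed
  qed (use C in auto)
  have "u z = h z" for z
  proof (cases "z \<in> X")
    case True
    have "(kern z, cnj (h z)) \<in> G" using GI[of "{z}" "\<lambda>_. 1"] True by (simp add: comb_def L_def cscale_alg(2))
    then have "cnj (u z) = cnj (h z)" using rep reproduce'[OF u(1) True] by metis
    then show ?thesis by simp
  next
    case False
    then show ?thesis using supp u(1) by (simp add: reproducing_space.supp[OF reproducing_space_axioms] supported_on_def)
  qed
  then have "u = h" by blast
  then show "h \<in> H" "nrm h \<le> C" using u by auto
qed

text \<open>Weak compactness of balls, in the form needed here: the criterion for membership only involves
  finitely many values of the function.\<close>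

lemma pointwise_limit:
  assumes h: "\<And>n. h n \<in> H" "\<And>n. nrm (h n) \<le> C" and g: "supported_on X g"
    and lim: "\<And>z. z \<in> X \<Longrightarrow> (\<lambda>n. h n z) \<longlonglongrightarrow> g z"
  shows "g \<in> H" "nrm g \<le> C"
proof -
  have C: "C \<ge> 0" using nrm_ge0[OF h(1)] h(2) order_trans by blast
  have "cmod (\<Sum>z\<in>S. c z * cnj (g z)) \<le> C * nrm (comb S c)" if "finite S" "S \<subseteq> X" for S c
  proof (rule LIMSEQ_le_const2)
    show "(\<lambda>n. cmod (\<Sum>z\<in>S. c z * cnj (h n z))) \<longlonglongrightarrow> cmod (\<Sum>z\<in>S. c z * cnj (g z))"
      using that by (intro tendsto_intros lim) auto
    have "cmod (\<Sum>z\<in>S. c z * cnj (h n z)) \<le> C * nrm (comb S c)" for n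
    proof -
      have "cmod (\<Sum>z\<in>S. c z * cnj (h n z)) \<le> nrm (comb S c) * nrm (h n)"
        unfolding ip_comb[OF that(2) h(1), symmetric] by (intro cauchy_schwarz comb_mem that h)
      also have "\<dots> \<le> nrm (comb S c) * C" by (intro mult_left_mono h nrm_ge0 comb_mem that)
      finally show ?thesis by (simp add: mult.commute)
    qed
    then show "\<exists>N. \<forall>n\<ge>N. cmod (\<Sum>z\<in>S. c z * cnj (h n z)) \<le> C * nrm (comb S c)" by blast
  qed
  then show "g \<in> H" "nrm g \<le> C" using membership[OF g C] by blast+
qed

text \<open>Orthogonal projection of \<open>y\<close> to \<open>K\<close>: the functional \<open>ip _ y\<close> on \<open>K\<close> is represented by an element of
  \<open>K\<close>, which has the same values as \<open>y\<close> because \<open>K\<close> contains the kernel functions.\<close>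

lemma dense:
  assumes sub: "csubspace K" and K: "K \<subseteq> H" and kern: "\<And>z. z \<in> X \<Longrightarrow> kern z \<in> K"
    and closed: "\<And>s u. (\<And>n. s n \<in> K) \<Longrightarrow> u \<in> H \<Longrightarrow> (\<lambda>n::nat. nrm (s n - u)) \<longlonglongrightarrow> 0 \<Longrightarrow> u \<in> K"
  shows "H \<subseteq> K"
proof
  fix y assume y: "y \<in> H"
  have KD: "0 \<in> K" "\<And>f g. f \<in> K \<Longrightarrow> g \<in> K \<Longrightarrow> f + g \<in> K" "\<And>c f. f \<in> K \<Longrightarrow> cscale c f \<in> K"
    using sub unfolding csubspace_def by blast+
  define G where "G = (\<lambda>x. (x, ip x y)) ` K"
  obtain u s where u: "u \<in> H" "\<And>x l. (x, l) \<in> G \<Longrightarrow> ip x u = l"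
    and s: "\<And>n. s n \<in> fst ` G" "(\<lambda>n::nat. nrm (s n - u)) \<longlonglongrightarrow> 0"
  proof (rule riesz[of "nrm y" G])
    show "(0, 0) \<in> G" using KD(1) y by (auto simp: G_def image_iff)
    show "(x + x', l + l') \<in> G" if "(x, l) \<in> G" "(x', l') \<in> G" for x l x' l'
      using that KD(2)[of x x'] K y by (auto simp: G_def image_iff ip_add_left subset_iff)
    show "(cscale c x, c * l) \<in> G" if "(x, l) \<in> G" for x l c
      using that KD(3)[of x c] K y by (auto simp: G_def image_iff ip_scale_left subset_iff)
    show "cmod l \<le> nrm y * nrm x" if "(x, l) \<in> G" for x l
      using that cauchy_schwarz[of x y] K y by (auto simp: G_def mult.commute)
  qed (use K y in \<open>auto simp: G_def\<close>)
  have "u \<in> K" using closed[OF _ u(1) s(2)] s(1) by (force simp: G_def)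
  moreover have "u z = y z" for z
  proof (cases "z \<in> X")
    case True
    then have "(kern z, ip (kern z) y) \<in> G" using kern by (auto simp: G_def)
    then have "ip (kern z) u = ip (kern z) y" using u(2) by blast
    then show ?thesis using True u y by (simp add: reproduce')
  next
    case False
    then show ?thesis using supp[OF u(1)] supp[OF y] by simp
  qed
  then have "u = y" by blast
  ultimately show "y \<in> K" by blast
qed

text \<open>The vectors \<open>y\<close> with this property form a closed subspace that contains the kernel functions.\<close>

lemma weakly_null:
  assumes h: "\<And>n. h n \<in> H" "\<And>n. nrm (h n) \<le> C"
    and lim: "\<And>z. z \<in> X \<Longrightarrow> (\<lambda>n. h n z) \<longlonglongrightarrow> 0" and y: "y \<in> H"
  shows "(\<lambda>n. ip (h n) y) \<longlonglongrightarrow> 0"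
proof -
  define K where "K = {y \<in> H. (\<lambda>n. ip (h n) y) \<longlonglongrightarrow> 0}"
  have C: "C \<ge> 0" using nrm_ge0[OF h(1)] h(2) order_trans by blast
  have "H \<subseteq> K"
  proof (rule dense)
    show "csubspace K"
      unfolding csubspace_def K_def
    proof (intro conjI ballI allI)
      fix f g assume "f \<in> {y \<in> H. (\<lambda>n. ip (h n) y) \<longlonglongrightarrow> 0}" "g \<in> {y \<in> H. (\<lambda>n. ip (h n) y) \<longlonglongrightarrow> 0}"
      then show "f + g \<in> {y \<in> H. (\<lambda>n. ip (h n) y) \<longlonglongrightarrow> 0}"
        using tendsto_add_zero[of "\<lambda>n. ip (h n) f" sequentially "\<lambda>n. ip (h n) g"] h by (simp add: ip_add_right)
    next
      fix c f assume "f \<in> {y \<in> H. (\<lambda>n. ip (h n) y) \<longlonglongrightarrow> 0}"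
      then show "cscale c f \<in> {y \<in> H. (\<lambda>n. ip (h n) y) \<longlonglongrightarrow> 0}"
        using tendsto_mult_right_zero[of "\<lambda>n. ip (h n) f" sequentially "cnj c"] h by (simp add: ip_scale_right)
    qed (use h in simp)
    show "K \<subseteq> H" by (auto simp: K_def)
    show "kern z \<in> K" if "z \<in> X" for z
      using that lim[OF that] h by (simp add: K_def reproduce)
    fix s u assume s: "\<And>n. s n \<in> K" and u: "u \<in> H" and su: "(\<lambda>n::nat. nrm (s n - u)) \<longlonglongrightarrow> 0"
    have "(\<lambda>n. ip (h n) u) \<longlonglongrightarrow> 0"
    proof (rule tendstoI)
      fix e :: real assume e: "e > 0"
      have "(\<lambda>j. C * nrm (s j - u)) \<longlonglongrightarrow> 0" using tendsto_mult_right_zero[OF su] .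
      then have "\<forall>\<^sub>F j in sequentially. C * nrm (s j - u) < e / 2"
        using order_tendstoD(2)[of _ 0 sequentially "e / 2"] e by simp
      then obtain j where j: "C * nrm (s j - u) < e / 2" by (auto simp: eventually_sequentially)
      have sj: "s j \<in> H" "(\<lambda>n. ip (h n) (s j)) \<longlonglongrightarrow> 0" using s[of j] by (auto simp: K_def)
      have "\<forall>\<^sub>F n in sequentially. cmod (ip (h n) (s j)) < e / 2"
        using order_tendstoD(2)[OF tendsto_norm_zero[OF sj(2)], of "e / 2"] e by simp
      then show "\<forall>\<^sub>F n in sequentially. dist (ip (h n) u) 0 < e"
      proof eventually_elim
        case (elim n)
        have "cmod (ip (h n) (s j - u)) \<le> nrm (h n) * nrm (s j - u)"
          by (intro cauchy_schwarz h diff_mem sj u)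
        also have "\<dots> \<le> C * nrm (s j - u)" by (intro mult_right_mono h nrm_ge0 diff_mem sj u)
        finally have "cmod (ip (h n) (s j) - ip (h n) u) < e / 2"
          using j by (simp only: ip_diff_right[OF sj(1) u h(1)])
        then show ?case using elim norm_triangle_ineq2[of "ip (h n) u" "ip (h n) (s j)"]
          by (simp add: norm_minus_commute)
      qed
    qed
    then show "u \<in> K" using u by (simp add: K_def)
  qed
  then show ?thesis using y by (auto simp: K_def)
qed

end

context reproducing_space
begin

definition mult :: "('a \<Rightarrow> complex) \<Rightarrow> bool" where
  "mult f \<longleftrightarrow> (\<forall>g\<in>H. f * g \<in> H)"

abbreviation mnorm :: "('a \<Rightarrow> complex) \<Rightarrow> real" where
  "mnorm \<equiv> multiplier_norm H ip"

lemma multD: "mult f \<Longrightarrow> g \<in> H \<Longrightarrow> f * g \<in> H"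
  by (simp add: mult_def)

lemma mult_add: "mult f \<Longrightarrow> mult g \<Longrightarrow> mult (f + g)"
  by (simp add: mult_def distrib_right)

lemma cscale_times: "cscale c f * g = cscale c (f * g)" "f * cscale c g = cscale c (f * (g :: 'b \<Rightarrow> complex))"
  by (auto simp: fun_eq_iff)

lemma mult_scale: "mult f \<Longrightarrow> mult (cscale c f)"
  by (simp add: mult_def cscale_times)

lemma mult_diff: "mult f \<Longrightarrow> mult g \<Longrightarrow> mult (f - g)"
  by (simp add: mult_def left_diff_distrib)

lemma mult_zero: "mult 0"
  by (simp add: mult_def)

lemma mult_sum: "(\<And>i. i \<in> S \<Longrightarrow> mult (F i)) \<Longrightarrow> mult (\<Sum>i\<in>S. F i)"
  by (induction S rule: infinite_finite_induct) (auto simp: mult_zero mult_add)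

text \<open>The closed graph theorem for multipliers, by nested balls. The function
  \<open>g \<mapsto> \<parallel>f g\<parallel>\<close> is lower semicontinuous because pointwise limits do not increase the norm;
  were it unbounded on the unit ball, every ball would contain a smaller one on which it exceeds
  a prescribed number.\<close>

lemma mult_bounded:
  assumes f: "mult f"
  shows "\<exists>C\<ge>0. \<forall>g\<in>H. nrm (f * g) \<le> C * nrm g"
proof (rule ccontr)
  assume neg: "\<not> ?thesis"
  have big: "\<exists>h\<in>H. nrm h \<le> \<delta> \<and> nrm (f * h) > R" if \<delta>: "\<delta> > 0" and R: "R \<ge> 0" for \<delta> R
  proof -
    have "R / \<delta> \<ge> 0" using that by simp
    then obtain g where g: "g \<in> H" "nrm (f * g) > R / \<delta> * nrm g"
      using neg not_le by blast
    have "g \<noteq> 0" using g(2) by auto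
    then have pos: "nrm g > 0" using nrm_eq_0[OF g(1)] nrm_ge0[OF g(1)] by linarith
    have "nrm (cscale (of_real (\<delta> / nrm g)) g) = \<delta>"
      using pos \<delta> g by (simp add: nrm_scale norm_divide)
    moreover have "nrm (f * cscale (of_real (\<delta> / nrm g)) g) = \<delta> / nrm g * nrm (f * g)"
      using pos \<delta> multD[OF f g(1)] by (simp add: cscale_times nrm_scale norm_divide)
    moreover have "\<delta> / nrm g * nrm (f * g) > R"
    proof -
      have "\<delta> / nrm g * (R / \<delta> * nrm g) < \<delta> / nrm g * nrm (f * g)"
        using pos \<delta> g(2) by (intro mult_strict_left_mono) auto
      then show ?thesis using pos \<delta> by simp
    qed
    ultimately show ?thesis
      by (intro bexI[of _ "cscale (of_real (\<delta> / nrm g)) g"] scale_mem g) auto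
  qed
  have lsc: "\<exists>\<epsilon>>0. \<forall>g'\<in>H. nrm (g' - g) \<le> \<epsilon> \<longrightarrow> nrm (f * g') > R"
    if g: "g \<in> H" "nrm (f * g) > R" for g R
  proof (rule ccontr)
    assume "\<not> ?thesis"
    then have "\<exists>g'\<in>H. nrm (g' - g) \<le> 1 / real (Suc n) \<and> \<not> nrm (f * g') > R" for n
      by (metis of_nat_0_less_iff zero_less_Suc zero_less_divide_1_iff)
    then obtain s where s: "\<And>n. s n \<in> H" "\<And>n. nrm (s n - g) \<le> 1 / real (Suc n)" "\<And>n. nrm (f * s n) \<le> R"
      unfolding not_less by metis
    have "(\<lambda>n. nrm (s n - g)) \<longlonglongrightarrow> 0"
    proof (rule tendsto_sandwich[of "\<lambda>_. 0"])
      show "(\<lambda>n. 1 / real (Suc n)) \<longlonglongrightarrow> 0"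
        using LIMSEQ_inverse_real_of_nat by (simp add: inverse_eq_divide)
    qed (use s g in auto)
    then have "(\<lambda>n. s n z) \<longlonglongrightarrow> g z" for z by (intro tendsto_eval s g)
    then have lim: "(\<lambda>n. (f * s n) z) \<longlonglongrightarrow> (f * g) z" for z
      unfolding times_fun_apply by (intro tendsto_mult_left)
    have "nrm (f * g) \<le> R"
    proof (rule pointwise_limit(2)[of "\<lambda>n. f * s n"])
      show "supported_on X (f * g)"
        using supp[OF multD[OF f g(1)]] by (simp only: supported_on_def) blast
    qed (intro multD f s lim)+
    then show False using g(2) by simp
  qed
  define P where "P = (\<lambda>(n::nat) (x, \<epsilon>::real). x \<in> H \<and> \<epsilon> > 0 \<and> \<epsilon> \<le> (1/2) ^ n)"
  define Q where "Q = (\<lambda>n (x, \<epsilon>) (x', \<epsilon>'). nrm (x' - x) \<le> \<epsilon> / 2 \<and> \<epsilon>' \<le> \<epsilon> / 2 \<and>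
      (\<forall>g\<in>H. nrm (g - x') \<le> \<epsilon>' \<longrightarrow> nrm (f * g) > real n))"
  have "\<exists>b. \<forall>n. P n (b n) \<and> Q n (b n) (b (Suc n))"
  proof (rule dependent_nat_choice)
    show "\<exists>b. P 0 b" by (rule exI[of _ "(0, 1)"]) (simp add: P_def)
    fix b n assume Pb: "P n b"
    obtain x \<epsilon> where b: "b = (x, \<epsilon>)" by fastforce
    have x: "x \<in> H" "\<epsilon> > 0" "\<epsilon> \<le> (1/2) ^ n" using Pb by (auto simp: P_def b)
    have "\<exists>x'\<in>H. nrm (x' - x) \<le> \<epsilon> / 2 \<and> nrm (f * x') > real n"
    proof (cases "nrm (f * x) > real n")
      case True
      then show ?thesis using x by (intro bexI[of _ x]) auto
    next
      case False
      obtain h where h: "h \<in> H" "nrm h \<le> \<epsilon> / 2" "nrm (f * h) > 2 * real n"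
        using big[of "\<epsilon> / 2" "2 * real n"] x by auto
      have "f * h = f * (x + h) - f * x" by (simp add: distrib_left)
      then have "nrm (f * h) \<le> nrm (f * (x + h)) + nrm (f * x)"
        using nrm_triangle_diff[of "f * (x + h)" "f * x"] multD[OF f] x h by simp
      then have "nrm (f * (x + h)) > real n" using h False by linarith
      then show ?thesis using h x by (intro bexI[of _ "x + h"]) auto
    qed
    then obtain x' where x': "x' \<in> H" "nrm (x' - x) \<le> \<epsilon> / 2" "nrm (f * x') > real n" by blast
    obtain e where e: "e > 0" "\<forall>g\<in>H. nrm (g - x') \<le> e \<longrightarrow> nrm (f * g) > real n"
      using lsc[OF x'(1,3)] by blast
    \<comment> \<open>in the next ball, the norm of the product exceeds \<open>n\<close> everywhere\<close>
    show "\<exists>b'. P (Suc n) b' \<and> Q n b b'"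
      by (rule exI[of _ "(x', min e (\<epsilon> / 2))"]) (use x x' e in \<open>auto simp: P_def Q_def b\<close>)
  qed
  then obtain b where b: "\<And>n. P n (b n)" "\<And>n. Q n (b n) (b (Suc n))" by blast
  define x where "x = (\<lambda>n. fst (b n))"
  define \<epsilon> where "\<epsilon> = (\<lambda>n. snd (b n))"
  have beq: "b n = (x n, \<epsilon> n)" for n by (simp add: x_def \<epsilon>_def)
  have x: "x n \<in> H" "\<epsilon> n > 0" "\<epsilon> n \<le> (1/2) ^ n" for n using b(1)[of n] by (auto simp: beq P_def)
  have step: "nrm (x (Suc n) - x n) \<le> \<epsilon> n / 2" "\<epsilon> (Suc n) \<le> \<epsilon> n / 2"
    "\<And>g. g \<in> H \<Longrightarrow> nrm (g - x (Suc n)) \<le> \<epsilon> (Suc n) \<Longrightarrow> nrm (f * g) > real n" for n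
    using b(2)[of n] by (auto simp: beq Q_def)
  \<comment> \<open>the radii at least halve, so the sum of all later steps is at most \<open>\<epsilon> n\<close>\<close>
  have near: "nrm (x (n + j) - x n) \<le> \<epsilon> n - \<epsilon> (n + j)" for n j
  proof (induction j)
    case (Suc j)
    have "x (n + Suc j) - x n = (x (Suc (n + j)) - x (n + j)) + (x (n + j) - x n)" by simp
    then have "nrm (x (n + Suc j) - x n) \<le> nrm (x (Suc (n + j)) - x (n + j)) + nrm (x (n + j) - x n)"
      using nrm_triangle[OF diff_mem[OF x(1) x(1)] diff_mem[OF x(1) x(1)]] by metis
    then show ?case using Suc step(1,2)[of "n + j"] by (simp del: minus_apply)
  next
    case 0
    have "x n - x n = 0" by simp
    then show ?case by (simp only: add_0_right nrm_zero)
  qed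
  have near': "nrm (x m - x n) \<le> \<epsilon> n" if "n \<le> m" for m n
    using near[of n "m - n"] x(2)[of m] that by simp
  obtain u where u: "u \<in> H" "(\<lambda>n. nrm (x n - u)) \<longlonglongrightarrow> 0"
  proof (rule complete[of x])
    fix e :: real assume "e > 0"
    then obtain N where N: "(1/2) ^ N < e / 2" using real_arch_pow_inv[of "e/2" "1/2"] by auto
    have "nrm (x i - x j) < e" if "i \<ge> N" "j \<ge> N" for i j
    proof -
      have "x i - x j = (x i - x N) - (x j - x N)" by simp
      then have "nrm (x i - x j) \<le> nrm (x i - x N) + nrm (x j - x N)"
        using nrm_triangle_diff[OF diff_mem[OF x(1) x(1)] diff_mem[OF x(1) x(1)]] by metis
      then show ?thesis using near'[OF that(1)] near'[OF that(2)] x(3)[of N] N by linarith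
    qed
    then show "\<exists>N. \<forall>m\<ge>N. \<forall>n\<ge>N. nrm (x m - x n) < e" by blast
  qed (use x in auto)
  have "nrm (u - x n) \<le> \<epsilon> n" for n
  proof -
    have "nrm (u - x n) \<le> \<epsilon> n + nrm (x (n + m) - u)" for m
    proof -
      have "u - x n = (x (n + m) - x n) - (x (n + m) - u)" by simp
      then have "nrm (u - x n) \<le> nrm (x (n + m) - x n) + nrm (x (n + m) - u)"
        using nrm_triangle_diff[OF diff_mem[OF x(1) x(1)] diff_mem[OF x(1) u(1)]] by metis
      then show ?thesis using near'[of n "n + m"] by simp
    qed
    moreover have "(\<lambda>m. \<epsilon> n + nrm (x (n + m) - u)) \<longlonglongrightarrow> \<epsilon> n + 0"
      using LIMSEQ_ignore_initial_segment[OF u(2), of n] by (intro tendsto_intros) (simp add: add.commute)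
    ultimately show ?thesis by (intro LIMSEQ_le_const[of _ "\<epsilon> n"]) auto
  qed
  then have "nrm (f * u) > real n" for n using step(3)[OF u(1), of n] by blast
  then show False using reals_Archimedean2[of "nrm (f * u)"] by (meson less_asym)
qed

lemma mnorm_bdd:
  assumes "mult f" shows "bdd_above ((\<lambda>g. nrm (f * g)) ` {g \<in> H. nrm g \<le> 1})"
proof -
  obtain C where C: "C \<ge> 0" "\<And>g. g \<in> H \<Longrightarrow> nrm (f * g) \<le> C * nrm g" using mult_bounded[OF assms] by blast
  show ?thesis
  proof (rule bdd_aboveI2[of _ _ C])
    fix g assume "g \<in> {g \<in> H. nrm g \<le> 1}"
    then show "nrm (f * g) \<le> C" using C(2)[of g] mult_left_mono[of "nrm g" 1 C] C(1) by simp
  qed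
qed

lemma mnorm_alt: "mnorm f = (SUP g\<in>{g \<in> H. nrm g \<le> 1}. nrm (f * g))"
  by (simp add: multiplier_norm_def operator_norm_def multiplication_op_def)

lemma mnorm_ge0: assumes "mult f" shows "mnorm f \<ge> 0"
  unfolding mnorm_alt
  by (rule cSUP_upper2[OF mnorm_bdd[OF assms], of 0]) simp_all

lemma mnorm_bound: assumes f: "mult f" and g: "g \<in> H" shows "nrm (f * g) \<le> mnorm f * nrm g"
proof (cases "g = 0")
  case False
  then have pos: "nrm g > 0" using nrm_eq_0[OF g] nrm_ge0[OF g] by linarith
  let ?g = "cscale (of_real (1 / nrm g)) g"
  have "nrm ?g = 1" using pos g by (simp add: nrm_scale norm_divide)
  then have "nrm (f * ?g) \<le> mnorm f"
    unfolding mnorm_alt by (intro cSUP_upper mnorm_bdd f CollectI conjI scale_mem g) (simp del: cscale_apply)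
  moreover have "nrm (f * ?g) = nrm (f * g) / nrm g"
    using pos g multD[OF f g] by (simp add: cscale_times nrm_scale norm_divide)
  ultimately show ?thesis using pos by (simp add: pos_divide_le_eq)
qed simp

lemma mnorm_le:
  assumes "C \<ge> 0" "\<And>g. g \<in> H \<Longrightarrow> nrm (f * g) \<le> C * nrm g" shows "mnorm f \<le> C"
  unfolding mnorm_alt
proof (rule cSUP_least)
  have "0 \<in> {g \<in> H. nrm g \<le> 1}" by (intro CollectI conjI zero_mem) simp
  then show "{g \<in> H. nrm g \<le> 1} \<noteq> {}" by blast
  fix g assume "g \<in> {g \<in> H. nrm g \<le> 1}"
  then show "nrm (f * g) \<le> C" using assms(2)[of g] mult_left_mono[of "nrm g" 1 C] assms(1) by simp
qed

lemma mnorm_triangle: assumes "mult f" "mult g" shows "mnorm (f + g) \<le> mnorm f + mnorm g"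
proof (rule mnorm_le)
  show "0 \<le> mnorm f + mnorm g" using assms by (simp add: mnorm_ge0)
  fix h assume h: "h \<in> H"
  have "nrm ((f + g) * h) \<le> nrm (f * h) + nrm (g * h)"
    unfolding distrib_right by (intro nrm_triangle multD assms h)
  then show "nrm ((f + g) * h) \<le> (mnorm f + mnorm g) * nrm h"
    using mnorm_bound[OF assms(1) h] mnorm_bound[OF assms(2) h] by (simp add: distrib_right)
qed

lemma mnorm_scale_le: assumes "mult f" shows "mnorm (cscale c f) \<le> cmod c * mnorm f"
proof (rule mnorm_le)
  show "0 \<le> cmod c * mnorm f" using assms by (simp add: mnorm_ge0)
  fix h assume h: "h \<in> H"
  show "nrm (cscale c f * h) \<le> cmod c * mnorm f * nrm h"
    using mnorm_bound[OF assms h] multD[OF assms h]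
    by (simp add: cscale_times nrm_scale mult_left_mono mult.assoc)
qed

lemma mnorm_scale: assumes "mult f" shows "mnorm (cscale c f) = cmod c * mnorm f"
proof (cases "c = 0")
  case True
  then show ?thesis using mnorm_scale_le[OF assms, of c] mnorm_ge0[OF mult_scale[OF assms, of c]] by simp
next
  case False
  have "mnorm (cscale (1 / c) (cscale c f)) \<le> cmod (1 / c) * mnorm (cscale c f)"
    by (intro mnorm_scale_le mult_scale assms)
  then have "cmod c * mnorm f \<le> mnorm (cscale c f)"
    using False by (simp add: cscale_alg(1,2) norm_divide field_simps)
  then show ?thesis using mnorm_scale_le[OF assms, of c] by linarith
qed

lemma mnorm_minus: "mult f \<Longrightarrow> mnorm (- f) = mnorm f"
  using mnorm_scale[of f "-1"] by (simp add: cscale_alg(7))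

lemma mnorm_triangle_diff: "mult f \<Longrightarrow> mult g \<Longrightarrow> mnorm (f - g) \<le> mnorm f + mnorm g"
  using mnorm_triangle[of f "cscale (-1) g"] mult_scale[of g "-1"] mnorm_minus[of g]
  by (simp only: diff_cscale cscale_alg(7))

lemma mnorm_sum: "(\<And>i. i \<in> S \<Longrightarrow> mult (F i)) \<Longrightarrow> mnorm (\<Sum>i\<in>S. F i) \<le> (\<Sum>i\<in>S. mnorm (F i))"
proof (induction S rule: infinite_finite_induct)
  case (insert x S)
  have "mnorm (F x + sum F S) \<le> mnorm (F x) + mnorm (sum F S)"
    using insert.prems by (intro mnorm_triangle mult_sum) auto
  also have "mnorm (sum F S) \<le> (\<Sum>i\<in>S. mnorm (F i))" using insert by blast
  finally show ?case by (simp only: sum.insert[OF insert.hyps(1,2)])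
qed (use mnorm_le[of 0 0] mnorm_ge0[OF mult_zero] in \<open>auto\<close>)

text \<open>The adjoint of multiplication by \<open>f\<close> sends \<open>kern z\<close> to \<open>cnj (f z)\<close> times itself.\<close>

lemma adjoint_bound:
  assumes f: "mult f" and S: "S \<subseteq> X"
  shows "nrm (comb S (\<lambda>z. c z * cnj (f z))) \<le> mnorm f * nrm (comb S c)"
proof -
  let ?y = "comb S c" and ?w = "comb S (\<lambda>z. c z * cnj (f z))"
  have y: "?y \<in> H" and w: "?w \<in> H" by (intro comb_mem S)+
  have "ip ?w ?w = ip ?y (f * ?w)"
    by (simp only: ip_comb[OF S w] ip_comb[OF S multD[OF f w]] times_fun_apply complex_cnj_mult mult.assoc)
  then have "nrm ?w * nrm ?w = cmod (ip ?y (f * ?w))"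
    using ip_self[OF w] nrm_ge0[OF w] by (metis norm_of_real abs_of_nonneg power2_eq_square zero_le_power2)
  also have "\<dots> \<le> nrm ?y * nrm (f * ?w)" by (intro cauchy_schwarz y multD f w)
  also have "\<dots> \<le> nrm ?y * (mnorm f * nrm ?w)" by (intro mult_left_mono mnorm_bound f w nrm_ge0 y)
  finally have le: "nrm ?w * nrm ?w \<le> mnorm f * nrm ?y * nrm ?w" by (simp only: mult_ac)
  show ?thesis
  proof (cases "nrm ?w = 0")
    case True
    then show ?thesis using mnorm_ge0[OF f] nrm_ge0[OF y] by simp
  next
    case False
    then show ?thesis using le nrm_ge0[OF w] by (simp only: mult_le_cancel_right)
  qed
qed

text \<open>Conversely, a bound for the would-be adjoint on the kernel functions makes a function a
  multiplier.\<close>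

lemma multiplier_criterion:
  assumes C: "C \<ge> 0"
    and bd: "\<And>S c. finite S \<Longrightarrow> S \<subseteq> X \<Longrightarrow> nrm (comb S (\<lambda>z. c z * cnj (p z))) \<le> C * nrm (comb S c)"
  shows "mult p" "mnorm p \<le> C"
proof -
  have *: "p * g \<in> H \<and> nrm (p * g) \<le> C * nrm g" if g: "g \<in> H" for g
  proof -
    have sup: "supported_on X (p * g)" using supp[OF g] by (simp add: supported_on_def)
    have C': "C * nrm g \<ge> 0" using C g by simp
    have "cmod (\<Sum>z\<in>S. c z * cnj ((p * g) z)) \<le> C * nrm g * nrm (comb S c)" if S: "finite S" "S \<subseteq> X" for S c
    proof -
      have "(\<Sum>z\<in>S. c z * cnj ((p * g) z)) = ip (comb S (\<lambda>z. c z * cnj (p z))) g"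
        by (simp only: ip_comb[OF S(2) g] times_fun_apply complex_cnj_mult mult.assoc)
      then have "cmod (\<Sum>z\<in>S. c z * cnj ((p * g) z)) \<le> nrm (comb S (\<lambda>z. c z * cnj (p z))) * nrm g"
        using cauchy_schwarz[OF comb_mem[OF S(2)] g] by simp
      also have "\<dots> \<le> C * nrm (comb S c) * nrm g" by (intro mult_right_mono bd S nrm_ge0 g)
      finally show ?thesis by (simp only: mult_ac)
    qed
    then show ?thesis using membership[OF sup C'] by blast
  qed
  then show "mult p" by (simp add: mult_def)
  show "mnorm p \<le> C" using * C by (intro mnorm_le) auto
qed

text \<open>The values of a multiplier are, up to conjugation, eigenvalues of the adjoint operator.\<close>

lemma mult_eval_bound:
  assumes f: "mult f" and z: "z \<in> X" "k z z \<noteq> 0" shows "cmod (f z) \<le> mnorm f"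
proof -
  have kz: "kern z \<in> H" using z by simp
  have "kern z \<noteq> 0" using z by (auto simp: kern_def restrict0_def fun_eq_iff)
  then have pos: "nrm (kern z) > 0" using nrm_eq_0[OF kz] nrm_ge0[OF kz] by linarith
  have "ip (f * kern z) (kern z) = f z * ip (kern z) (kern z)"
    using z by (simp only: reproduce[OF multD[OF f kz]] reproduce[OF kz] times_fun_apply)
  then have "cmod (f z) * (nrm (kern z) * nrm (kern z)) = cmod (ip (f * kern z) (kern z))"
    unfolding ip_self[OF kz] by (simp add: norm_mult norm_power power2_eq_square)
  also have "\<dots> \<le> nrm (f * kern z) * nrm (kern z)" by (intro cauchy_schwarz multD f kz)
  also have "\<dots> \<le> mnorm f * nrm (kern z) * nrm (kern z)" by (intro mult_right_mono mnorm_bound f kz nrm_ge0)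
  finally show ?thesis using pos by (simp add: mult.assoc[symmetric])
qed

end

context reproducing_space
begin

lemma restrict0_times: "g \<in> H \<Longrightarrow> restrict0 X f * g = f * g"
  using supp[of g] by (auto simp: fun_eq_iff restrict0_def)

lemma mult_restrict0 [simp]: "mult (restrict0 X f) \<longleftrightarrow> mult f"
  by (simp add: mult_def restrict0_times)

lemma mnorm_restrict0 [simp]: "mnorm (restrict0 X f) = mnorm f"
  unfolding mnorm_alt by (intro SUP_cong refl) (simp add: restrict0_times)

text \<open>The tails of the series are pointwise limits of finite sums with uniformly bounded norms.\<close>

lemma mult_series:
  assumes F: "\<And>m. mult (F m)" and sm: "summable (\<lambda>m. mnorm (F m))"
    and sup: "supported_on X g" "\<And>m. supported_on X (F m)"
    and lim: "\<And>z. z \<in> X \<Longrightarrow> (\<lambda>m. F m z) sums g z"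
  shows "mult g" "mnorm (g - (\<Sum>m<M. F m)) \<le> (\<Sum>m. mnorm (F (m + M)))"
proof -
  have *: "(g - (\<Sum>m<M. F m)) * h \<in> H \<and>
      nrm ((g - (\<Sum>m<M. F m)) * h) \<le> (\<Sum>m. mnorm (F (m + M))) * nrm h" if h: "h \<in> H" for h M
  proof -
    let ?C = "\<Sum>m. mnorm (F (m + M))"
    have smM: "summable (\<lambda>m. mnorm (F (m + M)))" using sm by (rule summable_ignore_initial_segment)
    define G where "G = (\<lambda>n. (\<Sum>m<n. F (m + M)))"
    have mG: "mult (G n)" for n unfolding G_def by (intro mult_sum F)
    have "mnorm (G n) \<le> ?C" for n
    proof -
      have "mnorm (G n) \<le> (\<Sum>m<n. mnorm (F (m + M)))" unfolding G_def by (intro mnorm_sum F)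
      also have "\<dots> \<le> ?C" by (intro sum_le_suminf smM) (auto intro: mnorm_ge0 F)
      finally show ?thesis .
    qed
    then have bd: "nrm (G n * h) \<le> ?C * nrm h" for n
      using mnorm_bound[OF mG h, of n] mult_right_mono[OF _ nrm_ge0[OF h]] order_trans by blast
    have sup': "supported_on X ((g - (\<Sum>m<M. F m)) * h)"
      using supp[OF h] by (simp add: supported_on_def)
    have lim': "(\<lambda>n. (G n * h) z) \<longlonglongrightarrow> ((g - (\<Sum>m<M. F m)) * h) z" if "z \<in> X" for z
    proof -
      have "(\<lambda>m. F (m + M) z) sums (g z - (\<Sum>m<M. F m z))"
        using sums_split_initial_segment[OF lim[OF that], of M] .
      then have "(\<lambda>n. (\<Sum>m<n. F (m + M) z) * h z) \<longlonglongrightarrow> (g z - (\<Sum>m<M. F m z)) * h z"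
        unfolding sums_def by (rule tendsto_mult_right)
      then show ?thesis by (simp add: G_def sum_fun_apply)
    qed
    show ?thesis using pointwise_limit[OF multD[OF mG h] bd sup' lim'] by blast
  qed
  show "mult g" unfolding mult_def using *[of _ 0] by simp
  have "0 \<le> (\<Sum>m. mnorm (F (m + M)))"
    by (intro suminf_nonneg summable_ignore_initial_segment[OF sm] mnorm_ge0 F)
  then show "mnorm (g - (\<Sum>m<M. F m)) \<le> (\<Sum>m. mnorm (F (m + M)))"
    using * by (intro mnorm_le) auto
qed

end

section \<open>Words and homogeneous polynomials\<close>

text \<open>Monomials are indexed by words in the coordinates instead of exponent vectors. A monomial then occurs
  once for each ordering of its factors, which absorbs the multinomial coefficients of
  \<open>\<langle>w, z\<rangle>^m\<close>.\<close>

definition words :: "nat \<Rightarrow> 'n::finite list set" where "words m = {l. length l = m}"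

definition wmon :: "'n list \<Rightarrow> complex ^ 'n \<Rightarrow> complex" where
  "wmon l z = prod_list (map (\<lambda>i. z $ i) l)"

definition homog :: "nat \<Rightarrow> ('n list \<Rightarrow> complex) \<Rightarrow> complex ^ 'n \<Rightarrow> complex" where
  "homog m b z = (\<Sum>l\<in>words m. b l * wmon l z)"

lemma finite_words [simp]: "finite (words m :: 'n::finite list set)"
  using finite_lists_length_eq[of "UNIV :: 'n set" m] by (simp add: words_def)

lemma words_0: "words 0 = {[]}"
  by (auto simp: words_def)

lemma sum_words_Suc: "(\<Sum>l\<in>words (Suc m). F l) = (\<Sum>i\<in>UNIV. \<Sum>l\<in>words m. (F (i # l) :: complex))"
proof -
  have im: "words (Suc m) = (\<lambda>(i, l). i # l) ` (UNIV \<times> words m)"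
    by (auto simp: words_def length_Suc_conv image_iff)
  have inj: "inj_on (\<lambda>(i, l). i # l) (UNIV \<times> words m)" by (auto simp: inj_on_def)
  have "(\<Sum>l\<in>words (Suc m). F l) = (\<Sum>(i, l)\<in>UNIV \<times> words m. F (i # l))"
    unfolding im sum.reindex[OF inj] by (simp add: case_prod_unfold)
  then show ?thesis by (simp only: sum.cartesian_product)
qed

lemma wmon_Nil [simp]: "wmon [] z = 1"
  by (simp add: wmon_def)

lemma wmon_Cons [simp]: "wmon (i # l) z = z $ i * wmon l z"
  by (simp add: wmon_def)

lemma cinner_pow: "cinner_vec w z ^ m = (\<Sum>l\<in>words m. wmon l w * cnj (wmon l z))"
proof (induction m)
  case (Suc m)
  have "cinner_vec w z ^ Suc m = (\<Sum>i\<in>UNIV. w $ i * cnj (z $ i)) * (\<Sum>l\<in>words m. wmon l w * cnj (wmon l z))"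
    by (simp only: Suc power_Suc) (simp only: cinner_vec_def)
  also have "\<dots> = (\<Sum>l\<in>words (Suc m). wmon l w * cnj (wmon l z))"
    by (simp add: sum_words_Suc sum_product mult_ac)
  finally show ?case .
qed (simp add: words_0)

text \<open>Multiplying a kernel by \<open>\<langle>w, z\<rangle>^m\<close> turns its quadratic form into a sum, over the words of length
  \<open>m\<close>, of the same form at modified coefficients.\<close>

lemma cinner_pow_form:
  "(\<Sum>z\<in>S. \<Sum>w\<in>S. c z * cnj (c w) * (cinner_vec w z ^ m * g w z)) =
   (\<Sum>l\<in>words m. \<Sum>z\<in>S. \<Sum>w\<in>S. (c z * cnj (wmon l z)) * cnj (c w * cnj (wmon l w)) * g w z)"
proof -
  have "(\<Sum>z\<in>S. \<Sum>w\<in>S. c z * cnj (c w) * (cinner_vec w z ^ m * g w z)) =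
    (\<Sum>z\<in>S. \<Sum>w\<in>S. \<Sum>l\<in>words m. (c z * cnj (wmon l z)) * cnj (c w * cnj (wmon l w)) * g w z)"
    by (simp add: cinner_pow sum_distrib_left sum_distrib_right mult_ac)
  also have "\<dots> = (\<Sum>z\<in>S. \<Sum>l\<in>words m. \<Sum>w\<in>S. (c z * cnj (wmon l z)) * cnj (c w * cnj (wmon l w)) * g w z)"
    by (intro sum.cong refl sum.swap)
  also have "\<dots> = (\<Sum>l\<in>words m. \<Sum>z\<in>S. \<Sum>w\<in>S. (c z * cnj (wmon l z)) * cnj (c w * cnj (wmon l w)) * g w z)"
    by (rule sum.swap)
  finally show ?thesis .
qed

lemma cinner_self: "cinner_vec z z = of_real ((norm z)\<^sup>2)"
proof -
  have "(norm z)\<^sup>2 = (\<Sum>i\<in>UNIV. (cmod (z $ i))\<^sup>2)"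
    by (simp add: norm_vec_def L2_set_def sum_nonneg)
  then show ?thesis by (simp add: cinner_vec_def complex_norm_square[symmetric])
qed

lemma cinner_bound: "cmod (cinner_vec w z) \<le> norm w * norm z"
proof -
  have "cmod (cinner_vec w z) \<le> (\<Sum>i\<in>UNIV. \<bar>cmod (w $ i)\<bar> * \<bar>cmod (z $ i)\<bar>)"
    unfolding cinner_vec_def by (rule order_trans[OF norm_sum]) (simp add: norm_mult)
  also have "\<dots> \<le> norm w * norm z" unfolding norm_vec_def by (rule L2_set_mult_ineq)
  finally show ?thesis .
qed

lemma cinner_ball: assumes "w \<in> ball 0 1" "z \<in> ball 0 1" shows "cmod (cinner_vec w z) < 1"
proof -
  have "norm w * norm z \<le> 1 * norm z" using assms by (intro mult_right_mono) auto
  then show ?thesis using cinner_bound[of w z] assms by simp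
qed

lemma cinner_cnj: "cinner_vec z w = cnj (cinner_vec w z)"
  by (simp add: cinner_vec_def mult.commute)

lemma wmon_scale: "wmon l (a *s z) = a ^ length l * wmon l z"
  by (induction l) auto

lemma homog_scale: "homog m b (a *s z) = a ^ m * homog m b z"
  by (simp add: homog_def wmon_scale words_def sum_distrib_left mult_ac)

lemma scaleR_smult: "r *\<^sub>R (z :: complex ^ 'n) = of_real r *s z"
  by (simp add: vec_eq_iff) (simp add: scaleR_conv_of_real)

lemma cinner_scale: "cinner_vec (a *s w) z = a * cinner_vec w z" "cinner_vec w (a *s z) = cnj a * cinner_vec w z"
  by (simp_all add: cinner_vec_def sum_distrib_left mult_ac)

lemma sum_wmon_sq: "(\<Sum>l\<in>words m. (cmod (wmon l z))\<^sup>2) = (norm z ^ m)\<^sup>2"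
proof -
  have "of_real (\<Sum>l\<in>words m. (cmod (wmon l z))\<^sup>2) = cinner_vec z z ^ m"
    unfolding cinner_pow by (simp add: complex_norm_square[symmetric])
  also have "\<dots> = of_real ((norm z ^ m)\<^sup>2)"
    by (simp add: cinner_self power_mult[symmetric] mult.commute)
  finally show ?thesis using of_real_eq_iff by blast
qed

lemma homog_cinner: "homog m (\<lambda>l. cnj (wmon l z)) w = cinner_vec w z ^ m"
  by (simp add: homog_def cinner_pow mult.commute)

section \<open>The Drury--Arveson space\<close>

locale drury_arveson_space =
  fixes H :: "(complex ^ 'n \<Rightarrow> complex) set" and ip
  assumes da: "drury_arveson H ip"

sublocale drury_arveson_space \<subseteq> reproducing_space "ball 0 1" "\<lambda>w z. 1 / (1 - cinner_vec w z)" H ip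
  using da by unfold_locales (simp add: drury_arveson_def)

context drury_arveson_space
begin

abbreviation B :: "(complex ^ 'n) set" where "B \<equiv> ball 0 1"

abbreviation res :: "(complex ^ 'n \<Rightarrow> complex) \<Rightarrow> complex ^ 'n \<Rightarrow> complex" where "res \<equiv> restrict0 B"

text \<open>By the geometric series, \<open>k(w, z) = \<langle>w, z\<rangle>^m k(w, z) + (\<Sum>j<m. \<langle>w, z\<rangle>^j)\<close>, and the quadratic form of
  each \<open>\<langle>w, z\<rangle>^j\<close> is a sum of squares.\<close>

lemma row_contraction:
  assumes S: "finite S" "S \<subseteq> B"
  shows "(\<Sum>l\<in>words m. (nrm (comb S (\<lambda>z. c z * cnj (wmon l z))))\<^sup>2) \<le> (nrm (comb S c))\<^sup>2"
proof -
  let ?k = "\<lambda>w z. 1 / (1 - cinner_vec w z)"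
  define R where "R = (\<Sum>j<m. \<Sum>l\<in>words j. (cmod (\<Sum>z\<in>S. c z * cnj (wmon l z)))\<^sup>2)"
  have "of_real ((nrm (comb S c))\<^sup>2) = (\<Sum>z\<in>S. \<Sum>w\<in>S. c z * cnj (c w) * ?k w z)"
    by (rule nrm_comb_sq[OF S(2)])
  also have "\<dots> = (\<Sum>z\<in>S. \<Sum>w\<in>S. c z * cnj (c w) * (cinner_vec w z ^ m * ?k w z) +
      (\<Sum>j<m. c z * cnj (c w) * (cinner_vec w z ^ j * 1)))"
  proof (intro sum.cong refl)
    fix z w assume "z \<in> S" "w \<in> S"
    then have "cmod (cinner_vec w z) < 1" using S cinner_ball by blast
    then have "cinner_vec w z \<noteq> 1" by auto
    then have "?k w z = cinner_vec w z ^ m * ?k w z + (\<Sum>j<m. cinner_vec w z ^ j * 1)"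
      by (simp add: sum_gp_strict divide_simps)
    then have "c z * cnj (c w) * ?k w z =
        c z * cnj (c w) * (cinner_vec w z ^ m * ?k w z + (\<Sum>j<m. cinner_vec w z ^ j * 1))"
      by (rule arg_cong)
    then show "c z * cnj (c w) * ?k w z = c z * cnj (c w) * (cinner_vec w z ^ m * ?k w z) +
        (\<Sum>j<m. c z * cnj (c w) * (cinner_vec w z ^ j * 1))"
      by (simp only: distrib_left sum_distrib_left)
  qed
  also have "\<dots> = (\<Sum>z\<in>S. \<Sum>w\<in>S. c z * cnj (c w) * (cinner_vec w z ^ m * ?k w z)) +
      (\<Sum>j<m. \<Sum>z\<in>S. \<Sum>w\<in>S. c z * cnj (c w) * (cinner_vec w z ^ j * 1))"
    by (simp only: sum.distrib sum.swap[where B = "{..<m}"])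
  also have "(\<Sum>z\<in>S. \<Sum>w\<in>S. c z * cnj (c w) * (cinner_vec w z ^ m * ?k w z)) =
      of_real (\<Sum>l\<in>words m. (nrm (comb S (\<lambda>z. c z * cnj (wmon l z))))\<^sup>2)"
    unfolding cinner_pow_form of_real_sum by (intro sum.cong refl nrm_comb_sq[OF S(2), symmetric])
  also have "(\<Sum>j<m. \<Sum>z\<in>S. \<Sum>w\<in>S. c z * cnj (c w) * (cinner_vec w z ^ j * 1)) = of_real R"
    unfolding cinner_pow_form R_def of_real_sum complex_norm_square
    by (simp add: sum_product)
  finally have "(nrm (comb S c))\<^sup>2 = (\<Sum>l\<in>words m. (nrm (comb S (\<lambda>z. c z * cnj (wmon l z))))\<^sup>2) + R"
    unfolding of_real_add[symmetric] of_real_eq_iff .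
  moreover have "R \<ge> 0" unfolding R_def by (intro sum_nonneg) auto
  ultimately show ?thesis by linarith
qed

text \<open>The row contraction and the Cauchy--Schwarz inequality. For the choice of coefficients that is symmetric
  under reordering of words, the bound is the norm of the polynomial in \<open>H\<close>.\<close>

lemma homog_multiplier: "mult (homog m b)" "mnorm (homog m b) \<le> L2_set (\<lambda>l. cmod (b l)) (words m)"
proof -
  have bd: "nrm (comb S (\<lambda>z. c z * cnj (homog m b z))) \<le> L2_set (\<lambda>l. cmod (b l)) (words m) * nrm (comb S c)"
    if S: "finite S" "S \<subseteq> B" for S c
  proof -
    let ?y = "\<lambda>l. comb S (\<lambda>z. c z * cnj (wmon l z))"
    have y: "?y l \<in> H" for l by (rule comb_mem[OF S(2)])
    have "comb S (\<lambda>z. c z * cnj (homog m b z)) = (\<Sum>l\<in>words m. cscale (cnj (b l)) (?y l))"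
    proof
      fix v
      have "comb S (\<lambda>z. c z * cnj (homog m b z)) v = (\<Sum>z\<in>S. \<Sum>l\<in>words m. cnj (b l) * (c z * cnj (wmon l z) * kern z v))"
        by (simp add: comb_def sum_fun_apply homog_def sum_distrib_left sum_distrib_right mult_ac)
      also have "\<dots> = (\<Sum>l\<in>words m. \<Sum>z\<in>S. cnj (b l) * (c z * cnj (wmon l z) * kern z v))"
        by (rule sum.swap)
      also have "\<dots> = (\<Sum>l\<in>words m. cscale (cnj (b l)) (?y l)) v"
        by (simp add: comb_def sum_fun_apply sum_distrib_left)
      finally show "comb S (\<lambda>z. c z * cnj (homog m b z)) v = (\<Sum>l\<in>words m. cscale (cnj (b l)) (?y l)) v" .
    qed
    then have "nrm (comb S (\<lambda>z. c z * cnj (homog m b z))) \<le> (\<Sum>l\<in>words m. nrm (cscale (cnj (b l)) (?y l)))"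
      using nrm_sum[of "words m" "\<lambda>l. cscale (cnj (b l)) (?y l)"] y by simp
    also have "\<dots> = (\<Sum>l\<in>words m. \<bar>cmod (b l)\<bar> * \<bar>nrm (?y l)\<bar>)"
      using y by (intro sum.cong refl) (simp add: nrm_scale)
    also have "\<dots> \<le> L2_set (\<lambda>l. cmod (b l)) (words m) * L2_set (\<lambda>l. nrm (?y l)) (words m)"
      by (rule L2_set_mult_ineq)
    also have "L2_set (\<lambda>l. nrm (?y l)) (words m) \<le> nrm (comb S c)"
      unfolding L2_set_def
      by (rule real_le_lsqrt[OF nrm_ge0[OF comb_mem[OF S(2)]] row_contraction[OF S]])
    finally show ?thesis by (simp add: mult_left_mono)
  qed
  show "mult (homog m b)" "mnorm (homog m b) \<le> L2_set (\<lambda>l. cmod (b l)) (words m)"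
    using multiplier_criterion[OF L2_set_nonneg bd] by blast+
qed

end

section \<open>Polynomials and homogeneous components\<close>

lemma restrict0_supported [simp]: "supported_on X (restrict0 X f)"
  by (simp add: supported_on_def restrict0_def)

lemma restrict0_id: "supported_on X f \<Longrightarrow> restrict0 X f = f"
  by (auto simp: supported_on_def restrict0_def fun_eq_iff)

lemma wmon_prod: "wmon l z = (\<Prod>i\<in>UNIV. (z $ i) ^ count_list l i)"
proof (induction l)
  case (Cons a l)
  have "(\<Prod>i\<in>UNIV. (z $ i) ^ count_list (a # l) i) =
      (\<Prod>i\<in>UNIV. (if i = a then z $ i else 1) * (z $ i) ^ count_list l i)"
    by (intro prod.cong) auto
  also have "\<dots> = z $ a * (\<Prod>i\<in>UNIV. (z $ i) ^ count_list l i)"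
    by (simp add: prod.distrib)
  finally show ?case by (simp add: Cons)
qed simp

lemma polynomial_fun_add:
  assumes "polynomial_fun p" "polynomial_fun q" shows "polynomial_fun (\<lambda>z. p z + q z)"
proof -
  obtain A c where A: "finite A" "\<And>z. p z = (\<Sum>\<alpha>\<in>A. c \<alpha> * (\<Prod>i\<in>UNIV. (z $ i) ^ \<alpha> i))"
    using assms(1) unfolding polynomial_fun_def by blast
  obtain A' c' where A': "finite A'" "\<And>z. q z = (\<Sum>\<alpha>\<in>A'. c' \<alpha> * (\<Prod>i\<in>UNIV. (z $ i) ^ \<alpha> i))"
    using assms(2) unfolding polynomial_fun_def by blast
  have 1: "(\<Sum>\<alpha>\<in>A. c \<alpha> * M \<alpha>) = (\<Sum>\<alpha>\<in>A \<union> A'. (if \<alpha> \<in> A then c \<alpha> else 0) * M \<alpha>)" for M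
    by (rule sum.mono_neutral_cong_left) (use A A' in auto)
  have 2: "(\<Sum>\<alpha>\<in>A'. c' \<alpha> * M \<alpha>) = (\<Sum>\<alpha>\<in>A \<union> A'. (if \<alpha> \<in> A' then c' \<alpha> else 0) * M \<alpha>)" for M
    by (rule sum.mono_neutral_cong_left) (use A A' in auto)
  show ?thesis
    unfolding polynomial_fun_def
    by (rule exI[of _ "A \<union> A'"], rule exI[of _ "\<lambda>\<alpha>. (if \<alpha> \<in> A then c \<alpha> else 0) + (if \<alpha> \<in> A' then c' \<alpha> else 0)"])
      (simp only: A A' 1 2 sum.distrib[symmetric] distrib_right finite_Un simp_thms)
qed

lemma polynomial_fun_wmon: "polynomial_fun (\<lambda>z. a * wmon l z)"
  unfolding polynomial_fun_def wmon_prod by (rule exI[of _ "{count_list l}"]) auto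

lemma polynomial_fun_sum: "(\<And>i. i \<in> S \<Longrightarrow> polynomial_fun (p i)) \<Longrightarrow> polynomial_fun (\<lambda>z. \<Sum>i\<in>S. p i z)"
proof (induction S rule: infinite_finite_induct)
  case (insert x F)
  then show ?case using polynomial_fun_add[of "p x" "\<lambda>z. \<Sum>i\<in>F. p i z"] by simp
qed (auto simp: polynomial_fun_def intro: exI[of _ "{}"])

lemma polynomial_fun_homog: "polynomial_fun (homog m b)"
  unfolding homog_def[abs_def] by (intro polynomial_fun_sum polynomial_fun_wmon)

lemma count_list_replicate: "count_list (replicate n a) b = (if a = b then n else 0)"
  by (induction n) auto

text \<open>Every monomial in the usual sense comes from a word.\<close>

lemma exponents_of_word: "\<exists>l. count_list l = (\<alpha> :: 'n::finite \<Rightarrow> nat)"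
proof -
  have fold: "count_list (concat (map (\<lambda>i. replicate (\<alpha> i) i) xs)) j = (if j \<in> set xs then \<alpha> j else 0)"
    if "distinct xs" for xs j
    using that by (induction xs) (auto simp: count_list_replicate)
  obtain xs :: "'n list" where xs: "set xs = UNIV" "distinct xs"
    using finite_distinct_list[OF finite] by blast
  have "count_list (concat (map (\<lambda>i. replicate (\<alpha> i) i) xs)) = \<alpha>"
    using fold[OF xs(2)] xs by (simp add: fun_eq_iff)
  then show ?thesis by blast
qed

context drury_arveson_space
begin

definition one :: "complex ^ 'n \<Rightarrow> complex" where "one = res (\<lambda>_. 1)"

lemma one_kern: "one = kern 0"
  unfolding one_def kern_def by (simp add: cinner_vec_def)

lemma one_mem [simp]: "one \<in> H"
  by (simp add: one_kern)

lemma nrm_one: "nrm one = 1"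
proof -
  have "ip one one = one 0" using reproduce[of one 0] by (simp add: one_kern)
  then have "(nrm one)\<^sup>2 = 1" using nrm_sq[OF one_mem] by (simp add: one_def restrict0_def)
  then show ?thesis using nrm_ge0[OF one_mem] by (simp add: power2_eq_1_iff)
qed

lemma times_one: "f * one = res f"
  by (auto simp: one_def restrict0_def fun_eq_iff)

lemma mult_mem: "mult f \<Longrightarrow> res f \<in> H"
  using multD[OF _ one_mem] by (simp add: times_one)

lemma nrm_le_mnorm: "mult f \<Longrightarrow> nrm (res f) \<le> mnorm f"
  using mnorm_bound[OF _ one_mem] by (simp add: times_one nrm_one)

lemma mult_eval: "mult f \<Longrightarrow> z \<in> B \<Longrightarrow> cmod (f z) \<le> mnorm f"
proof (rule mult_eval_bound)
  assume "z \<in> B"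
  then have "cmod (cinner_vec z z) < 1" by (intro cinner_ball)
  then show "1 / (1 - cinner_vec z z) \<noteq> 0" by auto
qed

text \<open>As the constant \<open>one\<close> is in \<open>H\<close>, multipliers belong to \<open>H\<close>, whose elements are analytic.\<close>

lemma multiplier_algebra_iff: "f \<in> multiplier_algebra H \<longleftrightarrow> supported_on B f \<and> mult f"
proof
  assume f: "supported_on B f \<and> mult f"
  then have "f \<in> H" using mult_mem[of f] by (simp add: restrict0_id)
  then have "analytic_on_ball f" using da by (simp add: drury_arveson_def)
  then show "f \<in> multiplier_algebra H"
    using f by (simp add: multiplier_algebra_def mult_def multiplication_op_def)
qed (simp add: multiplier_algebra_def mult_def multiplication_op_def)

lemma polynomial_mult: assumes "polynomial_fun p" shows "mult p"
proof -
  obtain A c where A: "finite A" "\<And>z. p z = (\<Sum>\<alpha>\<in>A. c \<alpha> * (\<Prod>i\<in>UNIV. (z $ i) ^ \<alpha> i))"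
    using assms unfolding polynomial_fun_def by blast
  obtain L where L: "\<And>\<alpha>. count_list (L \<alpha>) = (\<alpha> :: 'n \<Rightarrow> nat)" using exponents_of_word by metis
  have "p = (\<Sum>\<alpha>\<in>A. cscale (c \<alpha>) (homog (length (L \<alpha>)) (\<lambda>l. if l = L \<alpha> then 1 else 0)))"
    by (auto simp: fun_eq_iff sum_fun_apply A homog_def words_def[symmetric] wmon_prod L
        if_distrib[of "\<lambda>x. x * _"] sum.delta cong: if_cong) (simp add: words_def)
  then show ?thesis by (simp only:) (intro mult_sum mult_scale homog_multiplier)
qed

lemma homog_mem [simp]: "res (homog m b) \<in> H"
  by (intro mult_mem homog_multiplier)

definition mon :: "'n list \<Rightarrow> complex ^ 'n \<Rightarrow> complex" where "mon l = res (wmon l)"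

lemma mon_mem [simp]: "mon l \<in> H"
proof -
  have "wmon l = homog (length l) (\<lambda>l'. if l' = l then 1 else 0)"
    by (auto simp: fun_eq_iff homog_def if_distrib[of "\<lambda>x. x * _"] sum.delta words_def[symmetric] cong: if_cong)
      (simp add: words_def)
  then show ?thesis unfolding mon_def by (simp only: homog_mem)
qed

lemma res_homog: "res (homog m b) = (\<Sum>l\<in>words m. cscale (b l) (mon l))"
  by (auto simp: fun_eq_iff sum_fun_apply homog_def mon_def restrict0_def)

lemma ip_homog: "f \<in> H \<Longrightarrow> ip f (res (homog m b)) = (\<Sum>l\<in>words m. cnj (b l) * ip f (mon l))"
  unfolding res_homog by (subst ip_sum_right) (auto intro!: sum.cong simp: ip_scale_right)

text \<open>Words with the same letters have the same monomial, so the coefficients of a homogeneous polynomial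
  are not unique. Pairing with the monomials makes the choice for which the sum of
  the squares of the coefficients is the squared norm.\<close>

definition hcoef :: "(complex ^ 'n \<Rightarrow> complex) \<Rightarrow> 'n list \<Rightarrow> complex" where
  "hcoef f l = ip f (mon l)"

definition hpart :: "nat \<Rightarrow> (complex ^ 'n \<Rightarrow> complex) \<Rightarrow> complex ^ 'n \<Rightarrow> complex" where
  "hpart m f = homog m (hcoef f)"

lemma hpart_mult [simp]: "mult (hpart m f)"
  by (simp add: hpart_def homog_multiplier)

lemma hpart_mnorm: assumes f: "f \<in> H" shows "mnorm (hpart m f) \<le> nrm f"
proof -
  let ?b = "hcoef f"
  let ?L = "L2_set (\<lambda>l. cmod (?b l)) (words m)"
  have h: "res (hpart m f) \<in> H" by (simp add: hpart_def)
  \<comment> \<open>the component is an orthogonal projection of \<open>f\<close>\<close>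
  have "of_real (?L\<^sup>2) = ip f (res (hpart m f))"
    unfolding hpart_def ip_homog[OF f]
    by (simp add: L2_set_def sum_nonneg complex_norm_square hcoef_def mult.commute del: of_real_power)
  then have "?L\<^sup>2 = cmod (ip f (res (hpart m f)))"
    using norm_of_real[of "?L\<^sup>2", where 'a = complex] by (simp only: abs_of_nonneg[OF zero_le_power2])
  also have "\<dots> \<le> nrm f * nrm (res (hpart m f))" by (intro cauchy_schwarz f h)
  also have "\<dots> \<le> nrm f * ?L"
    using nrm_le_mnorm[of "homog m ?b"] homog_multiplier[of m ?b] f unfolding hpart_def
    by (intro mult_left_mono) auto
  finally have le: "?L * ?L \<le> nrm f * ?L" by (simp add: power2_eq_square)
  have "?L \<le> nrm f"
  proof (cases "?L = 0")
    case False
    then have "?L > 0" using L2_set_nonneg[of "\<lambda>l. cmod (?b l)" "words m"] by linarith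
    then show ?thesis using le by simp
  qed (use f in simp)
  then show ?thesis using homog_multiplier(2)[of m ?b] by (simp add: hpart_def)
qed

text \<open>This identifies the components: \<open>\<langle>\<cdot>, z\<rangle>^m\<close> is the part of degree \<open>m\<close> of the kernel function at \<open>z\<close>.\<close>

lemma hpart_ip: assumes "f \<in> H" shows "hpart m f z = ip f (res (\<lambda>w. cinner_vec w z ^ m))"
  using ip_homog[OF assms, of m "\<lambda>l. cnj (wmon l z)"]
  by (simp add: homog_cinner[abs_def] hpart_def homog_def hcoef_def mult.commute)

lemma cinner_pow_mult: "mult (\<lambda>w. cinner_vec w z ^ m)" "mnorm (\<lambda>w. cinner_vec w z ^ m) \<le> norm z ^ m"
proof -
  have "L2_set (\<lambda>l. cmod (cnj (wmon l z))) (words m) = norm z ^ m"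
    unfolding L2_set_def complex_mod_cnj sum_wmon_sq by simp
  then show "mult (\<lambda>w. cinner_vec w z ^ m)" "mnorm (\<lambda>w. cinner_vec w z ^ m) \<le> norm z ^ m"
    using homog_multiplier[of m "\<lambda>l. cnj (wmon l z)"] by (simp_all add: homog_cinner[abs_def])
qed

lemma hpart_bound: assumes "f \<in> H" shows "cmod (hpart m f z) \<le> nrm f * norm z ^ m"
proof -
  have "cmod (hpart m f z) \<le> nrm f * nrm (res (\<lambda>w. cinner_vec w z ^ m))"
    unfolding hpart_ip[OF assms] by (intro cauchy_schwarz assms mult_mem cinner_pow_mult)
  also have "\<dots> \<le> nrm f * norm z ^ m"
    using nrm_le_mnorm[OF cinner_pow_mult(1)[of z m]] cinner_pow_mult(2)[of z m] assms
    by (intro mult_left_mono) auto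
  finally show ?thesis .
qed

text \<open>The expansion of the kernel function into powers of \<open>\<langle>\<cdot>, z\<rangle>\<close> converges in norm, so it can be paired
  with \<open>f\<close>.\<close>

lemma hpart_sums: assumes f: "f \<in> H" and z: "z \<in> B" shows "(\<lambda>m. hpart m f z) sums f z"
proof -
  let ?e = "\<lambda>m. res (\<lambda>w. cinner_vec w z ^ m)"
  have e: "?e m \<in> H" for m by (intro mult_mem cinner_pow_mult)
  have "nrm (?e m) \<le> norm z ^ m" for m
    using nrm_le_mnorm[OF cinner_pow_mult(1)[of z m]] cinner_pow_mult(2)[of z m] by linarith
  then have "summable (\<lambda>m. nrm (?e m))"
    using z e by (intro summable_comparison_test'[OF summable_geometric[of "norm z"], of 0]) auto
  then obtain u where u: "u \<in> H" "(\<lambda>n. nrm ((\<Sum>i<n. ?e i) - u)) \<longlonglongrightarrow> 0"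
    using abs_convergent_series[of ?e] e by blast
  have sumH: "(\<Sum>i<n. ?e i) \<in> H" for n by (intro sum_mem e)
  have "u = kern z"
  proof
    fix w
    show "u w = kern z w"
    proof (cases "w \<in> B")
      case True
      have "(\<lambda>n. (\<Sum>i<n. ?e i) w) \<longlonglongrightarrow> u w" by (rule tendsto_eval[OF sumH u])
      moreover have "(\<lambda>n. (\<Sum>i<n. ?e i) w) \<longlonglongrightarrow> kern z w"
        using geometric_sums[OF cinner_ball[OF True z]] True
        by (simp add: sum_fun_apply restrict0_def kern_def sums_def)
      ultimately show ?thesis using LIMSEQ_unique by blast
    next
      case False
      then show ?thesis using supp[OF u(1)] by (simp add: kern_def restrict0_def)
    qed
  qed
  then have "(\<lambda>n. ip f (\<Sum>i<n. ?e i)) \<longlonglongrightarrow> f z"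
    using tendsto_ip_right[OF sumH u(1) f u(2)] reproduce[OF f z] by simp
  then show ?thesis unfolding sums_def hpart_ip[OF f] by (simp only: ip_sum_right[OF e f])
qed

end

section \<open>Dilations\<close>

context drury_arveson_space
begin

definition dil :: "real \<Rightarrow> (complex ^ 'n \<Rightarrow> complex) \<Rightarrow> complex ^ 'n \<Rightarrow> complex" where
  "dil r f = res (\<lambda>z. f (r *\<^sub>R z))"

lemma dil_supported [simp]: "supported_on B (dil r f)"
  by (simp add: dil_def)

lemma dil_ball: "0 \<le> r \<Longrightarrow> r \<le> 1 \<Longrightarrow> z \<in> B \<Longrightarrow> r *\<^sub>R z \<in> B"
  using mult_right_le_one_le[of "norm z" r] by (simp add: mult.commute)

lemma dil_dil: "0 \<le> s \<Longrightarrow> s \<le> 1 \<Longrightarrow> dil s (dil r f) = dil (r * s) f"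
  using dil_ball[of s] by (auto simp: dil_def restrict0_def fun_eq_iff)

lemma dil_add: "dil r (f + g) = dil r f + dil r g"
  by (auto simp: dil_def restrict0_def fun_eq_iff)

lemma dil_scale: "dil r (cscale c f) = cscale c (dil r f)"
  by (auto simp: dil_def restrict0_def fun_eq_iff)

lemma hpart_scaleR: "hpart m f (r *\<^sub>R z) = of_real (r ^ m) * hpart m f z"
  by (simp add: hpart_def scaleR_smult homog_scale)

definition dil_part :: "real \<Rightarrow> (complex ^ 'n \<Rightarrow> complex) \<Rightarrow> nat \<Rightarrow> complex ^ 'n \<Rightarrow> complex" where
  "dil_part r f m = cscale (of_real (r ^ m)) (res (hpart m f))"

lemma dil_part_mult [simp]: "mult (dil_part r f m)"
  unfolding dil_part_def by (intro mult_scale) simp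

lemma dil_part_mnorm: "f \<in> H \<Longrightarrow> 0 \<le> r \<Longrightarrow> mnorm (dil_part r f m) \<le> r ^ m * nrm f"
  unfolding dil_part_def using hpart_mnorm[of f m]
  by (subst mnorm_scale) (auto simp: norm_power mult_left_mono)

text \<open>For \<open>r < 1\<close> the factors \<open>r ^ m\<close> make the homogeneous expansion converge in the multiplier norm, even
  when \<open>f\<close> itself is not a multiplier.\<close>

lemma dil_series:
  assumes f: "f \<in> H" and r: "0 \<le> r" "r < 1"
  shows "mult (dil r f)" "(\<lambda>M. mnorm (dil r f - (\<Sum>m<M. dil_part r f m))) \<longlonglongrightarrow> 0"
proof -
  have geo: "summable (\<lambda>m. r ^ m * nrm f)" using r by (intro summable_mult2 summable_geometric) simp
  have sm: "summable (\<lambda>m. mnorm (dil_part r f m))"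
    by (rule summable_comparison_test'[OF geo, of 0]) (simp add: dil_part_mnorm f r mnorm_ge0)
  have sup: "supported_on B (dil_part r f m)" for m by (auto simp: dil_part_def supported_on_def restrict0_def)
  have lim: "(\<lambda>m. dil_part r f m z) sums dil r f z" if z: "z \<in> B" for z
  proof -
    have "(\<lambda>m. hpart m f (r *\<^sub>R z)) sums f (r *\<^sub>R z)"
      using r z by (intro hpart_sums f dil_ball) auto
    then show ?thesis using z by (simp add: hpart_scaleR dil_part_def dil_def restrict0_def)
  qed
  note ser = mult_series[OF dil_part_mult sm dil_supported sup lim]
  show "mult (dil r f)" by (rule ser(1))
  have tail: "(\<lambda>M. \<Sum>m. mnorm (dil_part r f (m + M))) \<longlonglongrightarrow> 0"
  proof -
    have "(\<lambda>M. suminf (\<lambda>m. mnorm (dil_part r f m)) - (\<Sum>m<M. mnorm (dil_part r f m))) \<longlonglongrightarrow> 0"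
      using tendsto_diff[OF tendsto_const[of "suminf (\<lambda>m. mnorm (dil_part r f m))"] summable_LIMSEQ[OF sm]] by simp
    then show ?thesis by (simp only: suminf_minus_initial_segment[OF sm])
  qed
  show "(\<lambda>M. mnorm (dil r f - (\<Sum>m<M. dil_part r f m))) \<longlonglongrightarrow> 0"
  proof (rule Lim_null_comparison[OF always_eventually[OF allI] tail])
    fix M
    have "mnorm (dil r f - (\<Sum>m<M. dil_part r f m)) \<ge> 0"
      by (intro mnorm_ge0 mult_diff mult_sum dil_part_mult ser(1))
    then show "norm (mnorm (dil r f - (\<Sum>m<M. dil_part r f m))) \<le> (\<Sum>m. mnorm (dil_part r f (m + M)))"
      using ser(2)[of M] by simp
  qed
qed

abbreviation \<A> :: "(complex ^ 'n \<Rightarrow> complex) set" where "\<A> \<equiv> ball_algebra H ip"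

abbreviation \<M> :: "(complex ^ 'n \<Rightarrow> complex) set" where "\<M> \<equiv> multiplier_algebra H"

lemma A_multiplier: "f \<in> \<A> \<Longrightarrow> f \<in> \<M>"
  by (simp add: ball_algebra_def)

lemma multiplierD: "f \<in> \<M> \<Longrightarrow> mult f" "f \<in> \<M> \<Longrightarrow> supported_on B f" "f \<in> \<M> \<Longrightarrow> f \<in> H"
  using mult_mem[of f] by (auto simp: multiplier_algebra_iff restrict0_id)

lemma nrm_le_mnorm_multiplier: "f \<in> \<M> \<Longrightarrow> nrm f \<le> mnorm f"
  using nrm_le_mnorm[of f] multiplierD[of f] by (simp add: restrict0_id)

lemma poly_A: "polynomial_fun p \<Longrightarrow> res p \<in> \<A>"
proof -
  assume p: "polynomial_fun p"
  have "res p - res p = 0" by simp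
  moreover have "mnorm 0 = 0" using mnorm_le[of 0 0] mnorm_ge0[OF mult_zero] by simp
  ultimately have "mnorm (res p - res p) < e" if "e > 0" for e using that by (simp only:)
  then show ?thesis using p polynomial_mult[OF p]
    unfolding ball_algebra_def multiplier_algebra_iff by (intro CollectI conjI) (simp, simp, blast)
qed

lemma supported_add: "supported_on X f \<Longrightarrow> supported_on X g \<Longrightarrow> supported_on X (f + g)"
  and supported_scale: "supported_on X f \<Longrightarrow> supported_on X (cscale c f)"
  by (simp_all add: supported_on_def)

lemma A_approx: assumes "f \<in> \<A>" "e > 0"
  obtains p where "polynomial_fun p" "mnorm (f - res p) < e"
  using assms by (auto simp: ball_algebra_def)

lemma A_intro: assumes "supported_on B f" "mult f" "\<And>e. e > 0 \<Longrightarrow> \<exists>p. polynomial_fun p \<and> mnorm (f - res p) < e"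
  shows "f \<in> \<A>"
  using assms by (simp add: ball_algebra_def multiplier_algebra_iff)

lemma res_sum_dil_part: "(\<Sum>m<N. dil_part r f m) = res (\<lambda>z. \<Sum>m<N. homog m (\<lambda>l. of_real (r ^ m) * hcoef f l) z)"
  by (auto simp: fun_eq_iff sum_fun_apply dil_part_def restrict0_def hpart_def homog_def sum_distrib_left mult.assoc)

lemma dil_A: assumes f: "f \<in> H" and r: "0 \<le> r" "r < 1" shows "dil r f \<in> \<A>"
proof (rule A_intro)
  show "mult (dil r f)" by (rule dil_series[OF assms])
  fix e :: real assume "e > 0"
  then have "\<forall>\<^sub>F N in sequentially. mnorm (dil r f - (\<Sum>m<N. dil_part r f m)) < e"
    by (rule order_tendstoD(2)[OF dil_series(2)[OF assms]])
  then obtain N where N: "mnorm (dil r f - (\<Sum>m<N. dil_part r f m)) < e" by (auto simp: eventually_sequentially)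
  have "polynomial_fun (\<lambda>z. \<Sum>m<N. homog m (\<lambda>l. of_real (r ^ m) * hcoef f l) z)"
    by (rule polynomial_fun_sum) (rule polynomial_fun_homog)
  then show "\<exists>p. polynomial_fun p \<and> mnorm (dil r f - res p) < e"
    using N[unfolded res_sum_dil_part] by (intro exI conjI)
qed simp

lemma A_add: assumes "f \<in> \<A>" "g \<in> \<A>" shows "f + g \<in> \<A>"
proof (rule A_intro)
  show "supported_on B (f + g)" "mult (f + g)"
    using assms[THEN A_multiplier] multiplierD by (auto intro: supported_add mult_add)
  fix e :: real assume e: "e > 0"
  obtain p where p: "polynomial_fun p" "mnorm (f - res p) < e / 2"
    using A_approx[OF assms(1), of "e / 2"] e by auto
  obtain q where q: "polynomial_fun q" "mnorm (g - res q) < e / 2"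
    using A_approx[OF assms(2), of "e / 2"] e by auto
  have eq: "f + g - res (\<lambda>z. p z + q z) = (f - res p) + (g - res q)"
    by (auto simp: fun_eq_iff restrict0_def)
  have "mnorm (f + g - res (\<lambda>z. p z + q z)) \<le> mnorm (f - res p) + mnorm (g - res q)"
    unfolding eq using assms[THEN A_multiplier] multiplierD polynomial_mult p q
    by (intro mnorm_triangle mult_diff) auto
  then show "\<exists>p. polynomial_fun p \<and> mnorm (f + g - res p) < e"
    using p q polynomial_fun_add[OF p(1) q(1)] by (intro exI[of _ "\<lambda>z. p z + q z"]) linarith
qed

lemma polynomial_fun_scale: assumes "polynomial_fun p" shows "polynomial_fun (\<lambda>z. a * p z)"
proof -
  obtain S c where S: "finite S" "\<And>z. p z = (\<Sum>\<alpha>\<in>S. c \<alpha> * (\<Prod>i\<in>UNIV. (z $ i) ^ \<alpha> i))"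
    using assms unfolding polynomial_fun_def by blast
  show ?thesis unfolding polynomial_fun_def
    by (rule exI[of _ S], rule exI[of _ "\<lambda>\<alpha>. a * c \<alpha>"]) (simp add: S sum_distrib_left mult.assoc)
qed

lemma A_scale: assumes "f \<in> \<A>" shows "cscale a f \<in> \<A>"
proof (rule A_intro)
  show "supported_on B (cscale a f)" "mult (cscale a f)"
    using assms[THEN A_multiplier] multiplierD by (auto intro: supported_scale mult_scale)
  fix e :: real assume e: "e > 0"
  have pos: "cmod a + 1 > 0" by (simp add: add_nonneg_pos)
  obtain p where p: "polynomial_fun p" "mnorm (f - res p) < e / (cmod a + 1)"
    using A_approx[OF assms, of "e / (cmod a + 1)"] e pos by auto
  have eq: "cscale a f - res (\<lambda>z. a * p z) = cscale a (f - res p)"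
    by (auto simp: fun_eq_iff restrict0_def algebra_simps)
  have m: "mult (f - res p)" using assms[THEN A_multiplier] multiplierD polynomial_mult p by (intro mult_diff) auto
  have "mnorm (cscale a f - res (\<lambda>z. a * p z)) = cmod a * mnorm (f - res p)"
    unfolding eq by (rule mnorm_scale[OF m])
  also have "\<dots> \<le> (cmod a + 1) * mnorm (f - res p)" using mnorm_ge0[OF m] by (intro mult_right_mono) auto
  also have "\<dots> < e" using p(2) pos by (simp only: pos_less_divide_eq mult.commute)
  finally show "\<exists>p. polynomial_fun p \<and> mnorm (cscale a f - res p) < e"
    using polynomial_fun_scale[OF p(1)] by blast
qed

lemma A_diff: "f \<in> \<A> \<Longrightarrow> g \<in> \<A> \<Longrightarrow> f - g \<in> \<A>"
  unfolding diff_cscale by (intro A_add A_scale)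

lemma A_zero: "0 \<in> \<A>"
  using poly_A[of "\<lambda>_. 0"] by (simp add: polynomial_fun_def restrict0_def zero_fun_def exI[of _ "{}"])

lemma A_sum: "(\<And>i. i \<in> S \<Longrightarrow> F i \<in> \<A>) \<Longrightarrow> (\<Sum>i\<in>S. F i) \<in> \<A>"
  by (induction S rule: infinite_finite_induct) (auto simp: A_zero A_add)

lemma mon_A: "mon l \<in> \<A>"
  unfolding mon_def using poly_A[OF polynomial_fun_wmon[of 1 l]] by simp

lemma homog_A: "res (homog m b) \<in> \<A>"
  by (intro poly_A polynomial_fun_homog)

lemma dil_part_A: "dil_part r f m \<in> \<A>"
  unfolding dil_part_def hpart_def by (intro A_scale homog_A)

text \<open>The coefficients are indexed by the original points, while the kernel functions sit at the dilated ones.\<close>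

definition dcomb :: "real \<Rightarrow> (complex ^ 'n) set \<Rightarrow> (complex ^ 'n \<Rightarrow> complex) \<Rightarrow> complex ^ 'n \<Rightarrow> complex" where
  "dcomb r S c = comb ((*\<^sub>R) r ` S) (\<lambda>v. c (inverse r *\<^sub>R v))"

text \<open>Dilation is contractive on multipliers. The kernel satisfies
  \<open>k w z = k (r w) (r z) * (1 + (1 - r\<^sup>2) * (\<Sum>m\<ge>1. \<langle>w, z\<rangle>^m))\<close>, and the second factor is positive definite
  and diagonal in the monomials, so the quadratic form of \<open>k\<close> is a positive combination of
  quadratic forms of the kernel at the dilated points, to each of which the adjoint bound
  applies.\<close>

lemma kernel_dilation:
  assumes S: "finite S" "S \<subseteq> B" and r: "0 < r" "r < 1"
  shows "(\<lambda>m. (if m = 0 then 1 else 1 - r\<^sup>2) *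
      (\<Sum>l\<in>words m. (nrm (dcomb r S (\<lambda>z. c z * cnj (wmon l z))))\<^sup>2)) sums (nrm (comb S c))\<^sup>2"
proof -
  let ?k = "\<lambda>w z. 1 / (1 - cinner_vec w z)"
  let ?a = "\<lambda>m::nat. if m = 0 then 1 else 1 - r\<^sup>2"
  have rS: "(*\<^sub>R) r ` S \<subseteq> B" using dil_ball[of r] r S by auto
  have inj: "inj_on ((*\<^sub>R) r) S" using r by (auto simp: inj_on_def)
  have inv: "inverse r *\<^sub>R r *\<^sub>R z = z" for z :: "complex ^ 'n" using r by simp
  have K: "of_real ((nrm (dcomb r S d))\<^sup>2) = (\<Sum>z\<in>S. \<Sum>w\<in>S. d z * cnj (d w) * ?k (r *\<^sub>R w) (r *\<^sub>R z))" for d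
    unfolding dcomb_def nrm_comb_sq[OF rS] sum.reindex[OF inj] comp_def inv ..
  have "(\<lambda>m. \<Sum>z\<in>S. \<Sum>w\<in>S. c z * cnj (c w) * ?k (r *\<^sub>R w) (r *\<^sub>R z) * (of_real (?a m) * cinner_vec w z ^ m))
      sums (\<Sum>z\<in>S. \<Sum>w\<in>S. c z * cnj (c w) * ?k w z)"
  proof (intro sums_sum)
    fix z w assume "z \<in> S" "w \<in> S"
    define x where "x = cinner_vec w z"
    have lt: "cmod x < 1" using \<open>z \<in> S\<close> \<open>w \<in> S\<close> S cinner_ball unfolding x_def by blast
    have rx: "cinner_vec (r *\<^sub>R w) (r *\<^sub>R z) = of_real (r\<^sup>2) * x"
      by (simp add: scaleR_smult cinner_scale x_def power2_eq_square mult.assoc)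
    have x1: "x \<noteq> 1" using lt by auto
    have "cmod (of_real (r\<^sup>2) * x) < 1"
    proof -
      have "r\<^sup>2 \<le> 1" using r by (simp add: power_le_one)
      then have "r\<^sup>2 * cmod x \<le> 1 * cmod x" by (intro mult_right_mono) auto
      then show ?thesis using lt by (simp add: norm_mult norm_power)
    qed
    then have rx1: "of_real (r\<^sup>2) * x \<noteq> 1" by auto
    \<comment> \<open>the expansion of \<open>(1 - r\<^sup>2 x) / (1 - x)\<close>\<close>
    have "(\<lambda>m. of_real (1 - r\<^sup>2) * x ^ m + (if m = 0 then of_real (r\<^sup>2) else 0)) sums
        (of_real (1 - r\<^sup>2) * (1 / (1 - x)) + of_real (r\<^sup>2))"
      by (intro sums_add sums_mult geometric_sums lt sums_single)
    also have "(\<lambda>m. of_real (1 - r\<^sup>2) * x ^ m + (if m = 0 then of_real (r\<^sup>2) else 0)) =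
        (\<lambda>m. of_real (?a m) * x ^ m)" by auto
    also have "of_real (1 - r\<^sup>2) * (1 / (1 - x)) + of_real (r\<^sup>2) = (1 - of_real (r\<^sup>2) * x) / (1 - x)"
      using x1 by (simp add: field_simps)
    finally have "(\<lambda>m. ?k (r *\<^sub>R w) (r *\<^sub>R z) * (of_real (?a m) * x ^ m)) sums
        (?k (r *\<^sub>R w) (r *\<^sub>R z) * ((1 - of_real (r\<^sup>2) * x) / (1 - x)))" by (rule sums_mult)
    also have "?k (r *\<^sub>R w) (r *\<^sub>R z) * ((1 - of_real (r\<^sup>2) * x) / (1 - x)) = ?k w z"
      using rx1 by (simp add: rx x_def[symmetric] del: of_real_power)
    finally show "(\<lambda>m. c z * cnj (c w) * ?k (r *\<^sub>R w) (r *\<^sub>R z) * (of_real (?a m) * cinner_vec w z ^ m)) sums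
        (c z * cnj (c w) * ?k w z)"
      using sums_mult[of _ _ "c z * cnj (c w)"] unfolding x_def by (simp only: mult.assoc)
  qed
  also have "(\<Sum>z\<in>S. \<Sum>w\<in>S. c z * cnj (c w) * ?k w z) = of_real ((nrm (comb S c))\<^sup>2)"
    by (rule nrm_comb_sq[OF S(2), symmetric])
  also have "(\<lambda>m. \<Sum>z\<in>S. \<Sum>w\<in>S. c z * cnj (c w) * ?k (r *\<^sub>R w) (r *\<^sub>R z) * (of_real (?a m) * cinner_vec w z ^ m)) =
     (\<lambda>m. of_real (?a m * (\<Sum>l\<in>words m. (nrm (dcomb r S (\<lambda>z. c z * cnj (wmon l z))))\<^sup>2)))"
  proof
    fix m
    have "(\<Sum>z\<in>S. \<Sum>w\<in>S. c z * cnj (c w) * ?k (r *\<^sub>R w) (r *\<^sub>R z) * (of_real (?a m) * cinner_vec w z ^ m)) =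
      of_real (?a m) * (\<Sum>z\<in>S. \<Sum>w\<in>S. c z * cnj (c w) * (cinner_vec w z ^ m * ?k (r *\<^sub>R w) (r *\<^sub>R z)))"
      unfolding sum_distrib_left by (simp only: mult_ac)
    also have "\<dots> = of_real (?a m * (\<Sum>l\<in>words m. (nrm (dcomb r S (\<lambda>z. c z * cnj (wmon l z))))\<^sup>2))"
      unfolding cinner_pow_form of_real_mult of_real_sum K ..
    finally show "(\<Sum>z\<in>S. \<Sum>w\<in>S. c z * cnj (c w) * ?k (r *\<^sub>R w) (r *\<^sub>R z) * (of_real (?a m) * cinner_vec w z ^ m)) =
      of_real (?a m * (\<Sum>l\<in>words m. (nrm (dcomb r S (\<lambda>z. c z * cnj (wmon l z))))\<^sup>2))" .
  qed
  finally show ?thesis unfolding sums_of_real_iff .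
qed

lemma dil_mnorm:
  assumes f: "mult f" and r: "0 \<le> r" "r < 1"
  shows "mnorm (dil r f) \<le> mnorm f"
proof (cases "r = 0")
  case True
  have C: "cmod (f 0) \<le> mnorm f" by (rule mult_eval[OF f]) simp
  show ?thesis
  proof (rule mnorm_le[OF mnorm_ge0[OF f]])
    fix g assume g: "g \<in> H"
    have "dil r f * g = cscale (f 0) g"
      using True supp[OF g] by (auto simp: dil_def restrict0_def fun_eq_iff)
    then have "nrm (dil r f * g) = cmod (f 0) * nrm g" using g by (simp only: nrm_scale)
    then show "nrm (dil r f * g) \<le> mnorm f * nrm g" using C g by (simp add: mult_right_mono)
  qed
next
  case False
  then have r': "0 < r" using r by simp
  have "nrm (comb S (\<lambda>z. c z * cnj (f (r *\<^sub>R z)))) \<le> mnorm f * nrm (comb S c)"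
    if S: "finite S" "S \<subseteq> B" for S c
  proof -
    define a where "a m = (if m = 0 then 1 else 1 - r\<^sup>2)" for m :: nat
    have a: "a m \<ge> 0" for m using r by (simp add: a_def power_le_one)
    note sums = kernel_dilation[OF S r' r(2), folded a_def]
    have rS: "(*\<^sub>R) r ` S \<subseteq> B" using dil_ball[of r] r S by auto
    have term_le: "(nrm (dcomb r S (\<lambda>z. c z * cnj (f (r *\<^sub>R z)) * cnj (wmon l z))))\<^sup>2 \<le>
        (mnorm f)\<^sup>2 * (nrm (dcomb r S (\<lambda>z. c z * cnj (wmon l z))))\<^sup>2" for l
    proof -
      have "dcomb r S (\<lambda>z. c z * cnj (f (r *\<^sub>R z)) * cnj (wmon l z)) =
         comb ((*\<^sub>R) r ` S) (\<lambda>v. c (inverse r *\<^sub>R v) * cnj (wmon l (inverse r *\<^sub>R v)) * cnj (f v))"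
        unfolding dcomb_def using r' by (simp add: mult_ac)
      then have "nrm (dcomb r S (\<lambda>z. c z * cnj (f (r *\<^sub>R z)) * cnj (wmon l z))) \<le> mnorm f * nrm (dcomb r S (\<lambda>z. c z * cnj (wmon l z)))"
        unfolding dcomb_def by (simp only: adjoint_bound[OF f rS])
      moreover have "0 \<le> nrm (dcomb r S (\<lambda>z. c z * cnj (f (r *\<^sub>R z)) * cnj (wmon l z)))"
        unfolding dcomb_def by (intro nrm_ge0 comb_mem rS)
      ultimately show ?thesis unfolding power_mult_distrib[symmetric] by (rule power_mono)
    qed
    have "(nrm (comb S (\<lambda>z. c z * cnj (f (r *\<^sub>R z)))))\<^sup>2 \<le> (mnorm f)\<^sup>2 * (nrm (comb S c))\<^sup>2"
    proof (rule sums_le[OF _ sums[of "\<lambda>z. c z * cnj (f (r *\<^sub>R z))"] sums_mult[OF sums[of c], of "(mnorm f)\<^sup>2"]])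
      fix m
      have "(\<Sum>l\<in>words m. (nrm (dcomb r S (\<lambda>z. c z * cnj (f (r *\<^sub>R z)) * cnj (wmon l z))))\<^sup>2) \<le>
          (mnorm f)\<^sup>2 * (\<Sum>l\<in>words m. (nrm (dcomb r S (\<lambda>z. c z * cnj (wmon l z))))\<^sup>2)"
        unfolding sum_distrib_left by (intro sum_mono term_le)
      then have "a m * (\<Sum>l\<in>words m. (nrm (dcomb r S (\<lambda>z. c z * cnj (f (r *\<^sub>R z)) * cnj (wmon l z))))\<^sup>2) \<le>
          a m * ((mnorm f)\<^sup>2 * (\<Sum>l\<in>words m. (nrm (dcomb r S (\<lambda>z. c z * cnj (wmon l z))))\<^sup>2))"
        by (intro mult_left_mono a)
      then show "a m * (\<Sum>l\<in>words m. (nrm (dcomb r S (\<lambda>z. c z * cnj (f (r *\<^sub>R z)) * cnj (wmon l z))))\<^sup>2) \<le>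
          (mnorm f)\<^sup>2 * (a m * (\<Sum>l\<in>words m. (nrm (dcomb r S (\<lambda>z. c z * cnj (wmon l z))))\<^sup>2))"
        by (simp only: mult.left_commute)
    qed
    then have "(nrm (comb S (\<lambda>z. c z * cnj (f (r *\<^sub>R z)))))\<^sup>2 \<le> (mnorm f * nrm (comb S c))\<^sup>2"
      by (simp only: power_mult_distrib)
    then show ?thesis
      by (rule power2_le_imp_le) (intro mult_nonneg_nonneg mnorm_ge0[OF f] nrm_ge0 comb_mem[OF S(2)])
  qed
  note bd = this
  have "mnorm (\<lambda>z. f (r *\<^sub>R z)) \<le> mnorm f" by (rule multiplier_criterion(2)[OF mnorm_ge0[OF f] bd])
  then show ?thesis by (simp add: dil_def)
qed

end

section \<open>Dual norms and weak-* null sequences\<close>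

context reproducing_space
begin

lemma dual_spaceD:
  assumes "\<Psi> \<in> dual_space V mnorm"
  shows "\<And>f g. f \<in> V \<Longrightarrow> g \<in> V \<Longrightarrow> \<Psi> (f + g) = \<Psi> f + \<Psi> g"
    "\<And>c f. f \<in> V \<Longrightarrow> \<Psi> (cscale c f) = c * \<Psi> f"
    "\<exists>C. \<forall>f\<in>V. cmod (\<Psi> f) \<le> C * mnorm f"
  using assms unfolding dual_space_def by simp_all

lemma dual_norm_bdd:
  assumes V: "\<And>f. f \<in> V \<Longrightarrow> mult f" and bd: "\<And>f. f \<in> V \<Longrightarrow> cmod (\<Psi> f) \<le> C * mnorm f"
  shows "bdd_above ((\<lambda>f. cmod (\<Psi> f)) ` {f \<in> V. mnorm f \<le> 1})"
proof (rule bdd_aboveI2)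
  fix f assume f: "f \<in> {f \<in> V. mnorm f \<le> 1}"
  then have "C * mnorm f \<le> \<bar>C\<bar> * mnorm f" by (intro mult_right_mono mnorm_ge0 V) auto
  also have "\<dots> \<le> \<bar>C\<bar> * 1" using f by (intro mult_left_mono) auto
  finally show "cmod (\<Psi> f) \<le> \<bar>C\<bar>" using bd[of f] f by simp
qed

lemma dual_norm_upper:
  assumes V: "\<And>f. f \<in> V \<Longrightarrow> mult f" and bd: "\<And>f. f \<in> V \<Longrightarrow> cmod (\<Psi> f) \<le> C * mnorm f"
    and f: "f \<in> V" "mnorm f \<le> 1"
  shows "cmod (\<Psi> f) \<le> dual_norm V mnorm \<Psi>"
  unfolding dual_norm_def
  by (rule cSUP_upper[OF _ dual_norm_bdd[OF V bd]]) (use f in simp_all)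

lemma dual_norm_ge0:
  assumes V: "\<And>f. f \<in> V \<Longrightarrow> mult f" and bd: "\<And>f. f \<in> V \<Longrightarrow> cmod (\<Psi> f) \<le> C * mnorm f"
    and V0: "0 \<in> V"
  shows "0 \<le> dual_norm V mnorm \<Psi>"
proof -
  have "mnorm 0 \<le> 1" by (rule mnorm_le) auto
  then have "cmod (\<Psi> 0) \<le> dual_norm V mnorm \<Psi>" using dual_norm_upper[where V=V and C=C and \<Psi>=\<Psi>, OF V bd V0] by simp
  then show ?thesis using norm_ge_zero order_trans by blast
qed

lemma dual_norm_bound:
  assumes V: "\<And>f. f \<in> V \<Longrightarrow> mult f" and scl: "\<And>c f. f \<in> V \<Longrightarrow> cscale c f \<in> V"
    and \<Psi>: "\<Psi> \<in> dual_space V mnorm" and f: "f \<in> V"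
  shows "cmod (\<Psi> f) \<le> dual_norm V mnorm \<Psi> * mnorm f"
proof -
  obtain C where C: "\<And>f. f \<in> V \<Longrightarrow> cmod (\<Psi> f) \<le> C * mnorm f" using dual_spaceD(3)[OF \<Psi>] by auto
  show ?thesis
  proof (cases "mnorm f = 0")
    case True
    then show ?thesis using C[OF f] by simp
  next
    case False
    then have pos: "mnorm f > 0" using mnorm_ge0[OF V[OF f]] by linarith
    let ?c = "of_real (1 / mnorm f) :: complex"
    have "mnorm (cscale ?c f) = 1" using pos by (simp add: mnorm_scale V f norm_divide)
    then have "cmod (\<Psi> (cscale ?c f)) \<le> dual_norm V mnorm \<Psi>"
      by (intro dual_norm_upper[OF V C] scl f) auto
    then show ?thesis using pos by (simp add: dual_spaceD(2)[OF \<Psi> f] norm_divide norm_mult pos_divide_le_eq)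
  qed
qed

lemma dual_norm_le:
  assumes "0 \<in> V" "\<And>f. f \<in> V \<Longrightarrow> mnorm f \<le> 1 \<Longrightarrow> cmod (\<Psi> f) \<le> C"
  shows "dual_norm V mnorm \<Psi> \<le> C"
  unfolding dual_norm_def
proof (rule cSUP_least)
  have "mnorm 0 \<le> 1" by (rule mnorm_le) auto
  then show "{f \<in> V. mnorm f \<le> 1} \<noteq> {}" using assms(1) by blast
qed (use assms in auto)

lemma multiplication_bounded: assumes "mult f" shows "multiplication_op f \<in> bounded_operators H ip"
  unfolding bounded_operators_def multiplication_op_def
  using multD[OF assms] mnorm_bound[OF assms] by (auto simp: distrib_left cscale_times)

lemma normal_summable:
  assumes x: "\<And>n. x n \<in> H" "\<And>n. y n \<in> H"
    and s: "summable (\<lambda>n. (nrm (x n))\<^sup>2)" "summable (\<lambda>n. (nrm (y n))\<^sup>2)"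
  shows "summable (\<lambda>n. nrm (x n) * nrm (y n))"
proof (rule summable_comparison_test'[of _ 0])
  show "summable (\<lambda>n. (nrm (x n))\<^sup>2 + (nrm (y n))\<^sup>2)" by (intro summable_add s)
  fix n
  have "2 * (nrm (x n) * nrm (y n)) \<le> (nrm (x n))\<^sup>2 + (nrm (y n))\<^sup>2"
    using sum_squares_bound[of "nrm (x n)" "nrm (y n)"] by (simp add: mult.assoc)
  moreover have "0 \<le> nrm (x n) * nrm (y n)" using x by simp
  ultimately show "norm (nrm (x n) * nrm (y n)) \<le> (nrm (x n))\<^sup>2 + (nrm (y n))\<^sup>2" by simp
qed

text \<open>Normal functionals are absolutely convergent sums of functionals \<open>f \<mapsto> ip (f * x) y\<close>, and for each of
  these the claim is \<open>weakly_null\<close>.\<close>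

lemma pointwise_weakstar_null:
  assumes F: "\<And>n. mult (F n)" "\<And>n. mnorm (F n) \<le> C" and lim: "\<And>z. z \<in> X \<Longrightarrow> (\<lambda>n. F n z) \<longlonglongrightarrow> 0"
    and \<Lambda>: "\<Lambda> \<in> operators_predual H ip"
  shows "(\<lambda>n. \<Lambda> (multiplication_op (F n))) \<longlonglongrightarrow> 0"
proof -
  obtain x y where xy: "\<And>n. x n \<in> H" "\<And>n. y n \<in> H"
    and s: "summable (\<lambda>n. (nrm (x n))\<^sup>2)" "summable (\<lambda>n. (nrm (y n))\<^sup>2)"
    and rep: "\<And>T. T \<in> bounded_operators H ip \<Longrightarrow> \<Lambda> T = (\<Sum>n. ip (T (x n)) (y n))"
    using \<Lambda> unfolding operators_predual_def by auto
  have bdx: "nrm (F n * x j) \<le> C * nrm (x j)" for n j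
    using mnorm_bound[OF F(1) xy(1), of n j] mult_right_mono[OF F(2) nrm_ge0[OF xy(1)], of n j] by linarith
  have "(\<lambda>n. \<Sum>j. ip (F n * x j) (y j)) \<longlonglongrightarrow> (\<Sum>j::nat. 0)"
  proof (rule tannerys_theorem[THEN conjunct2, THEN conjunct2])
    show "summable (\<lambda>j. C * (nrm (x j) * nrm (y j)))"
      by (intro summable_mult normal_summable xy s)
    show "(\<lambda>n. ip (F n * x j) (y j)) \<longlonglongrightarrow> 0" for j
    proof (rule weakly_null[OF multD[OF F(1) xy(1)] bdx _ xy(2)])
      show "(\<lambda>n. (F n * x j) z) \<longlonglongrightarrow> 0" if "z \<in> X" for z
        unfolding times_fun_apply by (rule tendsto_mult_left_zero[OF lim[OF that]])
    qed
    have "cmod (ip (F n * x j) (y j)) \<le> C * (nrm (x j) * nrm (y j))" for n j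
    proof -
      have "cmod (ip (F n * x j) (y j)) \<le> nrm (F n * x j) * nrm (y j)"
        by (intro cauchy_schwarz multD F xy)
      also have "\<dots> \<le> C * nrm (x j) * nrm (y j)" by (intro mult_right_mono bdx nrm_ge0 xy)
      finally show ?thesis by (simp only: mult.assoc)
    qed
    then show "\<forall>\<^sub>F (j, n) in sequentially \<times>\<^sub>F sequentially. cmod (ip (F n * x j) (y j)) \<le> C * (nrm (x j) * nrm (y j))"
      by (intro always_eventually) auto
  qed simp
  then show ?thesis
    using rep[OF multiplication_bounded[OF F(1)]] by (simp add: multiplication_op_def)
qed

end

section \<open>Henkin functionals and dilations\<close>

locale henkin = drury_arveson_space +
  fixes \<Phi> :: "(complex ^ 'a \<Rightarrow> complex) \<Rightarrow> complex"
  assumes henkin: "henkin_functional H ip \<Phi>"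
begin

lemma \<Phi>_dual: "\<Phi> \<in> dual_space \<A> mnorm"
  using henkin by (simp add: henkin_functional_def)

lemmas \<Phi>_add = dual_spaceD(1)[OF \<Phi>_dual]
lemmas \<Phi>_scale = dual_spaceD(2)[OF \<Phi>_dual]

abbreviation dnorm :: "((complex ^ 'a \<Rightarrow> complex) \<Rightarrow> complex) \<Rightarrow> real" where
  "dnorm \<equiv> dual_norm \<A> mnorm"

lemma A_mult: "f \<in> \<A> \<Longrightarrow> mult f"
  using A_multiplier multiplierD by blast

lemma A_H: "f \<in> \<A> \<Longrightarrow> f \<in> H"
  using A_multiplier multiplierD by blast

lemma \<Phi>_bound: "f \<in> \<A> \<Longrightarrow> cmod (\<Phi> f) \<le> dnorm \<Phi> * mnorm f"
  by (rule dual_norm_bound[OF A_mult A_scale \<Phi>_dual])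

lemma dnorm_\<Phi>_ge0: "0 \<le> dnorm \<Phi>"
  by (rule dual_norm_ge0[OF A_mult \<Phi>_bound A_zero])

lemma \<Phi>_zero: "\<Phi> 0 = 0"
  using \<Phi>_scale[OF A_zero, of 0] by (simp add: cscale_alg(3))

lemma \<Phi>_diff: "f \<in> \<A> \<Longrightarrow> g \<in> \<A> \<Longrightarrow> \<Phi> (f - g) = \<Phi> f - \<Phi> g"
  unfolding diff_cscale by (simp only: \<Phi>_add A_scale \<Phi>_scale) simp

lemma \<Phi>_sum: "(\<And>i. i \<in> S \<Longrightarrow> F i \<in> \<A>) \<Longrightarrow> \<Phi> (\<Sum>i\<in>S. F i) = (\<Sum>i\<in>S. \<Phi> (F i))"
proof (induction S rule: infinite_finite_induct)
  case (insert x S)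
  have "\<Phi> (F x + sum F S) = \<Phi> (F x) + \<Phi> (sum F S)"
    using insert.prems by (intro \<Phi>_add A_sum) auto
  moreover have "\<Phi> (sum F S) = (\<Sum>i\<in>S. \<Phi> (F i))" using insert by simp
  ultimately show ?case by (simp only: sum.insert[OF insert.hyps(1,2)])
qed (simp_all add: \<Phi>_zero)

text \<open>The homogeneous polynomial \<open>Q m\<close> represents, as a vector of \<open>H\<close>, the action of \<open>\<Phi>\<close> on the components
  of degree \<open>m\<close>; see \<open>ip_Q\<close>.\<close>

definition Q :: "nat \<Rightarrow> complex ^ 'a \<Rightarrow> complex" where
  "Q m = homog m (\<lambda>l. cnj (\<Phi> (mon l)))"

lemma Q_mult: "mult (Q m)"
  by (simp add: Q_def homog_multiplier)

lemma \<Phi>_homog: "\<Phi> (res (homog m b)) = (\<Sum>l\<in>words m. b l * \<Phi> (mon l))"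
  unfolding res_homog by (simp only: \<Phi>_sum A_scale mon_A \<Phi>_scale)

text \<open>Testing \<open>\<Phi>\<close> on \<open>Q m\<close> itself gives the sum of the squares of the coefficients, which also bounds the
  square of the multiplier norm of \<open>Q m\<close>.\<close>

lemma Q_mnorm: "mnorm (Q m) \<le> dnorm \<Phi>"
proof -
  let ?L = "L2_set (\<lambda>l. cmod (cnj (\<Phi> (mon l)))) (words m)"
  \<comment> \<open>the coefficients of \<open>Q m\<close> are the conjugates of the values of \<open>\<Phi>\<close> at the monomials\<close>
  have "of_real (?L\<^sup>2) = \<Phi> (res (Q m))"
    unfolding Q_def \<Phi>_homog
    by (simp add: L2_set_def sum_nonneg complex_norm_square mult.commute del: of_real_power)
  then have "?L\<^sup>2 = cmod (\<Phi> (res (Q m)))"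
    using norm_of_real[of "?L\<^sup>2", where 'a = complex] by (simp only: abs_of_nonneg[OF zero_le_power2])
  also have "\<dots> \<le> dnorm \<Phi> * mnorm (res (Q m))" unfolding Q_def by (intro \<Phi>_bound homog_A)
  also have "\<dots> \<le> dnorm \<Phi> * ?L"
    unfolding mnorm_restrict0 Q_def by (intro mult_left_mono homog_multiplier dnorm_\<Phi>_ge0)
  finally have le: "?L * ?L \<le> dnorm \<Phi> * ?L" by (simp add: power2_eq_square)
  have "?L \<le> dnorm \<Phi>"
  proof (cases "?L = 0")
    case False
    then have "?L > 0" using L2_set_nonneg[of "\<lambda>l. cmod (cnj (\<Phi> (mon l)))" "words m"] by linarith
    then show ?thesis using le by simp
  qed (use dnorm_\<Phi>_ge0 in simp)
  then show ?thesis using homog_multiplier(2)[of m "\<lambda>l. cnj (\<Phi> (mon l))"] by (simp add: Q_def)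
qed

lemma Q_mem: "res (Q m) \<in> H" by (rule mult_mem[OF Q_mult])

lemma Q_nrm: "nrm (res (Q m)) \<le> dnorm \<Phi>"
  using nrm_le_mnorm[OF Q_mult] Q_mnorm order_trans by blast

lemma ip_Q: assumes f: "f \<in> H" shows "ip f (res (Q m)) = \<Phi> (res (hpart m f))"
  unfolding Q_def ip_homog[OF f] hpart_def \<Phi>_homog by (simp add: hcoef_def mult.commute)

lemma \<Phi>_dil_sums:
  assumes f: "f \<in> H" and r: "0 \<le> r" "r < 1"
  shows "(\<lambda>m. of_real (r ^ m) * \<Phi> (res (hpart m f))) sums \<Phi> (dil r f)"
proof -
  have P: "(\<Sum>m<N. of_real (r ^ m) * \<Phi> (res (hpart m f))) = \<Phi> (\<Sum>m<N. dil_part r f m)" for N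
    by (simp only: \<Phi>_sum dil_part_A) (simp only: dil_part_def hpart_def \<Phi>_scale homog_A)
  have sA: "(\<Sum>m<N. dil_part r f m) \<in> \<A>" for N by (intro A_sum dil_part_A)
  have "(\<lambda>N. \<Phi> (\<Sum>m<N. dil_part r f m) - \<Phi> (dil r f)) \<longlonglongrightarrow> 0"
  proof (rule Lim_null_comparison[OF always_eventually[OF allI]])
    show "(\<lambda>N. dnorm \<Phi> * mnorm (dil r f - (\<Sum>m<N. dil_part r f m))) \<longlonglongrightarrow> 0"
      by (rule tendsto_mult_right_zero[OF dil_series(2)[OF assms]])
    fix N
    have "\<Phi> (dil r f - (\<Sum>m<N. dil_part r f m)) = \<Phi> (dil r f) - \<Phi> (\<Sum>m<N. dil_part r f m)"
      by (intro \<Phi>_diff dil_A assms sA)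
    moreover have "cmod (\<Phi> (dil r f - (\<Sum>m<N. dil_part r f m))) \<le> dnorm \<Phi> * mnorm (dil r f - (\<Sum>m<N. dil_part r f m))"
      by (intro \<Phi>_bound A_diff dil_A assms sA)
    ultimately show "norm (\<Phi> (\<Sum>m<N. dil_part r f m) - \<Phi> (dil r f)) \<le> dnorm \<Phi> * mnorm (dil r f - (\<Sum>m<N. dil_part r f m))"
      by (simp only: norm_minus_commute)
  qed
  then show ?thesis unfolding sums_def P by (rule LIM_zero_cancel)
qed

text \<open>The representing vector is \<open>\<Sum>m. r ^ m Q m\<close>, which converges because the polynomials \<open>Q m\<close> are bounded
  in \<open>H\<close>.\<close>

lemma \<Phi>_dil_rep:
  assumes r: "0 \<le> r" "r < 1"
  obtains y where "y \<in> H" "\<And>f. f \<in> H \<Longrightarrow> \<Phi> (dil r f) = ip f y"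
proof -
  let ?v = "\<lambda>m. cscale (of_real (r ^ m)) (res (Q m))"
  have v: "?v m \<in> H" for m by (intro scale_mem Q_mem)
  have "summable (\<lambda>m. r ^ m * dnorm \<Phi>)" using r by (intro summable_mult2 summable_geometric) simp
  then have "summable (\<lambda>m. nrm (?v m))"
    by (rule summable_comparison_test'[of _ 0])
      (use r Q_nrm in \<open>simp add: nrm_scale Q_mem norm_power mult_left_mono\<close>)
  then obtain y where y: "y \<in> H" "(\<lambda>n. nrm ((\<Sum>m<n. ?v m) - y)) \<longlonglongrightarrow> 0"
    using abs_convergent_series[of ?v] v by blast
  have "\<Phi> (dil r f) = ip f y" if f: "f \<in> H" for f
  proof -
    have "(\<lambda>n. ip f (\<Sum>m<n. ?v m)) \<longlonglongrightarrow> ip f y"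
      by (rule tendsto_ip_right[OF sum_mem[OF v] y(1) f y(2)])
    also have "(\<lambda>n. ip f (\<Sum>m<n. ?v m)) = (\<lambda>n. \<Sum>m<n. of_real (r ^ m) * \<Phi> (res (hpart m f)))"
      by (simp only: ip_sum_right[OF v f] ip_scale_right[OF Q_mem f] ip_Q[OF f] complex_cnj_complex_of_real)
    finally show ?thesis using \<Phi>_dil_sums[OF f r] unfolding sums_def using LIMSEQ_unique by blast
  qed
  then show ?thesis using that y(1) by blast
qed

definition defect :: "real \<Rightarrow> real" where
  "defect r = dnorm (\<lambda>f. \<Phi> f - \<Phi> (dil r f))"

lemma diff_dil_bound:
  assumes r: "0 \<le> r" "r < 1" and f: "f \<in> \<A>"
  shows "f - dil r f \<in> \<A>" "\<Phi> f - \<Phi> (dil r f) = \<Phi> (f - dil r f)" "mnorm (f - dil r f) \<le> 2 * mnorm f"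
    "cmod (\<Phi> f - \<Phi> (dil r f)) \<le> 2 * dnorm \<Phi> * mnorm f"
proof -
  have d: "dil r f \<in> \<A>" by (intro dil_A A_H f r)
  show m: "f - dil r f \<in> \<A>" by (intro A_diff f d)
  show eq: "\<Phi> f - \<Phi> (dil r f) = \<Phi> (f - dil r f)" by (rule \<Phi>_diff[OF f d, symmetric])
  have "mnorm (f - dil r f) \<le> mnorm f + mnorm (dil r f)" by (intro mnorm_triangle_diff A_mult f d)
  then show le: "mnorm (f - dil r f) \<le> 2 * mnorm f" using dil_mnorm[OF A_mult[OF f] r] by linarith
  have "cmod (\<Phi> (f - dil r f)) \<le> dnorm \<Phi> * mnorm (f - dil r f)" by (rule \<Phi>_bound[OF m])
  also have "\<dots> \<le> dnorm \<Phi> * (2 * mnorm f)" by (intro mult_left_mono le dnorm_\<Phi>_ge0)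
  finally show "cmod (\<Phi> f - \<Phi> (dil r f)) \<le> 2 * dnorm \<Phi> * mnorm f" unfolding eq by (simp only: mult_ac)
qed

lemma defect_ge0: "0 \<le> r \<Longrightarrow> r < 1 \<Longrightarrow> 0 \<le> defect r"
  unfolding defect_def by (rule dual_norm_ge0[OF A_mult diff_dil_bound(4) A_zero])

lemma kern_dil_tendsto:
  assumes z: "z \<in> B" and S: "\<And>n. 0 < S n" "\<And>n. S n < 1" "S \<longlonglongrightarrow> 1"
  shows "(\<lambda>n. nrm (kern z - kern (S n *\<^sub>R z))) \<longlonglongrightarrow> 0"
proof -
  define \<rho> where "\<rho> = (norm z)\<^sup>2"
  have \<rho>: "\<rho> < 1" using z by (simp add: \<rho>_def power_less_one_iff abs_square_less_1)
  have w: "S n *\<^sub>R z \<in> B" for n using dil_ball[OF less_imp_le[OF S(1)] less_imp_le[OF S(2)] z] .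
  have k: "ip (kern (s *\<^sub>R z)) (kern (t *\<^sub>R z)) = of_real (1 / (1 - s * t * \<rho>))"
    if "s *\<^sub>R z \<in> B" "t *\<^sub>R z \<in> B" for s t
    using that reproduce[OF kern_mem[OF that(1)] that(2)]
    by (simp add: kern_def restrict0_def scaleR_smult cinner_scale cinner_self \<rho>_def mult_ac)
  have z1: "1 *\<^sub>R z \<in> B" using z by simp
  have sq: "(nrm (kern z - kern (S n *\<^sub>R z)))\<^sup>2 =
      1 / (1 - \<rho>) - 2 * (1 / (1 - S n * \<rho>)) + 1 / (1 - S n * S n * \<rho>)" for n
  proof -
    have "(nrm (kern z - kern (S n *\<^sub>R z)))\<^sup>2 =
        Re (ip (kern z) (kern z)) - 2 * Re (ip (kern z) (kern (S n *\<^sub>R z))) + Re (ip (kern (S n *\<^sub>R z)) (kern (S n *\<^sub>R z)))"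
      by (simp only: nrm_sq_diff nrm_sq kern_mem z w)
    then show ?thesis using k[OF z1 z1] k[OF z1 w[of n]] k[OF w[of n] w[of n]] by simp
  qed
  have "(\<lambda>n. 1 / (1 - \<rho>) - 2 * (1 / (1 - S n * \<rho>)) + 1 / (1 - S n * S n * \<rho>)) \<longlonglongrightarrow>
      1 / (1 - \<rho>) - 2 * (1 / (1 - 1 * \<rho>)) + 1 / (1 - 1 * 1 * \<rho>)"
    using \<rho> by (intro tendsto_intros S(3)) auto
  then have "(\<lambda>n. (nrm (kern z - kern (S n *\<^sub>R z)))\<^sup>2) \<longlonglongrightarrow> 0" unfolding sq by simp
  then have "(\<lambda>n. sqrt ((nrm (kern z - kern (S n *\<^sub>R z)))\<^sup>2)) \<longlonglongrightarrow> sqrt 0" by (rule tendsto_real_sqrt)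
  then show ?thesis using nrm_ge0[OF diff_mem[OF kern_mem[OF z] kern_mem[OF w]]] by (simp del: minus_apply)
qed

text \<open>Here the Henkin property enters. For almost extremal \<open>f n\<close>, the
  functions \<open>f n - dil (S n) (f n)\<close> are bounded multipliers that tend to zero pointwise, because
  evaluation at \<open>z\<close> and at \<open>S n z\<close> are close in norm, uniformly on bounded sets.\<close>

lemma defect_tendsto: "(defect \<longlongrightarrow> 0) (at_left 1)"
proof (rule tendsto_at_left_sequentially[of 0])
  fix S :: "nat \<Rightarrow> real" assume S: "\<And>n. S n < 1" "\<And>n. 0 < S n" "S \<longlonglongrightarrow> 1"
  have S0: "0 \<le> S n" for n using S(2)[of n] by simp
  have ex: "\<exists>f. f \<in> \<A> \<and> mnorm f \<le> 1 \<and> defect (S n) - 1 / real (Suc n) < cmod (\<Phi> f - \<Phi> (dil (S n) f))" for n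
  proof -
    have ne: "{f \<in> \<A>. mnorm f \<le> 1} \<noteq> {}" using A_zero mnorm_le[of 1 0] by auto
    have lt: "defect (S n) - 1 / real (Suc n) < (SUP f\<in>{f \<in> \<A>. mnorm f \<le> 1}. cmod (\<Phi> f - \<Phi> (dil (S n) f)))"
      by (simp add: defect_def dual_norm_def)
    have "\<exists>f\<in>{f \<in> \<A>. mnorm f \<le> 1}. defect (S n) - 1 / real (Suc n) < cmod (\<Phi> f - \<Phi> (dil (S n) f))"
      by (rule less_cSUP_iff[THEN iffD1, OF ne _ lt]) (rule dual_norm_bdd[OF A_mult diff_dil_bound(4)[OF S0 S(1)]])
    then obtain f where "f \<in> {f \<in> \<A>. mnorm f \<le> 1}" "defect (S n) - 1 / real (Suc n) < cmod (\<Phi> f - \<Phi> (dil (S n) f))"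
      by (rule bexE)
    then show ?thesis by (intro exI[of _ f]) simp
  qed
  obtain f where f: "\<And>n. f n \<in> \<A>" "\<And>n. mnorm (f n) \<le> 1"
    "\<And>n. defect (S n) - 1 / real (Suc n) < cmod (\<Phi> (f n) - \<Phi> (dil (S n) (f n)))"
  proof -
    have "\<forall>n. \<exists>f. f \<in> \<A> \<and> mnorm f \<le> 1 \<and> defect (S n) - 1 / real (Suc n) < cmod (\<Phi> f - \<Phi> (dil (S n) f))"
      by (intro allI ex)
    from choice[OF this] obtain g where g: "\<forall>n. g n \<in> \<A> \<and> mnorm (g n) \<le> 1 \<and>
        defect (S n) - 1 / real (Suc n) < cmod (\<Phi> (g n) - \<Phi> (dil (S n) (g n)))" by (rule exE)
    show ?thesis by (rule that[of g]; use g in \<open>simp only: simp_thms\<close>)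
  qed
  define F where "F = (\<lambda>n. f n - dil (S n) (f n))"
  have FA: "F n \<in> \<A>" for n unfolding F_def by (rule diff_dil_bound(1)[OF S0 S(1) f(1)])
  have Fn: "mnorm (F n) \<le> 2" for n
    using diff_dil_bound(3)[OF S0 S(1) f(1), of n n] f(2)[of n] unfolding F_def by linarith
  have Fz: "(\<lambda>n. F n z) \<longlonglongrightarrow> 0" if z: "z \<in> B" for z
  proof (rule Lim_null_comparison[OF always_eventually[OF allI] kern_dil_tendsto[OF z S(2,1,3)]])
    fix n
    have w: "S n *\<^sub>R z \<in> B" by (rule dil_ball[OF S0 less_imp_le[OF S(1)] z])
    have fH: "f n \<in> H" by (rule A_H[OF f(1)])
    have "F n z = ip (f n) (kern z - kern (S n *\<^sub>R z))"
      using z w by (simp add: F_def dil_def restrict0_def ip_diff_right fH reproduce)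
    then have "cmod (F n z) \<le> nrm (f n) * nrm (kern z - kern (S n *\<^sub>R z))"
      by (simp only: cauchy_schwarz fH diff_mem kern_mem z w)
    also have "\<dots> \<le> 1 * nrm (kern z - kern (S n *\<^sub>R z))"
      using nrm_le_mnorm_multiplier[OF A_multiplier[OF f(1)], of n] f(2)[of n] z w by (intro mult_right_mono nrm_ge0 diff_mem kern_mem) auto
    finally show "norm (F n z) \<le> nrm (kern z - kern (S n *\<^sub>R z))" by simp
  qed
  have "multiplier_weakstar_null H ip F"
    unfolding multiplier_weakstar_null_def
  proof
    fix \<Psi> assume "\<Psi> \<in> multiplier_predual H ip"
    then obtain \<Lambda> where \<Lambda>: "\<Lambda> \<in> operators_predual H ip" "\<And>f. f \<in> \<M> \<Longrightarrow> \<Psi> f = \<Lambda> (multiplication_op f)"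
      unfolding multiplier_predual_def by auto
    show "(\<lambda>n. \<Psi> (F n)) \<longlonglongrightarrow> 0"
      using pointwise_weakstar_null[OF A_mult[OF FA] Fn Fz \<Lambda>(1)] \<Lambda>(2)[OF A_multiplier[OF FA]] by simp
  qed
  then have "(\<lambda>n. \<Phi> (F n)) \<longlonglongrightarrow> 0" using henkin FA unfolding henkin_functional_def by blast
  then have "(\<lambda>n. cmod (\<Phi> (F n)) + 1 / real (Suc n)) \<longlonglongrightarrow> 0 + 0"
    using LIMSEQ_inverse_real_of_nat by (intro tendsto_add tendsto_norm_zero) (simp_all add: inverse_eq_divide)
  then have lim: "(\<lambda>n. cmod (\<Phi> (F n)) + 1 / real (Suc n)) \<longlonglongrightarrow> 0" by simp
  show "(\<lambda>n. defect (S n)) \<longlonglongrightarrow> 0"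
  proof (rule Lim_null_comparison[OF always_eventually[OF allI] lim])
    fix n
    show "norm (defect (S n)) \<le> cmod (\<Phi> (F n)) + 1 / real (Suc n)"
      using f(3)[of n] defect_ge0[OF S0 S(1), of n] diff_dil_bound(2)[OF S0 S(1) f(1), of n n] unfolding F_def by simp
  qed
qed simp

end

section \<open>The Hahn--Banach theorem\<close>

text \<open>The theorem is stated for a space of complex functions, regarded as a real vector space. It is proved by
  minimal sublinear functionals, which avoids extending functionals step by step.\<close>

definition sublinear_on :: "('a \<Rightarrow> complex) set \<Rightarrow> (('a \<Rightarrow> complex) \<Rightarrow> real) \<Rightarrow> bool" where
  "sublinear_on V q \<longleftrightarrow> (\<forall>x\<in>V. \<forall>y\<in>V. q (x + y) \<le> q x + q y) \<and>
     (\<forall>x\<in>V. \<forall>t>0. q (cscale (of_real t) x) = t * q x)"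

context
  fixes V :: "('a \<Rightarrow> complex) set"
  assumes V: "csubspace V"
begin

lemma subspace_mem: "0 \<in> V" "\<And>x y. x \<in> V \<Longrightarrow> y \<in> V \<Longrightarrow> x + y \<in> V" "\<And>c x. x \<in> V \<Longrightarrow> cscale c x \<in> V"
  using V by (simp_all add: csubspace_def)

lemma subspace_neg: "x \<in> V \<Longrightarrow> - x \<in> V"
  using subspace_mem(3)[of x "-1"] by (simp only: cscale_alg(7))

context
  fixes q :: "('a \<Rightarrow> complex) \<Rightarrow> real"
  assumes q: "sublinear_on V q"
begin

lemma q_add: "x \<in> V \<Longrightarrow> y \<in> V \<Longrightarrow> q (x + y) \<le> q x + q y"
  using q by (simp add: sublinear_on_def)

lemma q_scale: "x \<in> V \<Longrightarrow> t > 0 \<Longrightarrow> q (cscale (of_real t) x) = t * q x"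
  using q by (simp add: sublinear_on_def)

lemma q_zero: "q 0 = 0"
  using q_scale[OF subspace_mem(1), of 2] by (simp only: cscale_alg(8)) simp

lemma q_scale0: "x \<in> V \<Longrightarrow> t \<ge> 0 \<Longrightarrow> q (cscale (of_real t) x) = t * q x"
  using q_scale[of x t] q_zero by (cases "t = 0") (simp_all add: cscale_alg(3) del: cscale_apply)

lemma q_neg: assumes "x \<in> V" shows "- q (- x) \<le> q x"
  using q_add[OF assms subspace_neg[OF assms]] q_zero by simp

text \<open>The largest sublinear functional that is below \<open>q\<close> and at most \<open>- q v\<close> at \<open>- v\<close>.\<close>

definition lower :: "('a \<Rightarrow> complex) \<Rightarrow> ('a \<Rightarrow> complex) \<Rightarrow> real" where
  "lower v x = (INF t\<in>{0..}. q (x + cscale (of_real t) v) - t * q v)"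

lemma lower_bdd:
  assumes "v \<in> V" "x \<in> V"
  shows "bdd_below ((\<lambda>t. q (x + cscale (of_real t) v) - t * q v) ` {0..})"
proof (rule bdd_belowI2)
  fix t :: real assume t: "t \<in> {0..}"
  have "q (cscale (of_real t) v) \<le> q (x + cscale (of_real t) v) + q (- x)"
    using q_add[OF subspace_mem(2)[OF assms(2) subspace_mem(3)[OF assms(1)]] subspace_neg[OF assms(2)], of "of_real t"] by simp
  then show "- q (- x) \<le> q (x + cscale (of_real t) v) - t * q v"
    using q_scale0[OF assms(1)] t by simp
qed

lemma lower_le: "v \<in> V \<Longrightarrow> x \<in> V \<Longrightarrow> t \<ge> 0 \<Longrightarrow> lower v x \<le> q (x + cscale (of_real t) v) - t * q v"
  unfolding lower_def by (rule cINF_lower[OF lower_bdd]) auto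

lemma lower_le_q: "v \<in> V \<Longrightarrow> x \<in> V \<Longrightarrow> lower v x \<le> q x"
  using lower_le[of v x 0] by (simp add: cscale_alg(3) del: cscale_apply)

lemma lower_approx:
  assumes "e > 0"
  obtains t where "t \<ge> 0" "q (x + cscale (of_real t) v) - t * q v < lower v x + e"
proof -
  have "\<exists>a\<in>(\<lambda>t. q (x + cscale (of_real t) v) - t * q v) ` {0..}. a < lower v x + e"
    using assms unfolding lower_def by (intro cInf_lessD) auto
  then show ?thesis using that by auto
qed

lemma lower_neg: "v \<in> V \<Longrightarrow> lower v (- v) \<le> - q v"
  using lower_le[of v "- v" 1] q_zero subspace_neg[of v] by (simp add: cscale_alg(2) del: cscale_apply)

lemma lower_sublinear:
  assumes v: "v \<in> V" shows "sublinear_on V (lower v)"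
  unfolding sublinear_on_def
proof (intro conjI ballI allI impI)
  fix x y assume x: "x \<in> V" and y: "y \<in> V"
  show "lower v (x + y) \<le> lower v x + lower v y"
  proof (rule field_le_epsilon)
    fix e :: real assume e: "e > 0"
    obtain s where s: "s \<ge> 0" "q (x + cscale (of_real s) v) - s * q v < lower v x + e / 2"
      using lower_approx[of "e / 2"] e by auto
    obtain t where t: "t \<ge> 0" "q (y + cscale (of_real t) v) - t * q v < lower v y + e / 2"
      using lower_approx[of "e / 2"] e by auto
    have eq: "x + y + cscale (of_real (s + t)) v = (x + cscale (of_real s) v) + (y + cscale (of_real t) v)"
      by (auto simp: fun_eq_iff algebra_simps)
    have "lower v (x + y) \<le> q (x + y + cscale (of_real (s + t)) v) - (s + t) * q v"
      using s t by (intro lower_le v subspace_mem x y) auto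
    also have "q (x + y + cscale (of_real (s + t)) v) \<le> q (x + cscale (of_real s) v) + q (y + cscale (of_real t) v)"
      unfolding eq by (intro q_add subspace_mem x y v)
    finally show "lower v (x + y) \<le> lower v x + lower v y + e"
      using s t by (simp only: distrib_right) linarith
  qed
next
  fix x and t :: real assume x: "x \<in> V" and t: "t > 0"
  have half: "lower v (cscale (of_real t) x) \<le> t * lower v x" if tx: "t > 0" "x \<in> V" for t x
  proof (rule field_le_epsilon)
    fix e :: real assume e: "e > 0"
    obtain s where s: "s \<ge> 0" "q (x + cscale (of_real s) v) - s * q v < lower v x + e / t"
      using lower_approx[of "e / t"] e tx(1) by auto
    have eq: "cscale (of_real t) x + cscale (of_real (t * s)) v = cscale (of_real t) (x + cscale (of_real s) v)"
      by (auto simp: fun_eq_iff algebra_simps)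
    have "lower v (cscale (of_real t) x) \<le> q (cscale (of_real t) x + cscale (of_real (t * s)) v) - t * s * q v"
      using s that by (intro lower_le v subspace_mem) auto
    also have "\<dots> = t * (q (x + cscale (of_real s) v) - s * q v)"
      unfolding eq using that v by (subst q_scale) (auto intro!: subspace_mem simp: algebra_simps)
    also have "\<dots> \<le> t * (lower v x + e / t)" using s that by (intro mult_left_mono) auto
    also have "\<dots> = t * lower v x + e" using that by (simp add: distrib_left)
    finally show "lower v (cscale (of_real t) x) \<le> t * lower v x + e" .
  qed
  have "lower v x = lower v (cscale (of_real (1 / t)) (cscale (of_real t) x))"
    using t by (simp add: cscale_alg(1,2) del: cscale_apply)
  also have "\<dots> \<le> (1 / t) * lower v (cscale (of_real t) x)" using t x by (intro half subspace_mem) auto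
  finally have "t * lower v x \<le> lower v (cscale (of_real t) x)" using t by (simp add: field_simps)
  then show "lower v (cscale (of_real t) x) = t * lower v x" using half[OF t x] by linarith
qed

end

text \<open>Zorn's lemma for the reversed pointwise order. Functionals are cut off outside \<open>V\<close> to make this
  order antisymmetric.\<close>

lemma minimal_sublinear:
  assumes p: "sublinear_on V p"
  shows "\<exists>q. sublinear_on V q \<and> (\<forall>x\<in>V. q x \<le> p x) \<and>
    (\<forall>q'. sublinear_on V q' \<longrightarrow> (\<forall>x\<in>V. q' x \<le> q x) \<longrightarrow> (\<forall>x\<in>V. q' x = q x))"
proof -
  define S where "S = {q. sublinear_on V q \<and> (\<forall>x\<in>V. q x \<le> p x) \<and> (\<forall>x. x \<notin> V \<longrightarrow> q x = 0)}"
  define le where "le = (\<lambda>q q'. \<forall>x\<in>V. q' x \<le> (q x :: real))"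
  define cut where "cut = (\<lambda>(q :: ('a \<Rightarrow> complex) \<Rightarrow> real) x. if x \<in> V then q x else 0)"
  have cut_S: "cut q \<in> S" if "sublinear_on V q" "\<And>x. x \<in> V \<Longrightarrow> q x \<le> p x" for q
    using that subspace_mem unfolding S_def sublinear_on_def cut_def by simp
  have SD: "sublinear_on V q" "\<And>x. x \<in> V \<Longrightarrow> q x \<le> p x" if "q \<in> S" for q
    using that unfolding S_def by blast+
  have bd: "- p (- x) \<le> q x" if "q \<in> S" "x \<in> V" for q x
    using q_neg[OF SD(1)[OF that(1)] that(2)] SD(2)[OF that(1) subspace_neg[OF that(2)]] by linarith
  have "\<exists>m\<in>S. \<forall>q\<in>S. le m q \<longrightarrow> q = m"
  proof (rule predicate_Zorn)
    show "partial_order_on S (relation_of le S)"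
    proof (rule partial_order_on_relation_ofI)
      fix q q' assume *: "q \<in> S" "q' \<in> S" "le q q'" "le q' q"
      show "q = q'"
      proof
        fix x show "q x = q' x"
          using * unfolding le_def S_def by (cases "x \<in> V") (auto intro: antisym)
      qed
    qed (auto simp: le_def intro: order_trans)
    fix C assume "C \<in> Chains (relation_of le S)"
    then have CR: "(q, q') \<in> relation_of le S \<or> (q', q) \<in> relation_of le S" if "q \<in> C" "q' \<in> C" for q q'
      using that unfolding Chains_def by blast
    have CS: "q \<in> S" if "q \<in> C" for q
      using CR[OF that that] unfolding relation_of_def by blast
    have chain: "le q q' \<or> le q' q" if "q \<in> C" "q' \<in> C" for q q'
      using CR[OF that] unfolding relation_of_def by blast
    show "\<exists>u\<in>S. \<forall>q\<in>C. le q u"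
    proof (cases "C = {}")
      case True
      then show ?thesis using cut_S[OF p] by blast
    next
      case False
      define u where "u x = (INF q\<in>C. q x)" for x
      have bdC: "bdd_below ((\<lambda>q. q x) ` C)" if "x \<in> V" for x
        using bd[OF CS that] by (rule bdd_belowI2)
      have u_le: "u x \<le> q x" if "x \<in> V" "q \<in> C" for x q
        unfolding u_def by (rule cINF_lower[OF bdC[OF that(1)] that(2)])
      have u_ge: "a \<le> u x" if "\<And>q. q \<in> C \<Longrightarrow> a \<le> q x" for a x
        unfolding u_def by (rule cINF_greatest[OF False that])
      have "u x \<le> p x" if "x \<in> V" for x
      proof -
        obtain q where "q \<in> C" using False by blast
        then show ?thesis using u_le[OF that] SD(2)[OF CS that] order_trans by blast
      qed
      moreover have "sublinear_on V u"
        unfolding sublinear_on_def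
      proof (intro conjI ballI allI impI)
        fix x y assume x: "x \<in> V" and y: "y \<in> V"
        \<comment> \<open>of two members of the chain, the smaller one can be used at both points\<close>
        have le2: "u (x + y) \<le> q x + q' y" if qq: "q \<in> C" "q' \<in> C" for q q'
        proof -
          obtain r where r: "r \<in> C" "r x \<le> q x" "r y \<le> q' y"
            using chain[OF qq] qq x y unfolding le_def by auto
          have "u (x + y) \<le> r (x + y)" by (rule u_le[OF subspace_mem(2)[OF x y] r(1)])
          also have "\<dots> \<le> r x + r y" by (rule q_add[OF SD(1)[OF CS[OF r(1)]] x y])
          finally show ?thesis using r by linarith
        qed
        have "u (x + y) - q x \<le> u y" if "q \<in> C" for q
          by (rule u_ge) (use le2[OF that] in \<open>simp add: diff_le_eq add.commute\<close>)
        then have "u (x + y) - u y \<le> u x" by (intro u_ge) (simp add: diff_le_eq add.commute)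
        then show "u (x + y) \<le> u x + u y" by simp
      next
        fix x and t :: real assume x: "x \<in> V" and t: "t > 0"
        have tx: "cscale (of_real t) x \<in> V" by (rule subspace_mem(3)[OF x])
        have sc: "q (cscale (of_real t) x) = t * q x" if "q \<in> C" for q
          by (rule q_scale[OF SD(1)[OF CS[OF that]] x t])
        have "u (cscale (of_real t) x) / t \<le> u x"
          by (rule u_ge) (use u_le[OF tx] sc t in \<open>simp add: pos_divide_le_eq mult.commute\<close>)
        moreover have "t * u x \<le> u (cscale (of_real t) x)"
        proof (rule u_ge)
          fix q assume q: "q \<in> C"
          show "t * u x \<le> q (cscale (of_real t) x)"
            unfolding sc[OF q] using u_le[OF x q] t by simp
        qed
        ultimately show "u (cscale (of_real t) x) = t * u x"
          using t by (simp add: pos_divide_le_eq mult.commute)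
      qed
      ultimately have "cut u \<in> S" by (intro cut_S)
      moreover have "le q (cut u)" if "q \<in> C" for q
        using u_le that unfolding le_def cut_def by simp
      ultimately show ?thesis by blast
    qed
  qed
  then obtain m where m: "m \<in> S" "\<forall>q\<in>S. le m q \<longrightarrow> q = m" by (rule bexE)
  show ?thesis
  proof (intro exI[of _ m] conjI ballI allI impI)
    fix q' x assume q1: "sublinear_on V q'" and q2: "\<forall>x\<in>V. q' x \<le> m x" and x: "x \<in> V"
    note q' = q1 q2[rule_format]
    have "q' y \<le> p y" if "y \<in> V" for y
      using q'(2)[OF that] SD(2)[OF m(1) that] by linarith
    then have "cut q' \<in> S" using q'(1) by (intro cut_S)
    moreover have "le m (cut q')" using q'(2) unfolding le_def cut_def by simp
    ultimately have "cut q' = m" using m(2) by simp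
    then have "m x = cut q' x" by simp
    then show "q' x = m x" using x unfolding cut_def by simp
  qed (use SD[OF m(1)] in simp_all)
qed

text \<open>A minimal sublinear functional is additive, because lowering it in any direction does not change it.
  Lowering \<open>p\<close> in the direction \<open>v\<close> first fixes the value at \<open>v\<close>.\<close>

lemma hahn_banach:
  assumes p: "sublinear_on V p" and v: "v \<in> V"
  shows "\<exists>F. (\<forall>x\<in>V. \<forall>y\<in>V. F (x + y) = F x + F y) \<and> (\<forall>t. \<forall>x\<in>V. F (cscale (of_real t) x) = t * F x) \<and>
    (\<forall>x\<in>V. F x \<le> p x) \<and> F v = (p v :: real)"
proof -
  obtain q where q': "sublinear_on V q \<and> (\<forall>x\<in>V. q x \<le> lower p v x) \<and>
    (\<forall>q'. sublinear_on V q' \<longrightarrow> (\<forall>x\<in>V. q' x \<le> q x) \<longrightarrow> (\<forall>x\<in>V. q' x = q x))"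
    using minimal_sublinear[OF lower_sublinear[OF p v]] by (rule exE)
  have q: "sublinear_on V q" "\<And>x. x \<in> V \<Longrightarrow> q x \<le> lower p v x"
    and min: "\<And>q' x. sublinear_on V q' \<Longrightarrow> (\<And>x. x \<in> V \<Longrightarrow> q' x \<le> q x) \<Longrightarrow> x \<in> V \<Longrightarrow> q' x = q x"
    using q' by simp_all
  have add: "q (x + y) = q x + q y" if x: "x \<in> V" and y: "y \<in> V" for x y
  proof (rule antisym[OF q_add[OF q(1) x y]])
    have "lower q y x = q x" by (rule min[OF lower_sublinear[OF q(1) y] lower_le_q[OF q(1) y] x])
    then show "q x + q y \<le> q (x + y)" using lower_le[OF q(1) y x, of 1] by (simp add: cscale_alg(2) del: cscale_apply)
  qed
  have neg: "q (- x) = - q x" if x: "x \<in> V" for x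
    using add[OF x subspace_neg[OF x]] q_zero[OF q(1)] by simp
  have scale: "q (cscale (of_real t) x) = t * q x" if x: "x \<in> V" for t x
  proof (cases "t \<ge> 0")
    case True
    then show ?thesis by (rule q_scale0[OF q(1) x])
  next
    case False
    have "cscale (of_real t) x = - cscale (of_real (- t)) x" by (auto simp: fun_eq_iff)
    then have "q (cscale (of_real t) x) = - q (cscale (of_real (- t)) x)"
      using neg[OF subspace_mem(3)[OF x], of "of_real (- t)"] by (simp only:)
    then show ?thesis using q_scale0[OF q(1) x, of "- t"] False by simp
  qed
  have le: "q x \<le> p x" if "x \<in> V" for x
    using q(2)[OF that] lower_le_q[OF p v that] by linarith
  have "- q v \<le> - p v" using neg[OF v] q(2)[OF subspace_neg[OF v]] lower_neg[OF p v] by linarith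
  then have "q v = p v" using le[OF v] by linarith
  then show ?thesis by (intro exI[of _ q] conjI ballI allI add scale le)
qed

end

section \<open>The predual of the multiplier algebra\<close>

text \<open>Rearrangement of an absolutely convergent double series with finite rows.\<close>

lemma flatten_double_series:
  fixes c :: "nat \<times> nat \<Rightarrow> 'b::banach"
  assumes bd: "\<And>N. (\<Sum>j<N. \<Sum>i<N. norm (c (j, i))) \<le> K" and zero: "\<And>j i. len j \<le> i \<Longrightarrow> c (j, i) = 0"
  shows "summable (\<lambda>n. norm (c (prod_decode n)))" "(\<lambda>j. \<Sum>i<len j. c (j, i)) sums (\<Sum>n. c (prod_decode n))"
proof -
  have F: "(\<Sum>x\<in>F. norm (c x)) \<le> K" if "finite F" for F
  proof -
    obtain N1 where N1: "fst ` F \<subseteq> {..<N1}" using finite_nat_bounded[of "fst ` F"] \<open>finite F\<close> by auto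
    obtain N2 where N2: "snd ` F \<subseteq> {..<N2}" using finite_nat_bounded[of "snd ` F"] \<open>finite F\<close> by auto
    have "F \<subseteq> {..<max N1 N2} \<times> {..<max N1 N2}" using N1 N2 by (force simp: less_max_iff_disj)
    then have "(\<Sum>x\<in>F. norm (c x)) \<le> (\<Sum>x\<in>{..<max N1 N2} \<times> {..<max N1 N2}. norm (c x))"
      by (intro sum_mono2) auto
    also have "\<dots> = (\<Sum>j<max N1 N2. \<Sum>i<max N1 N2. norm (c (j, i)))"
      by (simp add: sum.cartesian_product case_prod_unfold)
    also have "\<dots> \<le> K" by (rule bd)
    finally show ?thesis .
  qed
  have abs: "(\<lambda>x. norm (c x)) summable_on UNIV"
  proof (rule nonneg_bdd_above_summable_on)
    show "bdd_above (sum (\<lambda>x. norm (c x)) ` {F. F \<subseteq> UNIV \<and> finite F})"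
      by (rule bdd_aboveI2[of _ _ K]) (rule F, simp)
  qed simp
  then have "(\<lambda>n. norm (c (prod_decode n))) summable_on UNIV"
    by (rule iffD2[OF summable_on_reindex_bij_betw[OF bij_prod_decode]])
  then show sm: "summable (\<lambda>n. norm (c (prod_decode n)))" by (rule summable_on_imp_summable)
  have cs: "c summable_on UNIV \<times> UNIV" using abs_summable_summable[OF abs] by simp
  have "((\<lambda>n. c (prod_decode n)) has_sum (\<Sum>n. c (prod_decode n))) UNIV"
    by (rule norm_summable_imp_has_sum[OF sm summable_sums[OF summable_norm_cancel[OF sm]]])
  from infsumI[OF this] have tot: "infsum c (UNIV \<times> UNIV) = (\<Sum>n. c (prod_decode n))"
    unfolding UNIV_Times_UNIV by (rule trans[OF infsum_reindex_bij_betw[OF bij_prod_decode, symmetric]])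
  have inner: "infsum (\<lambda>i. c (j, i)) UNIV = (\<Sum>i<len j. c (j, i))" for j
  proof -
    have "infsum (\<lambda>i. c (j, i)) UNIV = infsum (\<lambda>i. c (j, i)) {..<len j}"
      by (rule infsum_cong_neutral) (use zero in auto)
    then show ?thesis by simp
  qed
  have "(\<lambda>j. infsum (\<lambda>i. c (j, i)) UNIV) summable_on UNIV"
    by (rule summable_on_Sigma_banach[where B = "\<lambda>_. UNIV"]) (use cs in simp)
  from has_sum_infsum[OF this]
  have "((\<lambda>j. infsum (\<lambda>i. c (j, i)) UNIV) has_sum (\<Sum>n. c (prod_decode n))) UNIV"
    unfolding infsum_Sigma_banach[OF cs] tot .
  then have "((\<lambda>j. \<Sum>i<len j. c (j, i)) has_sum (\<Sum>n. c (prod_decode n))) UNIV"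
    unfolding inner .
  then show "(\<lambda>j. \<Sum>i<len j. c (j, i)) sums (\<Sum>n. c (prod_decode n))" by (rule has_sum_imp_sums)
qed

text \<open>From here on functions are mostly treated as vectors, and their sums and products are evaluated only on
  demand.\<close>

lemmas fun_apply = plus_fun_apply minus_apply times_fun_apply zero_fun_apply uminus_apply cscale_apply

declare fun_apply [simp del]

context drury_arveson_space
begin

type_synonym ('k) pairs = "((complex ^ 'k \<Rightarrow> complex) \<times> (complex ^ 'k \<Rightarrow> complex)) list"

text \<open>A list of pairs stands for the operator \<open>\<Sum>(x, y). x \<otimes> y\<close> of finite rank; \<open>rank_functional\<close> is the functional that it
  induces on the multipliers, set to zero elsewhere so that equality of functionals is
  equality on the multipliers.\<close>

definition vecs :: "'n pairs \<Rightarrow> bool" where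
  "vecs L \<longleftrightarrow> (\<forall>p\<in>set L. fst p \<in> H \<and> snd p \<in> H)"

definition rank_functional :: "'n pairs \<Rightarrow> (complex ^ 'n \<Rightarrow> complex) \<Rightarrow> complex" where
  "rank_functional L f = (if f \<in> \<M> then \<Sum>p\<leftarrow>L. ip (f * fst p) (snd p) else 0)"

definition cost :: "'n pairs \<Rightarrow> real" where
  "cost L = (\<Sum>p\<leftarrow>L. ((nrm (fst p))\<^sup>2 + (nrm (snd p))\<^sup>2) / 2)"

definition finite_rank :: "((complex ^ 'n \<Rightarrow> complex) \<Rightarrow> complex) set" where
  "finite_rank = rank_functional ` {L. vecs L}"

text \<open>The quotient norm of the predual, restricted to functionals of finite rank. The arithmetic mean of squares
  in \<open>cost\<close> has the same infimum as the products \<open>nrm x * nrm y\<close>, by rescaling, and it bounds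
  the two sums of squares that make a functional normal.\<close>

definition qnorm :: "((complex ^ 'n \<Rightarrow> complex) \<Rightarrow> complex) \<Rightarrow> real" where
  "qnorm \<psi> = Inf (cost ` {L. vecs L \<and> rank_functional L = \<psi>})"

lemma cost_ge0: "0 \<le> cost L"
  unfolding cost_def by (intro sum_list_nonneg) auto

lemma rank_functional_append: "rank_functional (L @ L') = rank_functional L + rank_functional L'"
  by (auto simp: rank_functional_def fun_eq_iff fun_apply)

lemma rank_functional_scale:
  assumes "vecs L"
  shows "rank_functional (map (\<lambda>(x, y). (cscale a x, cscale b y)) L) = cscale (a * cnj b) (rank_functional L)"
proof
  fix f
  show "rank_functional (map (\<lambda>(x, y). (cscale a x, cscale b y)) L) f = cscale (a * cnj b) (rank_functional L) f"
  proof (cases "f \<in> \<M>")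
    case True
    have "(\<Sum>p\<leftarrow>map (\<lambda>(x, y). (cscale a x, cscale b y)) L. ip (f * fst p) (snd p)) =
       a * cnj b * (\<Sum>p\<leftarrow>L. ip (f * fst p) (snd p))"
      using assms
    proof (induction L)
      case (Cons p L)
      then have p: "fst p \<in> H" "snd p \<in> H" "vecs L" by (auto simp: vecs_def)
      have fp: "f * fst p \<in> H" using multD[OF multiplierD(1)[OF True] p(1)] .
      have "ip (f * cscale a (fst p)) (cscale b (snd p)) = a * cnj b * ip (f * fst p) (snd p)"
        unfolding cscale_times by (simp only: ip_scale_left ip_scale_right scale_mem p fp mult_ac)
      then show ?case using Cons.IH[OF p(3)] by (simp add: case_prod_unfold distrib_left)
    qed simp
    then show ?thesis using True by (simp add: rank_functional_def cscale_apply)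
  qed (simp add: rank_functional_def cscale_apply)
qed

lemma finite_rank_subspace: "csubspace finite_rank"
  unfolding csubspace_def
proof (intro conjI ballI allI)
  have "rank_functional [] = 0" by (auto simp: rank_functional_def fun_eq_iff fun_apply)
  then show "0 \<in> finite_rank" unfolding finite_rank_def by (force simp: vecs_def)
  fix \<psi> assume "\<psi> \<in> finite_rank"
  then obtain L where L: "\<psi> = rank_functional L" "vecs L" by (auto simp: finite_rank_def)
  show "\<psi> + \<eta> \<in> finite_rank" if \<eta>: "\<eta> \<in> finite_rank" for \<eta>
  proof -
    obtain L' where L': "\<eta> = rank_functional L'" "vecs L'" using \<eta> by (auto simp: finite_rank_def)
    have "vecs (L @ L')" using L L' by (auto simp: vecs_def)
    then show ?thesis unfolding L L' rank_functional_append[symmetric] finite_rank_def by simp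
  qed
  show "cscale a \<psi> \<in> finite_rank" for a
  proof -
    let ?L = "map (\<lambda>(x, y). (cscale a x, cscale 1 y)) L"
    have "vecs ?L" using L by (auto simp: vecs_def)
    moreover have "rank_functional ?L = cscale a \<psi>" using rank_functional_scale[OF L(2), of a 1] L(1) by simp
    ultimately show ?thesis unfolding finite_rank_def by (intro image_eqI[of _ _ ?L]) simp_all
  qed
qed

lemma qnorm_bdd: "bdd_below (cost ` {L. vecs L \<and> rank_functional L = \<psi>})"
  by (rule bdd_belowI2[of _ 0]) (rule cost_ge0)

lemma qnorm_le: "vecs L \<Longrightarrow> qnorm (rank_functional L) \<le> cost L"
  unfolding qnorm_def by (rule cINF_lower[OF qnorm_bdd]) simp

lemma qnorm_approx:
  assumes "\<psi> \<in> finite_rank" "e > 0"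
  obtains L where "vecs L" "rank_functional L = \<psi>" "cost L < qnorm \<psi> + e"
proof -
  have "cost ` {L. vecs L \<and> rank_functional L = \<psi>} \<noteq> {}" using assms(1) by (auto simp: finite_rank_def)
  then have "\<exists>a\<in>cost ` {L. vecs L \<and> rank_functional L = \<psi>}. a < qnorm \<psi> + e"
    using assms(2) unfolding qnorm_def by (intro cInf_lessD) auto
  then show ?thesis using that by auto
qed

lemma qnorm_scale_le:
  assumes \<psi>: "\<psi> \<in> finite_rank" and t: "t > 0" shows "qnorm (cscale (of_real t) \<psi>) \<le> t * qnorm \<psi>"
proof (rule field_le_epsilon)
  fix e :: real assume e: "e > 0"
  have "e / t > 0" using e t by simp
  then obtain L where L: "vecs L" "rank_functional L = \<psi>" "cost L < qnorm \<psi> + e / t"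
    using qnorm_approx[OF \<psi>] by blast
  define s where "s = (of_real (sqrt t) :: complex)"
  have s: "s * cnj s = of_real t" "(cmod s)\<^sup>2 = t"
    using t by (auto simp: s_def simp flip: of_real_mult)
  let ?L = "map (\<lambda>(x, y). (cscale s x, cscale s y)) L"
  have v: "vecs ?L" using L(1) by (auto simp: vecs_def)
  have c: "cost ?L = t * cost L"
    using L(1)
  proof (induction L)
    case (Cons p L)
    then have p: "fst p \<in> H" "snd p \<in> H" "vecs L" by (auto simp: vecs_def)
    have "(nrm (cscale s (fst p)))\<^sup>2 = t * (nrm (fst p))\<^sup>2" "(nrm (cscale s (snd p)))\<^sup>2 = t * (nrm (snd p))\<^sup>2"
      by (simp_all only: nrm_scale p power_mult_distrib s)
    then show ?case using Cons.IH[OF p(3)]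
      by (simp add: cost_def case_prod_unfold distrib_left add_divide_distrib)
  qed (simp add: cost_def)
  have "qnorm (cscale (of_real t) \<psi>) \<le> cost ?L"
    using qnorm_le[OF v] rank_functional_scale[OF L(1), of s s] L(2) s(1) by simp
  also have "\<dots> \<le> t * (qnorm \<psi> + e / t)" unfolding c using L(3) t by (intro mult_left_mono) auto
  also have "\<dots> = t * qnorm \<psi> + e" using t by (simp add: distrib_left)
  finally show "qnorm (cscale (of_real t) \<psi>) \<le> t * qnorm \<psi> + e" .
qed

lemma qnorm_sublinear: "sublinear_on finite_rank qnorm"
  unfolding sublinear_on_def
proof (intro conjI ballI allI impI)
  fix \<psi> \<eta> assume *: "\<psi> \<in> finite_rank" "\<eta> \<in> finite_rank"
  show "qnorm (\<psi> + \<eta>) \<le> qnorm \<psi> + qnorm \<eta>"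
  proof (rule field_le_epsilon)
    fix e :: real assume e: "e > 0"
    obtain L where L: "vecs L" "rank_functional L = \<psi>" "cost L < qnorm \<psi> + e / 2"
      using qnorm_approx[OF *(1), of "e / 2"] e by auto
    obtain L' where L': "vecs L'" "rank_functional L' = \<eta>" "cost L' < qnorm \<eta> + e / 2"
      using qnorm_approx[OF *(2), of "e / 2"] e by auto
    have "vecs (L @ L')" using L L' by (auto simp: vecs_def)
    then have "qnorm (\<psi> + \<eta>) \<le> cost (L @ L')"
      using qnorm_le[of "L @ L'"] by (simp only: rank_functional_append L(2) L'(2))
    also have "\<dots> = cost L + cost L'" by (simp add: cost_def)
    finally show "qnorm (\<psi> + \<eta>) \<le> qnorm \<psi> + qnorm \<eta> + e" using L(3) L'(3) by linarith
  qed
next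
  fix \<psi> and t :: real assume *: "\<psi> \<in> finite_rank" "t > 0"
  have m: "cscale (of_real t) \<psi> \<in> finite_rank" using finite_rank_subspace *(1) unfolding csubspace_def by blast
  have "cscale (of_real (1 / t)) (cscale (of_real t) \<psi>) = \<psi>" using *(2) by (auto simp: fun_eq_iff fun_apply)
  then have "qnorm \<psi> \<le> (1 / t) * qnorm (cscale (of_real t) \<psi>)"
    using qnorm_scale_le[OF m, of "1 / t"] *(2) by simp
  then have "t * qnorm \<psi> \<le> qnorm (cscale (of_real t) \<psi>)" using *(2) by (simp add: field_simps)
  then show "qnorm (cscale (of_real t) \<psi>) = t * qnorm \<psi>" using qnorm_scale_le[OF *] by linarith
qed

text \<open>The quotient norm is dominated by the norm as a functional on the multipliers. A
  Hahn--Banach functional that norms \<open>\<psi>\<close> for the quotient norm is a bounded sesquilinear form on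
  \<open>H\<close>, so it comes from an operator; as \<open>x \<otimes> kern z\<close> and \<open>x z\<close> times \<open>one \<otimes> kern z\<close> agree on
  multipliers, this operator is multiplication by a function.\<close>

lemma quotient_norm:
  assumes \<psi>: "\<psi> \<in> finite_rank" and C: "C \<ge> 0" and bd: "\<And>f. f \<in> \<M> \<Longrightarrow> cmod (\<psi> f) \<le> C * mnorm f"
  shows "qnorm \<psi> \<le> C"
proof -
  obtain F where F: "(\<forall>x\<in>finite_rank. \<forall>y\<in>finite_rank. F (x + y) = F x + F y) \<and>
      (\<forall>t. \<forall>x\<in>finite_rank. F (cscale (of_real t) x) = t * F x) \<and> (\<forall>x\<in>finite_rank. F x \<le> qnorm x) \<and> F \<psi> = qnorm \<psi>"
    using hahn_banach[OF finite_rank_subspace qnorm_sublinear \<psi>] by (rule exE)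
  have Fadd: "\<And>x y. x \<in> finite_rank \<Longrightarrow> y \<in> finite_rank \<Longrightarrow> F (x + y) = F x + F y"
    and Fscale: "\<And>t x. x \<in> finite_rank \<Longrightarrow> F (cscale (of_real t) x) = t * F x"
    and Fle: "\<And>x. x \<in> finite_rank \<Longrightarrow> F x \<le> qnorm x" and F\<psi>: "F \<psi> = qnorm \<psi>"
    using F by simp_all
  have FRD: "0 \<in> finite_rank" "\<And>x y. x \<in> finite_rank \<Longrightarrow> y \<in> finite_rank \<Longrightarrow> x + y \<in> finite_rank" "\<And>c x. x \<in> finite_rank \<Longrightarrow> cscale c x \<in> finite_rank"
    using finite_rank_subspace by (simp_all add: csubspace_def)
  \<comment> \<open>the complex linear functional with real part \<open>F\<close>\<close>
  define G where "G \<eta> = Complex (F \<eta>) (- F (cscale \<i> \<eta>))" for \<eta>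
  have Gadd: "G (x + y) = G x + G y" if "x \<in> finite_rank" "y \<in> finite_rank" for x y
    using that Fadd FRD by (simp add: G_def complex_eq_iff cscale_alg(4))
  have Gscale: "G (cscale c x) = c * G x" if x: "x \<in> finite_rank" for c x
  proof -
    have 1: "cscale c x = cscale (of_real (Re c)) x + cscale (of_real (Im c)) (cscale \<i> x)"
      by (auto simp: fun_eq_iff fun_apply complex_eq_iff)
    have 2: "cscale \<i> (cscale c x) = cscale (of_real (Re c)) (cscale \<i> x) + cscale (of_real (- Im c)) x"
      by (auto simp: fun_eq_iff fun_apply complex_eq_iff)
    have "F (cscale c x) = Re c * F x + Im c * F (cscale \<i> x)"
      unfolding 1 by (simp only: Fadd Fscale FRD x)
    moreover have "F (cscale \<i> (cscale c x)) = Re c * F (cscale \<i> x) - Im c * F x"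
      unfolding 2 by (simp add: Fadd Fscale FRD x del: of_real_minus)
    ultimately show ?thesis by (simp add: G_def complex_eq_iff)
  qed
  have G0: "G 0 = 0" using Gscale[OF FRD(1), of 0] by (simp only: cscale_alg(8)) simp
  define b where "b x y = G (rank_functional [(x, y)])" for x y
  have FR1: "rank_functional [(x, y)] \<in> finite_rank" if "x \<in> H" "y \<in> H" for x y
    using that by (auto simp: finite_rank_def vecs_def)
  have b_scale: "b (cscale a x) (cscale c y) = a * cnj c * b x y" if "x \<in> H" "y \<in> H" for a c x y
    using rank_functional_scale[of "[(x, y)]" a c] Gscale[OF FR1[OF that]] that
    by (simp add: b_def vecs_def)
  have b_add1: "b (x + x') y = b x y + b x' y" if "x \<in> H" "x' \<in> H" "y \<in> H" for x x' y
  proof -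
    have "rank_functional [(x + x', y)] = rank_functional [(x, y)] + rank_functional [(x', y)]"
      using that multiplierD(1) by (auto simp: rank_functional_def fun_eq_iff fun_apply distrib_left ip_add_left multD)
    then show ?thesis unfolding b_def by (simp only: Gadd FR1 that)
  qed
  have b_add2: "b x (y + y') = b x y + b x y'" if "x \<in> H" "y \<in> H" "y' \<in> H" for x y y'
  proof -
    have "rank_functional [(x, y + y')] = rank_functional [(x, y)] + rank_functional [(x, y')]"
      using that multiplierD(1) by (auto simp: rank_functional_def fun_eq_iff fun_apply ip_add_right multD)
    then show ?thesis unfolding b_def by (simp only: Gadd FR1 that)
  qed
  have b_quad: "cmod (b x y) \<le> ((nrm x)\<^sup>2 + (nrm y)\<^sup>2) / 2" if xy: "x \<in> H" "y \<in> H" for x y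
  proof -
    \<comment> \<open>a rotation that makes the value real and nonnegative\<close>
    define u where "u = (if b x y = 0 then 1 else cnj (b x y) / of_real (cmod (b x y)))"
    have u: "cmod u = 1" by (simp add: u_def norm_divide)
    have ub: "u * b x y = of_real (cmod (b x y))"
      using complex_norm_square[of "b x y"] by (auto simp: u_def field_simps power2_eq_square)
    have ux: "cscale u x \<in> H" using xy by simp
    have "cmod (b x y) = Re (b (cscale u x) (cscale 1 y))" by (simp only: b_scale xy) (simp add: ub)
    also have "\<dots> = F (rank_functional [(cscale u x, y)])" by (simp add: b_def G_def cscale_alg(2))
    also have "\<dots> \<le> qnorm (rank_functional [(cscale u x, y)])" by (intro Fle FR1 ux xy)
    also have "\<dots> \<le> cost [(cscale u x, y)]" using ux xy by (intro qnorm_le) (simp add: vecs_def)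
    also have "\<dots> = ((nrm x)\<^sup>2 + (nrm y)\<^sup>2) / 2" using xy u by (simp add: cost_def nrm_scale)
    finally show ?thesis .
  qed
  have b_bd: "cmod (b x y) \<le> nrm x * nrm y" if xy: "x \<in> H" "y \<in> H" for x y
  proof (cases "x = 0 \<or> y = 0")
    case True
    have "b x y = 0" using True b_scale[OF xy, of 0 1] b_scale[OF xy, of 1 0]
      by (auto simp: cscale_alg(2,3,8))
    then show ?thesis using xy by simp
  next
    case False
    then have pos: "nrm x > 0" "nrm y > 0"
      using nrm_eq_0[OF xy(1)] nrm_eq_0[OF xy(2)] nrm_ge0[OF xy(1)] nrm_ge0[OF xy(2)] by simp_all
    let ?a = "of_real (1 / nrm x) :: complex" and ?c = "of_real (1 / nrm y) :: complex"
    have "cmod (b (cscale ?a x) (cscale ?c y)) \<le> 1"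
      using b_quad[of "cscale ?a x" "cscale ?c y"] xy pos by (simp add: nrm_scale norm_divide)
    then have "cmod (b x y) / (nrm x * nrm y) \<le> 1"
      unfolding b_scale[OF xy] using pos by (simp add: norm_mult norm_divide)
    then show ?thesis using pos by (simp add: pos_divide_le_eq)
  qed
  have riesz_b: "\<exists>u\<in>H. nrm u \<le> nrm x \<and> (\<forall>y\<in>H. ip u y = b x y)" if x: "x \<in> H" for x
  proof -
    define Gr where "Gr = (\<lambda>y. (y, cnj (b x y))) ` H"
    have GrI: "(y, cnj (b x y)) \<in> Gr" if "y \<in> H" for y using that by (auto simp: Gr_def)
    have GrD: "y \<in> H" "l = cnj (b x y)" if "(y, l) \<in> Gr" for y l using that by (auto simp: Gr_def)
    obtain u where u: "u \<in> H" "nrm u \<le> nrm x" "\<And>y l. (y, l) \<in> Gr \<Longrightarrow> ip y u = l"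
    proof (rule riesz[of "nrm x" Gr])
      have "b x 0 = 0" using b_bd[OF x zero_mem] by simp
      then show "(0, 0) \<in> Gr" using GrI[OF zero_mem] by simp
      show "(y + y', l + l') \<in> Gr" if "(y, l) \<in> Gr" "(y', l') \<in> Gr" for y l y' l'
        using GrI[OF add_mem[OF GrD(1)[OF that(1)] GrD(1)[OF that(2)]]] GrD[OF that(1)] GrD[OF that(2)]
        by (simp add: b_add2 x)
      show "(cscale c y, c * l) \<in> Gr" if "(y, l) \<in> Gr" for y l c
        using GrI[OF scale_mem[OF GrD(1)[OF that], of c]] GrD[OF that] b_scale[OF x GrD(1)[OF that], of 1 c]
        by (simp add: cscale_alg(2))
      show "cmod l \<le> nrm x * nrm y" if "(y, l) \<in> Gr" for y l
        using GrD[OF that] b_bd[OF x] by simp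
    qed (use GrD x in auto)
    have "ip u y = b x y" if "y \<in> H" for y
      using u(3)[OF GrI[OF that]] ip_sym[OF that u(1)] by simp
    then show ?thesis using u by blast
  qed
  obtain g where g: "g \<in> H" "\<And>y. y \<in> H \<Longrightarrow> ip g y = b one y" using riesz_b[OF one_mem] by blast
  have gx: "g * x \<in> H \<and> nrm (g * x) \<le> nrm x \<and> (\<forall>y\<in>H. ip (g * x) y = b x y)" if x: "x \<in> H" for x
  proof -
    obtain u where u: "u \<in> H" "nrm u \<le> nrm x" "\<forall>y\<in>H. ip u y = b x y" using riesz_b[OF x] by blast
    have "u z = (g * x) z" for z
    proof (cases "z \<in> B")
      case True
      have k: "kern z \<in> H" by (rule kern_mem[OF True])
      \<comment> \<open>both sides evaluate \<open>f\<close> at \<open>z\<close>\<close>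
      have "rank_functional [(x, kern z)] = cscale (x z) (rank_functional [(one, kern z)])"
      proof
        have o: "one z = 1" using True by (simp add: one_def restrict0_def)
        fix f
        show "rank_functional [(x, kern z)] f = cscale (x z) (rank_functional [(one, kern z)]) f"
        proof (cases "f \<in> \<M>")
          case f: True
          have "f * x \<in> H" "f * one \<in> H" by (intro multD multiplierD(1)[OF f] x one_mem)+
          then show ?thesis using f True by (simp add: rank_functional_def reproduce fun_apply o)
        qed (simp add: rank_functional_def fun_apply)
      qed
      then have "b x (kern z) = x z * b one (kern z)" unfolding b_def by (simp only: Gscale FR1 one_mem k)
      then have "ip u (kern z) = x z * ip g (kern z)" using u(3) g(2) k by simp
      then show ?thesis using reproduce[OF u(1) True] reproduce[OF g(1) True] by (simp add: fun_apply)
    next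
      case False
      then show ?thesis using supp[OF u(1) False] supp[OF x False] by (simp add: fun_apply)
    qed
    then have "u = g * x" by blast
    then show ?thesis using u by blast
  qed
  have gm: "mult g" using gx by (simp add: mult_def)
  have gn: "mnorm g \<le> 1" using gx by (intro mnorm_le) auto
  have gM: "g \<in> \<M>" using gm supp[OF g(1)] by (simp add: multiplier_algebra_iff supported_on_def)
  have G_eval: "G (rank_functional L) = rank_functional L g" if "vecs L" for L
    using that
  proof (induction L)
    case Nil
    have "rank_functional [] = 0" by (auto simp: rank_functional_def fun_eq_iff fun_apply)
    then have "rank_functional [] g = 0" by (metis zero_fun_apply)
    then show ?case using \<open>rank_functional [] = 0\<close> G0 by (simp only:)
  next
    case (Cons p L)
    then have p: "fst p \<in> H" "snd p \<in> H" "vecs L" by (auto simp: vecs_def)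
    have L: "rank_functional L \<in> finite_rank" using p by (simp add: finite_rank_def)
    have split: "rank_functional (p # L) = rank_functional [(fst p, snd p)] + rank_functional L" using rank_functional_append[of "[p]" L] by simp
    have "G (rank_functional (p # L)) = b (fst p) (snd p) + rank_functional L g"
      unfolding split using Cons.IH[OF p(3)] by (simp only: Gadd FR1 p L b_def)
    also have "b (fst p) (snd p) = ip (g * fst p) (snd p)" using gx[OF p(1)] p(2) by simp
    also have "ip (g * fst p) (snd p) + rank_functional L g = rank_functional (p # L) g" using gM by (simp add: rank_functional_def)
    finally show ?case .
  qed
  have "qnorm \<psi> = Re (G \<psi>)" by (simp add: G_def F\<psi>)
  also have "G \<psi> = \<psi> g" using \<psi> G_eval by (auto simp: finite_rank_def)
  also have "Re (\<psi> g) \<le> C * mnorm g" using bd[OF gM] complex_Re_le_cmod[of "\<psi> g"] by linarith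
  also have "\<dots> \<le> C" using gn C mult_left_mono[of "mnorm g" 1 C] by simp
  finally show ?thesis .
qed

text \<open>A series of functionals of finite rank with summable costs is normal: list all the pairs in one sequence.\<close>

lemma normal_series:
  assumes L: "\<And>j. vecs (L j)" and sm: "summable (\<lambda>j. cost (L j))"
  shows "\<exists>\<Lambda>\<in>operators_predual H ip. \<forall>f\<in>\<M>. (\<lambda>j. rank_functional (L j) f) sums \<Lambda> (multiplication_op f)"
proof -
  define x where "x = (\<lambda>(j, i). if i < length (L j) then fst (L j ! i) else 0)"
  define y where "y = (\<lambda>(j, i). if i < length (L j) then snd (L j ! i) else 0)"
  have xH: "x p \<in> H" and yH: "y p \<in> H" for p
    using L[of "fst p"] by (auto simp: x_def y_def vecs_def case_prod_unfold)
  have bd: "(\<Sum>j<N. \<Sum>i<N. c (j, i)) \<le> K * (\<Sum>j. cost (L j))"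
    if c: "\<And>p. c p \<le> K * (((nrm (x p))\<^sup>2 + (nrm (y p))\<^sup>2) / 2)" and K: "K \<ge> 0" for c N K
  proof -
    have "(\<Sum>i<N. c (j, i)) \<le> K * cost (L j)" for j
    proof -
      let ?h = "\<lambda>i. ((nrm (x (j, i)))\<^sup>2 + (nrm (y (j, i)))\<^sup>2) / 2"
      have "(\<Sum>i<N. c (j, i)) \<le> (\<Sum>i<N. K * ?h i)" by (intro sum_mono c)
      also have "\<dots> \<le> (\<Sum>i\<in>{..<N} \<union> {..<length (L j)}. K * ?h i)" using K by (intro sum_mono2) auto
      also have "\<dots> = (\<Sum>i<length (L j). K * ?h i)"
        by (rule sum.mono_neutral_right) (auto simp: x_def y_def)
      also have "\<dots> = K * cost (L j)"
        by (simp add: cost_def sum_list_sum_nth atLeast0LessThan x_def y_def sum_distrib_left)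
      finally show ?thesis .
    qed
    then have "(\<Sum>j<N. \<Sum>i<N. c (j, i)) \<le> (\<Sum>j<N. K * cost (L j))" by (intro sum_mono)
    also have "\<dots> = K * (\<Sum>j<N. cost (L j))" by (simp add: sum_distrib_left)
    also have "\<dots> \<le> K * (\<Sum>j. cost (L j))"
      by (intro mult_left_mono K sum_le_suminf sm) (auto simp: cost_ge0)
    finally show ?thesis .
  qed
  have zero: "x (j, i) = 0" "y (j, i) = 0" if "length (L j) \<le> i" for i j using that by (auto simp: x_def y_def)
  have sx: "summable (\<lambda>n. (nrm (x (prod_decode n)))\<^sup>2)"
    using flatten_double_series(1)[of "\<lambda>p. (nrm (x p))\<^sup>2" "2 * (\<Sum>j. cost (L j))" "\<lambda>j. length (L j)"]
      bd[of "\<lambda>p. (nrm (x p))\<^sup>2" 2] zero by simp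
  have sy: "summable (\<lambda>n. (nrm (y (prod_decode n)))\<^sup>2)"
    using flatten_double_series(1)[of "\<lambda>p. (nrm (y p))\<^sup>2" "2 * (\<Sum>j. cost (L j))" "\<lambda>j. length (L j)"]
      bd[of "\<lambda>p. (nrm (y p))\<^sup>2" 2] zero by simp
  define \<Lambda> where "\<Lambda> T = (\<Sum>n. ip (T (x (prod_decode n))) (y (prod_decode n)))" for T
  have "\<Lambda> \<in> operators_predual H ip"
    unfolding operators_predual_def \<Lambda>_def
    by (intro CollectI exI[of _ "\<lambda>n. x (prod_decode n)"] exI[of _ "\<lambda>n. y (prod_decode n)"])
      (use xH yH sx sy in auto)
  moreover have "(\<lambda>j. rank_functional (L j) f) sums \<Lambda> (multiplication_op f)" if f: "f \<in> \<M>" for f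
  proof -
    let ?c = "\<lambda>p. ip (f * x p) (y p)"
    have m: "mult f" by (rule multiplierD(1)[OF f])
    have c: "cmod (?c p) \<le> mnorm f * (((nrm (x p))\<^sup>2 + (nrm (y p))\<^sup>2) / 2)" for p
    proof -
      have "cmod (?c p) \<le> nrm (f * x p) * nrm (y p)" by (intro cauchy_schwarz multD m xH yH)
      also have "\<dots> \<le> mnorm f * nrm (x p) * nrm (y p)" by (intro mult_right_mono mnorm_bound m xH nrm_ge0 yH)
      also have "\<dots> = mnorm f * (nrm (x p) * nrm (y p))" by simp
      also have "\<dots> \<le> mnorm f * (((nrm (x p))\<^sup>2 + (nrm (y p))\<^sup>2) / 2)"
        using sum_squares_bound[of "nrm (x p)" "nrm (y p)"] by (intro mult_left_mono mnorm_ge0 m) simp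
      finally show ?thesis .
    qed
    have "(\<lambda>j. \<Sum>i<length (L j). ?c (j, i)) sums (\<Sum>n. ?c (prod_decode n))"
      by (rule flatten_double_series(2)[of ?c "mnorm f * (\<Sum>j. cost (L j))"])
        (use bd[of "\<lambda>p. cmod (?c p)" "mnorm f"] c mnorm_ge0[OF m] zero xH in auto)
    moreover have "(\<Sum>i<length (L j). ?c (j, i)) = rank_functional (L j) f" for j
      using f by (simp add: rank_functional_def sum_list_sum_nth atLeast0LessThan x_def y_def)
    ultimately show ?thesis by (simp add: \<Lambda>_def multiplication_op_def)
  qed
  ultimately show ?thesis by blast
qed

end

section \<open>Integration over the sphere\<close>

lemma continuous_on_wmon [continuous_intros]: "continuous_on S (wmon l)"
proof (induction l)
  case Nil
  show ?case by (simp add: wmon_def[abs_def])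
next
  case (Cons i l)
  have "continuous_on S (\<lambda>z. z $ i * wmon l z)" by (intro continuous_intros Cons)
  then show ?case by (simp add: wmon_def[abs_def])
qed

lemma continuous_on_homog [continuous_intros]: "continuous_on S (homog m b)"
  unfolding homog_def[abs_def] by (intro continuous_intros)

lemma continuous_on_cinner [continuous_intros]:
  "continuous_on S f \<Longrightarrow> continuous_on S g \<Longrightarrow> continuous_on S (\<lambda>x. cinner_vec (f x) (g x))"
  unfolding cinner_vec_def by (intro continuous_intros)

lemma continuous_on_smult [continuous_intros]:
  fixes g :: "'a::topological_space \<Rightarrow> complex ^ 'n"
  shows "continuous_on S f \<Longrightarrow> continuous_on S g \<Longrightarrow> continuous_on S (\<lambda>x. f x *s g x)"
  unfolding vector_scalar_mult_def by (intro continuous_intros continuous_on_vec_lambda)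

lemma cinner_add: "cinner_vec (v + w) z = cinner_vec v z + cinner_vec w z"
  "cinner_vec z (v + w) = cinner_vec z v + cinner_vec z w"
  by (simp_all add: cinner_vec_def distrib_left distrib_right sum.distrib)

lemma cinner_minus: "cinner_vec (v - w) z = cinner_vec v z - cinner_vec w z"
  "cinner_vec z (v - w) = cinner_vec z v - cinner_vec z w"
  by (simp_all add: cinner_vec_def left_diff_distrib right_diff_distrib sum_subtractf)

lemma norm_smult: "norm (a *s z :: complex ^ 'n) = cmod a * norm z"
proof -
  have "cnj a * a = of_real ((cmod a)\<^sup>2)" using complex_norm_square[of a] by (simp add: mult.commute)
  then have "of_real ((norm (a *s z))\<^sup>2) = (of_real ((cmod a * norm z)\<^sup>2) :: complex)"
    unfolding cinner_self[symmetric] cinner_scale mult.assoc[symmetric]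
    by (simp only: cinner_self of_real_mult power_mult_distrib)
  then have "(norm (a *s z))\<^sup>2 = (cmod a * norm z)\<^sup>2" using of_real_eq_iff by blast
  then show ?thesis by (simp add: power2_eq_iff_nonneg)
qed

lemma rotation_orthogonal: "cmod a = 1 \<Longrightarrow> orthogonal_transformation ((*s) a :: complex ^ 'n \<Rightarrow> complex ^ 'n)"
  unfolding orthogonal_transformation
  by (auto simp: norm_smult linear_iff vec_eq_iff algebra_simps)

text \<open>For \<open>cmod a = 1\<close>, the unitary that fixes \<open>e\<close> and multiplies the orthogonal complement by \<open>a\<close>.\<close>

definition twist :: "complex ^ 'n \<Rightarrow> complex \<Rightarrow> complex ^ 'n \<Rightarrow> complex ^ 'n" where
  "twist e a z = cinner_vec z e *s e + a *s (z - cinner_vec z e *s e)"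

lemma twist_cinner:
  assumes "norm e = 1" shows "cinner_vec (twist e a z) e = cinner_vec z e"
proof -
  have "cinner_vec e e = 1" by (simp add: cinner_self assms)
  then show ?thesis by (simp add: twist_def cinner_add cinner_minus cinner_scale)
qed

lemma twist_orthogonal:
  assumes e: "norm e = 1" and a: "cmod a = 1" shows "orthogonal_transformation (twist e a)"
  unfolding orthogonal_transformation
proof (intro conjI allI)
  show "linear (twist e a)"
    by (rule linearI) (auto simp: twist_def cinner_add scaleR_smult cinner_scale vec_eq_iff algebra_simps)
  fix z
  define c where "c = cinner_vec z e"
  define b where "b = z - c *s e"
  have ee: "cinner_vec e e = 1" by (simp add: cinner_self e)
  have be: "cinner_vec b e = 0" by (simp add: b_def c_def cinner_minus cinner_scale ee)
  then have eb: "cinner_vec e b = 0" using cinner_cnj[of e b] by simp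
  have z: "z = c *s e + b" by (simp add: b_def)
  have tw: "twist e a z = c *s e + a *s b" by (simp add: twist_def b_def c_def)
  have aa: "a * cnj a = 1" using a complex_norm_square[of a] by simp
  have "cinner_vec (c *s e + a *s b) (c *s e + a *s b) = c * cnj c + (a * cnj a) * cinner_vec b b"
    by (simp add: cinner_add cinner_scale be eb ee)
  moreover have "cinner_vec (c *s e + b) (c *s e + b) = c * cnj c + cinner_vec b b"
    by (simp add: cinner_add cinner_scale be eb ee)
  ultimately have "cinner_vec (twist e a z) (twist e a z) = cinner_vec z z"
    by (simp only: tw aa mult_1_left z[symmetric])
  then have "(norm (twist e a z))\<^sup>2 = (norm z)\<^sup>2" unfolding cinner_self using of_real_eq_iff by blast
  then show "norm (twist e a z) = norm z" by (simp add: power2_eq_iff_nonneg)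
qed

text \<open>The mean value property, with a finite average in place of an integral.\<close>

lemma roots_of_unity_mean:
  fixes N :: nat and p :: "complex poly"
  assumes "degree p < N"
  shows "(\<Sum>k<N. poly p (cis (2 * pi * real k / real N))) = of_nat N * poly p 0"
proof -
  define \<omega> where "\<omega> = cis (2 * pi / real N)"
  have N: "N > 0" using assms by simp
  have pow: "cis (2 * pi * real k / real N) = \<omega> ^ k" for k
    unfolding \<omega>_def Complex.DeMoivre by (simp add: mult_ac)
  have geo: "(\<Sum>k<N. (\<omega> ^ k) ^ i) = (if i = 0 then of_nat N else 0)" if "i < N" for i
  proof (cases "i = 0")
    case False
    have "inj_on (\<lambda>k. cis (2 * pi * real k / real N)) {..<N}"
      using Complex.bij_betw_roots_unity[OF N] by (simp add: bij_betw_def)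
    then have inj: "inj_on (\<lambda>k. \<omega> ^ k) {..<N}" unfolding pow .
    have "\<omega> ^ i \<noteq> \<omega> ^ 0"
      using inj_onD[OF inj, of i 0] that N False by auto
    then have ne: "\<omega> ^ i \<noteq> 1" by simp
    have "\<omega> ^ N = 1" unfolding \<omega>_def Complex.DeMoivre using N by simp
    then have "(\<omega> ^ i) ^ N = 1" by (metis mult.commute power_mult power_one)
    then have "(\<Sum>k<N. (\<omega> ^ i) ^ k) = 0" using ne by (simp add: geometric_sum)
    then show ?thesis using False by (simp add: power_mult[symmetric] mult.commute)
  qed simp
  have "(\<Sum>k<N. poly p (\<omega> ^ k)) = (\<Sum>k<N. \<Sum>i\<le>degree p. coeff p i * (\<omega> ^ k) ^ i)"
    by (simp add: poly_altdef)
  also have "\<dots> = (\<Sum>i\<le>degree p. coeff p i * (\<Sum>k<N. (\<omega> ^ k) ^ i))"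
    unfolding sum_distrib_left by (rule sum.swap)
  also have "\<dots> = (\<Sum>i\<le>degree p. coeff p i * (if i = 0 then of_nat N else 0))"
    using assms by (intro sum.cong refl) (simp add: geo)
  also have "\<dots> = of_nat N * poly p 0"
    by (simp add: poly_0_coeff_0 if_distrib[of "\<lambda>x. _ * x"] sum.delta cong: if_cong)
  finally show ?thesis by (simp add: pow)
qed

lemma wmon_line: "\<exists>p. degree p \<le> length l \<and> (\<forall>t. wmon l (a + t *s b) = poly p t)"
proof (induction l)
  case Nil
  show ?case by (intro exI[of _ 1]) simp
next
  case (Cons i l)
  then obtain p where p: "degree p \<le> length l" "\<And>t. wmon l (a + t *s b) = poly p t" by blast
  have "degree ([:a $ i, b $ i:] * p) \<le> degree [:a $ i, b $ i:] + degree p" by (rule degree_mult_le)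
  also have "\<dots> \<le> length (i # l)" using p(1) by simp
  finally show ?case using p(2) by (intro exI[of _ "[:a $ i, b $ i:] * p"]) (simp add: algebra_simps)
qed

text \<open>On a complex line, a homogeneous polynomial of degree \<open>m\<close> is a polynomial of degree at most \<open>m\<close>, so \<open>m + 1\<close>
  roots of unity suffice.\<close>

lemma homog_mean:
  "(\<Sum>k<Suc m. homog m c (a + cis (2 * pi * real k / real (Suc m)) *s b)) = of_nat (Suc m) * homog m c a"
proof -
  have w: "(\<Sum>k<Suc m. wmon l (a + cis (2 * pi * real k / real (Suc m)) *s b)) = of_nat (Suc m) * wmon l a"
    if "l \<in> words m" for l
  proof -
    obtain p where p: "degree p \<le> length l" "\<And>t. wmon l (a + t *s b) = poly p t" using wmon_line by blast
    have "degree p < Suc m" using p(1) that by (simp add: words_def)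
    then have "(\<Sum>k<Suc m. wmon l (a + cis (2 * pi * real k / real (Suc m)) *s b)) = of_nat (Suc m) * poly p 0"
      unfolding p(2) by (rule roots_of_unity_mean)
    then show ?thesis using p(2)[of 0] by simp
  qed
  have "(\<Sum>k<Suc m. homog m c (a + cis (2 * pi * real k / real (Suc m)) *s b)) =
      (\<Sum>l\<in>words m. c l * (\<Sum>k<Suc m. wmon l (a + cis (2 * pi * real k / real (Suc m)) *s b)))"
    unfolding homog_def sum_distrib_left by (rule sum.swap)
  also have "\<dots> = (\<Sum>l\<in>words m. c l * (of_nat (Suc m) * wmon l a))"
    by (intro sum.cong refl) (simp only: w)
  also have "\<dots> = of_nat (Suc m) * homog m c a"
    unfolding homog_def sum_distrib_left by (simp only: mult.left_commute)
  finally show ?thesis .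
qed

locale sphere_measure =
  fixes \<sigma> :: "(complex ^ 'n) measure"
  assumes rot: "rotation_invariant_prob \<sigma>"
begin

lemma sets_\<sigma>: "sets \<sigma> = sets (restrict_space borel (sphere 0 1))"
  using rot by (simp add: rotation_invariant_prob_def)

lemma space_\<sigma>: "space \<sigma> = sphere 0 1"
  using sets_eq_imp_space_eq[OF sets_\<sigma>] by (simp add: space_restrict_space)

sublocale prob_space \<sigma>
  using rot by (simp add: rotation_invariant_prob_def)

lemma continuous_measurable: "continuous_on (sphere 0 1) f \<Longrightarrow> f \<in> borel_measurable \<sigma>"
  using borel_measurable_continuous_on_restrict[of "sphere 0 1" f] measurable_cong_sets[OF sets_\<sigma> refl] by blast

lemma continuous_integrable:
  fixes f :: "complex ^ 'n \<Rightarrow> 'b::{banach, second_countable_topology}"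
  assumes f: "continuous_on (sphere 0 1) f" shows "integrable \<sigma> f"
proof -
  have "bounded (f ` sphere 0 1)" by (intro compact_imp_bounded compact_continuous_image f) simp
  then obtain K where "\<And>z. z \<in> sphere 0 1 \<Longrightarrow> norm (f z) \<le> K" unfolding bounded_iff by blast
  then show ?thesis
    using continuous_measurable[OF f] by (intro integrable_const_bound[of f K]) (auto simp: space_\<sigma>)
qed

lemma integral_bounded_series:
  fixes F :: "nat \<Rightarrow> complex ^ 'n \<Rightarrow> complex"
  assumes int: "\<And>j. integrable \<sigma> (F j)" and bd: "\<And>j z. norm z = 1 \<Longrightarrow> norm (F j z) \<le> K j"
    and sm: "summable K" and lim: "\<And>z. norm z = 1 \<Longrightarrow> (\<lambda>j. F j z) sums G z"
  shows "(\<lambda>j. integral\<^sup>L \<sigma> (F j)) sums (\<integral>z. G z \<partial>\<sigma>)"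
proof -
  have "(\<lambda>j. integral\<^sup>L \<sigma> (F j)) sums (\<integral>z. (\<Sum>j. F j z) \<partial>\<sigma>)"
  proof (rule sums_integral[OF int])
    show "AE z in \<sigma>. summable (\<lambda>j. norm (F j z))"
      by (rule AE_I2, rule summable_comparison_test'[OF sm, of 0]) (simp add: bd space_\<sigma>)
    show "summable (\<lambda>j. \<integral>z. norm (F j z) \<partial>\<sigma>)"
    proof (rule summable_comparison_test'[OF sm, of 0])
      fix j
      have "(\<integral>z. norm (F j z) \<partial>\<sigma>) \<le> (\<integral>z. K j \<partial>\<sigma>)"
      proof (rule integral_mono_AE)
        show "AE z in \<sigma>. norm (F j z) \<le> K j" by (rule AE_I2, rule bd) (simp add: space_\<sigma>)
      qed (use int in \<open>simp_all only: integrable_norm integrable_const\<close>)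
      then show "norm (\<integral>z. norm (F j z) \<partial>\<sigma>) \<le> K j" by (simp add: prob_space)
    qed
  qed
  also have "(\<integral>z. (\<Sum>j. F j z) \<partial>\<sigma>) = (\<integral>z. G z \<partial>\<sigma>)"
    by (rule Bochner_Integration.integral_cong[OF refl]) (simp add: space_\<sigma> sums_unique[OF lim, symmetric])
  finally show ?thesis .
qed

lemma invariant_integral:
  fixes f :: "complex ^ 'n \<Rightarrow> complex"
  assumes U: "orthogonal_transformation U" and f: "continuous_on (sphere 0 1) f"
  shows "(\<integral>z. f (U z) \<partial>\<sigma>) = (\<integral>z. f z \<partial>\<sigma>)"
proof -
  have nU: "norm (U z) = norm z" for z using U by (simp add: orthogonal_transformation)
  have "continuous_on UNIV U"
    using U by (intro linear_continuous_on) (simp add: orthogonal_transformation_def linear_conv_bounded_linear)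
  then have cU: "U \<in> borel_measurable \<sigma>" by (intro continuous_measurable) (rule continuous_on_subset, auto)
  have "U \<in> measurable \<sigma> (restrict_space borel (sphere 0 1))"
    by (rule measurable_restrict_space2) (use cU nU in \<open>auto simp: space_\<sigma>\<close>)
  then have mU: "U \<in> measurable \<sigma> \<sigma>" using measurable_cong_sets[OF refl sets_\<sigma>] by blast
  have "distr \<sigma> \<sigma> U = \<sigma>" using rot U by (simp add: rotation_invariant_prob_def)
  then show ?thesis using integral_distr[OF mU continuous_measurable[OF f]] by simp
qed

text \<open>The rotation by an angle \<open>\<theta>\<close> multiplies the integral by \<open>cis ((j - m) \<theta>)\<close>.\<close>

lemma orthogonal_degrees:
  assumes "j \<noteq> m" shows "(\<integral>z. homog j b z * cinner_vec e z ^ m \<partial>\<sigma>) = 0"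
proof -
  \<comment> \<open>chosen so that the factor is \<open>-1\<close>\<close>
  define \<theta> where "\<theta> = pi / (real j - real m)"
  let ?a = "cis \<theta>"
  let ?f = "\<lambda>z. homog j b z * cinner_vec e z ^ m"
  have "(\<integral>z. ?f (?a *s z) \<partial>\<sigma>) = (\<integral>z. ?f z \<partial>\<sigma>)"
    by (intro invariant_integral rotation_orthogonal continuous_intros) simp
  moreover have "?f (?a *s z) = - ?f z" for z
  proof -
    have "?a ^ j * cnj ?a ^ m = cis (real j * \<theta>) * cis (real m * (- \<theta>))"
      unfolding cis_cnj Complex.DeMoivre ..
    also have "\<dots> = cis ((real j - real m) * \<theta>)" by (simp only: cis_mult) (simp add: algebra_simps)
    also have "\<dots> = -1" using assms by (simp add: \<theta>_def)
    finally have "?a ^ j * cnj ?a ^ m = -1" .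
    moreover have "?f (?a *s z) = (?a ^ j * cnj ?a ^ m) * ?f z"
      by (simp only: homog_scale cinner_scale power_mult_distrib mult_ac)
    ultimately show ?thesis by simp
  qed
  ultimately show ?thesis by simp
qed

definition moment_at :: "nat \<Rightarrow> complex ^ 'n \<Rightarrow> real" where
  "moment_at m e = (\<integral>z. cmod (cinner_vec z e) ^ (2 * m) \<partial>\<sigma>)"

text \<open>The unitaries \<open>twist e a\<close> leave \<open>\<langle>e, z\<rangle>\<close> unchanged. Averaging over them replaces the polynomial by its value
  at the projection of \<open>z\<close> to the line of \<open>e\<close>, where it is \<open>\<langle>z, e\<rangle>^m\<close> times the value at \<open>e\<close>.\<close>

lemma same_degree:
  assumes e: "norm e = 1"
  shows "(\<integral>z. homog m b z * cinner_vec e z ^ m \<partial>\<sigma>) = of_real (moment_at m e) * homog m b e"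
proof -
  let ?I = "\<integral>z. homog m b z * cinner_vec e z ^ m \<partial>\<sigma>"
  let ?w = "\<lambda>k. cis (2 * pi * real k / real (Suc m))"
  have cc: "continuous_on S (twist e a)" for S a
    unfolding twist_def[abs_def] by (intro continuous_intros)
  have int: "integrable \<sigma> (\<lambda>z. homog m b (twist e (?w k) z) * cinner_vec e z ^ m)" for k
    by (intro continuous_integrable continuous_intros continuous_on_compose2[OF continuous_on_homog[of UNIV]] cc) auto
  have "of_nat (Suc m) * ?I = (\<Sum>k<Suc m. \<integral>z. homog m b (twist e (?w k) z) * cinner_vec e z ^ m \<partial>\<sigma>)"
  proof -
    have "(\<integral>z. homog m b (twist e (?w k) z) * cinner_vec e z ^ m \<partial>\<sigma>) = ?I" for k
    proof -
      have "cinner_vec e (twist e (?w k) z) = cinner_vec e z" for z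
        using twist_cinner[OF e, of "?w k" z] cinner_cnj[of e] by metis
      then show ?thesis
        using invariant_integral[OF twist_orthogonal[OF e, of "?w k"], of "\<lambda>z. homog m b z * cinner_vec e z ^ m"]
        by (simp add: continuous_intros)
    qed
    then show ?thesis by simp
  qed
  also have "\<dots> = (\<integral>z. (\<Sum>k<Suc m. homog m b (twist e (?w k) z) * cinner_vec e z ^ m) \<partial>\<sigma>)"
    by (rule Bochner_Integration.integral_sum[symmetric]) (rule int)
  also have "\<dots> = (\<integral>z. of_nat (Suc m) * (of_real (cmod (cinner_vec z e) ^ (2 * m)) * homog m b e) \<partial>\<sigma>)"
  proof (rule Bochner_Integration.integral_cong[OF refl])
    fix z
    have "(\<Sum>k<Suc m. homog m b (twist e (?w k) z) * cinner_vec e z ^ m) =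
        of_nat (Suc m) * homog m b (cinner_vec z e *s e) * cinner_vec e z ^ m"
      unfolding twist_def sum_distrib_right[symmetric] homog_mean ..
    also have "\<dots> = of_nat (Suc m) * ((cinner_vec z e * cinner_vec e z) ^ m * homog m b e)"
      by (simp add: homog_scale power_mult_distrib)
    also have "cinner_vec z e * cinner_vec e z = of_real ((cmod (cinner_vec z e))\<^sup>2)"
      using cinner_cnj[of e z] by (simp only: complex_norm_square)
    finally show "(\<Sum>k<Suc m. homog m b (twist e (?w k) z) * cinner_vec e z ^ m) =
        of_nat (Suc m) * (of_real (cmod (cinner_vec z e) ^ (2 * m)) * homog m b e)"
      by (simp add: power_mult)
  qed
  also have "\<dots> = of_nat (Suc m) * (of_real (moment_at m e) * homog m b e)"
    unfolding moment_at_def by (simp only: integral_mult_right_zero integral_mult_left_zero integral_complex_of_real)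
  finally show ?thesis by (simp only: mult_cancel_left of_nat_neq_0 simp_thms)
qed

text \<open>Two ways to evaluate \<open>\<integral> \<langle>z, w\<rangle>^m \<langle>e, z\<rangle>^m d\<sigma>\<close> by \<open>same_degree\<close>; an intermediate vector takes care of
  orthogonal \<open>e\<close> and \<open>w\<close>.\<close>

lemma moment_at_unique:
  assumes e: "norm e = 1" and w: "norm w = 1" shows "moment_at m e = moment_at m w"
proof -
  have ne: "moment_at m e = moment_at m w" if e: "norm e = 1" and w: "norm w = 1" and ew: "cinner_vec e w \<noteq> 0" for e w
  proof -
    have J: "(\<integral>z. cinner_vec z w ^ m * cinner_vec e z ^ m \<partial>\<sigma>) = of_real (moment_at m e) * cinner_vec e w ^ m"
      if "norm e = 1" for e w
      using same_degree[OF that, of m "\<lambda>l. cnj (wmon l w)"] by (simp only: homog_cinner)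
    have "cnj (\<integral>z. cinner_vec z w ^ m * cinner_vec e z ^ m \<partial>\<sigma>) = (\<integral>z. cinner_vec z e ^ m * cinner_vec w z ^ m \<partial>\<sigma>)"
    proof -
      have "cnj (cinner_vec z w ^ m * cinner_vec e z ^ m) = cinner_vec z e ^ m * cinner_vec w z ^ m" for z
        using cinner_cnj[of w z] cinner_cnj[of z e] by (simp add: mult.commute)
      then show ?thesis by (simp only: Bochner_Integration.integral_cnj[symmetric])
    qed
    then have "cnj (of_real (moment_at m e) * cinner_vec e w ^ m) = of_real (moment_at m w) * cinner_vec w e ^ m"
      unfolding J[OF e] J[OF w] .
    then have "of_real (moment_at m e) * cinner_vec w e ^ m = of_real (moment_at m w) * cinner_vec w e ^ m"
      using cinner_cnj[of w e] by simp
    moreover have "cinner_vec w e \<noteq> 0" using ew cinner_cnj[of w e] by simp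
    ultimately show ?thesis by simp
  qed
  show ?thesis
  proof (cases "cinner_vec e w = 0")
    case True
    then have we: "cinner_vec w e = 0" using cinner_cnj[of w e] by simp
    \<comment> \<open>a unit vector that is orthogonal to neither\<close>
    define v where "v = of_real (1 / sqrt 2) *s (e + w)"
    have ee: "cinner_vec e e = 1" "cinner_vec w w = 1" using e w by (simp_all add: cinner_self)
    have "(of_real ((norm v)\<^sup>2) :: complex) = of_real (1 / sqrt 2) * (of_real (1 / sqrt 2) * (1 + 1))"
      unfolding cinner_self[symmetric] v_def
      by (simp only: cinner_scale cinner_add ee True we complex_cnj_complex_of_real) simp
    also have "\<dots> = of_real (1 / sqrt 2 * (1 / sqrt 2) * 2)"
      by (simp only: of_real_mult of_real_numeral one_add_one mult.assoc)
    finally have "(of_real ((norm v)\<^sup>2) :: complex) = of_real (1 / sqrt 2 * (1 / sqrt 2) * 2)" .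
    then have "(norm v)\<^sup>2 = 1 / sqrt 2 * (1 / sqrt 2) * 2" using of_real_eq_iff by blast
    then have "norm v = 1" using norm_ge_zero[of v] by (simp add: power2_eq_1_iff)
    moreover have "cinner_vec e v \<noteq> 0" "cinner_vec w v \<noteq> 0"
      unfolding v_def by (simp_all add: cinner_scale cinner_add ee True we)
    ultimately show ?thesis using ne[OF e, of v] ne[OF w, of v] by simp
  next
    case False
    then show ?thesis by (rule ne[OF e w])
  qed
qed

lemma unit_vector: "\<exists>e :: complex ^ 'n. norm e = 1"
proof -
  obtain e :: "complex ^ 'n" where "norm e = 1" using vector_choose_size[of 1] by auto
  then show ?thesis by blast
qed

definition moment :: "nat \<Rightarrow> real" where "moment m = moment_at m (SOME e. norm e = 1)"

lemma moment_at_eq: "norm e = 1 \<Longrightarrow> moment_at m e = moment m"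
  unfolding moment_def by (rule moment_at_unique[OF _ someI_ex[OF unit_vector]])

lemma homog_integral:
  "(\<integral>\<zeta>. homog j b \<zeta> * cinner_vec z \<zeta> ^ m \<partial>\<sigma>) = (if j = m then of_real (moment m) * homog m b z else 0)"
proof (cases "j = m")
  case True
  have "\<exists>e :: complex ^ 'n. norm e = 1 \<and> z = of_real (norm z) *s e"
  proof (cases "z = 0")
    case True
    then show ?thesis using unit_vector by auto
  next
    case False
    then have "norm ((1 / norm z) *\<^sub>R z) = 1" by simp
    moreover have "z = of_real (norm z) *s ((1 / norm z) *\<^sub>R z)"
      using False by (simp add: scaleR_smult vec_eq_iff)
    ultimately show ?thesis by blast
  qed
  then obtain e :: "complex ^ 'n" where e: "norm e = 1" and z: "z = of_real (norm z) *s e" by blast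
  define r where "r = (of_real (norm z) :: complex)"
  have z': "z = r *s e" using z by (simp add: r_def)
  have "(\<integral>\<zeta>. homog m b \<zeta> * cinner_vec z \<zeta> ^ m \<partial>\<sigma>) = (\<integral>\<zeta>. r ^ m * (homog m b \<zeta> * cinner_vec e \<zeta> ^ m) \<partial>\<sigma>)"
    unfolding z' cinner_scale power_mult_distrib by (simp only: mult_ac)
  also have "\<dots> = r ^ m * (of_real (moment m) * homog m b e)"
    unfolding integral_mult_right_zero same_degree[OF e] moment_at_eq[OF e] ..
  also have "\<dots> = of_real (moment m) * homog m b z" unfolding z' homog_scale by (simp only: mult_ac)
  finally show ?thesis using True by simp
qed (simp add: orthogonal_degrees)

text \<open>Finitely many caps of radius \<open>d\<close> cover the sphere, so one of them has positive measure, and the moments may be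
  computed at its centre.\<close>

lemma moment_lower:
  assumes d: "0 < d" "d < 1"
  obtains \<kappa> where "\<kappa> > 0" "\<And>m. \<kappa> * (1 - d) ^ (2 * m) \<le> moment m"
proof -
  have "\<exists>K. finite K \<and> K \<subseteq> sphere (0 :: complex ^ 'n) 1 \<and> sphere 0 1 \<subseteq> (\<Union>a\<in>K. ball a d)"
    by (rule seq_compact_imp_totally_bounded[OF compact_imp_seq_compact[OF compact_sphere], rule_format, OF d(1)])
  then obtain K where K: "finite K" "K \<subseteq> sphere (0 :: complex ^ 'n) 1" "sphere 0 1 \<subseteq> (\<Union>a\<in>K. ball a d)"
    by (elim exE conjE)
  define C where "C a = ball a d \<inter> sphere 0 1" for a :: "complex ^ 'n"
  have Cs: "C a \<in> sets \<sigma>" for a unfolding sets_\<sigma> C_def by (auto simp: sets_restrict_space)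
  have "\<exists>a\<in>K. measure \<sigma> (C a) > 0"
  proof (rule ccontr)
    assume neg: "\<not> ?thesis"
    have z: "measure \<sigma> (C a) = 0" if "a \<in> K" for a
    proof -
      have "\<not> measure \<sigma> (C a) > 0" using neg that by blast
      then show ?thesis using measure_nonneg[of \<sigma> "C a"] by linarith
    qed
    have "1 = measure \<sigma> (\<Union>a\<in>K. C a)"
    proof -
      have "(\<Union>a\<in>K. C a) = space \<sigma>" using K(3) by (auto simp: space_\<sigma> C_def)
      then show ?thesis using prob_space by simp
    qed
    also have "\<dots> \<le> (\<Sum>a\<in>K. measure \<sigma> (C a))" using Cs by (intro finite_measure_subadditive_finite K) auto
    finally show False using z by simp
  qed
  then obtain a where a: "a \<in> K" "measure \<sigma> (C a) > 0" by blast
  have na: "norm a = 1" using a(1) K(2) by auto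
  have "measure \<sigma> (C a) * (1 - d) ^ (2 * m) \<le> moment m" for m
  proof -
    have "measure \<sigma> (C a) * (1 - d) ^ (2 * m) = (\<integral>z. indicat_real (C a) z * (1 - d) ^ (2 * m) \<partial>\<sigma>)"
      using Cs[of a] by simp
    also have "\<dots> \<le> (\<integral>z. cmod (cinner_vec z a) ^ (2 * m) \<partial>\<sigma>)"
    proof (rule integral_mono)
      show "integrable \<sigma> (\<lambda>z. indicat_real (C a) z * (1 - d) ^ (2 * m))"
        using Cs[of a] by (intro integrable_mult_left integrable_real_indicator) (auto simp: emeasure_eq_measure)
      show "integrable \<sigma> (\<lambda>z. cmod (cinner_vec z a) ^ (2 * m))"
        by (intro continuous_integrable continuous_intros)
      fix z
      show "indicat_real (C a) z * (1 - d) ^ (2 * m) \<le> cmod (cinner_vec z a) ^ (2 * m)"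
      proof (cases "z \<in> C a")
        case True
        have "cinner_vec z a = 1 - cinner_vec (a - z) a" by (simp add: cinner_minus cinner_self na)
        then have "1 - cmod (cinner_vec (a - z) a) \<le> cmod (cinner_vec z a)"
          using norm_triangle_ineq2[of 1 "cinner_vec (a - z) a"] by simp
        moreover have "cmod (cinner_vec (a - z) a) \<le> d"
          using cinner_bound[of "a - z" a] na True by (simp add: C_def dist_norm)
        ultimately have "1 - d \<le> cmod (cinner_vec z a)" by linarith
        then show ?thesis using True d by (simp add: power_mono)
      qed simp
    qed
    also have "\<dots> = moment m" using moment_at_eq[OF na] by (simp add: moment_at_def)
    finally show ?thesis .
  qed
  then show ?thesis using that a(2) by blast
qed

lemma moment_pos: "moment m > 0"
proof -
  obtain \<kappa> where \<kappa>: "\<kappa> > 0" "\<And>m. \<kappa> * (1 - 1 / 2) ^ (2 * m) \<le> moment m"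
    using moment_lower[of "1/2"] by auto
  have "0 < \<kappa> * (1 - 1 / 2) ^ (2 * m)" using \<kappa>(1) by simp
  then show ?thesis using \<kappa>(2)[of m] by linarith
qed

lemma moment_summable: assumes s: "0 \<le> s" "s < 1" shows "summable (\<lambda>m. s ^ m / moment m)"
proof -
  \<comment> \<open>any number between \<open>s\<close> and \<open>1\<close> would do\<close>
  define t where "t = (1 + s) / 2"
  have t: "0 < t" "s < t" "t < 1" using s by (auto simp: t_def)
  have "0 < 1 - sqrt t" "1 - sqrt t < 1" using t by auto
  then obtain \<kappa> where \<kappa>: "\<kappa> > 0" "\<And>m. \<kappa> * (1 - (1 - sqrt t)) ^ (2 * m) \<le> moment m"
    using moment_lower by blast
  have le: "\<kappa> * t ^ m \<le> moment m" for m using \<kappa>(2)[of m] t by (simp add: power_mult)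
  show ?thesis
  proof (rule summable_comparison_test'[of _ 0])
    show "summable (\<lambda>m. (1 / \<kappa>) * (s / t) ^ m)" using s t by (intro summable_mult summable_geometric) simp
    fix m
    have "s ^ m / moment m \<le> s ^ m / (\<kappa> * t ^ m)"
      using le[of m] s t \<kappa>(1) moment_pos[of m] by (intro divide_left_mono) (auto intro!: mult_pos_pos)
    then show "norm (s ^ m / moment m) \<le> (1 / \<kappa>) * (s / t) ^ m"
      using s moment_pos[of m] by (simp add: power_divide field_simps)
  qed
qed

end

section \<open>Boundary values and the Szego formula\<close>

context drury_arveson_space
begin

lemma polynomial_fun_continuous: "polynomial_fun p \<Longrightarrow> continuous_on S p"
proof -
  assume "polynomial_fun p"
  then obtain A c where p: "\<And>z. p z = (\<Sum>\<alpha>\<in>A. c \<alpha> * (\<Prod>i\<in>UNIV. (z $ i) ^ \<alpha> i))"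
    unfolding polynomial_fun_def by blast
  have "continuous_on S (\<lambda>z. \<Sum>\<alpha>\<in>A. c \<alpha> * (\<Prod>i\<in>UNIV. (z $ i) ^ \<alpha> i))"
    by (intro continuous_intros)
  then show ?thesis using p by (metis (no_types, lifting) continuous_on_cong)
qed

text \<open>The multiplier norm dominates the supremum norm, so elements of the ball algebra are uniform limits of
  polynomials.\<close>

lemma A_uniformly_continuous:
  assumes f: "f \<in> \<A>" shows "uniformly_continuous_on B f"
  unfolding uniformly_continuous_on_def
proof (intro allI impI)
  fix e :: real assume e: "e > 0"
  obtain p where p: "polynomial_fun p" "mnorm (f - res p) < e / 3" using A_approx[OF f, of "e / 3"] e by auto
  have m: "mult (f - res p)" using multiplierD(1)[OF A_multiplier[OF f]] polynomial_mult[OF p(1)] by (intro mult_diff) auto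
  have near: "dist (f z) (p z) < e / 3" if "z \<in> B" for z
    using mult_eval[OF m that] p(2) that by (simp add: fun_apply restrict0_def dist_norm)
  have "uniformly_continuous_on (cball 0 1) p"
    by (intro compact_uniformly_continuous polynomial_fun_continuous p) simp
  then obtain d where d: "d > 0" "\<And>x x'. x \<in> cball 0 1 \<Longrightarrow> x' \<in> cball 0 1 \<Longrightarrow> dist x' x < d \<Longrightarrow> dist (p x') (p x) < e / 3"
    using e unfolding uniformly_continuous_on_def by (metis zero_less_divide_iff zero_less_numeral)
  have "dist (f x') (f x) < e" if x: "x \<in> B" "x' \<in> B" "dist x' x < d" for x x'
  proof -
    have "dist (p x') (p x) < e / 3" using x by (intro d) auto
    moreover have "dist (f x') (f x) \<le> dist (f x') (p x') + dist (p x') (p x) + dist (f x) (p x)"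
      using dist_triangle[of "f x'" "f x" "p x'"] dist_triangle[of "p x'" "f x" "p x"]
      by (simp add: dist_commute)
    ultimately show ?thesis using near[OF x(1)] near[OF x(2)] by linarith
  qed
  then show "\<exists>d>0. \<forall>x\<in>B. \<forall>x'\<in>B. dist x' x < d \<longrightarrow> dist (f x') (f x) < e" using d(1) by blast
qed

definition rad :: "nat \<Rightarrow> real" where "rad n = 1 - 1 / real (Suc (Suc n))"

lemma rad: "0 \<le> rad n" "rad n < 1" "rad \<longlonglongrightarrow> 1"
proof -
  show "0 \<le> rad n" "rad n < 1" by (simp_all add: rad_def)
  have "(\<lambda>n. 1 - 1 / real (Suc (Suc n))) \<longlonglongrightarrow> 1 - 0"
    using LIMSEQ_Suc[OF LIMSEQ_inverse_real_of_nat] by (intro tendsto_intros) (simp add: inverse_eq_divide)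
  then show "rad \<longlonglongrightarrow> 1" by (simp add: rad_def[abs_def])
qed

lemma boundary_value_limit:
  assumes f: "f \<in> \<A>" and \<zeta>: "norm \<zeta> = 1"
  shows "(\<lambda>n. f (rad n *\<^sub>R \<zeta>)) \<longlonglongrightarrow> boundary_value f \<zeta>"
proof -
  have cl: "\<zeta> \<in> closure B" using \<zeta> by (simp add: closure_ball)
  obtain l where l: "(f \<longlongrightarrow> l) (at \<zeta> within B)"
    using uniformly_continuous_on_extension_at_closure[OF A_uniformly_continuous[OF f] cl] by blast
  have lim: "filterlim (\<lambda>n. rad n *\<^sub>R \<zeta>) (at \<zeta> within B) sequentially"
    unfolding filterlim_at
  proof (intro conjI always_eventually allI)
    have "(\<lambda>n. rad n *\<^sub>R \<zeta>) \<longlonglongrightarrow> 1 *\<^sub>R \<zeta>" by (intro tendsto_intros rad)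
    then show "(\<lambda>n. rad n *\<^sub>R \<zeta>) \<longlonglongrightarrow> \<zeta>" by simp
    fix n
    have n: "norm (rad n *\<^sub>R \<zeta>) < 1" using rad(1)[of n] rad(2)[of n] \<zeta> by simp
    then show "rad n *\<^sub>R \<zeta> \<in> B" by simp
    show "rad n *\<^sub>R \<zeta> \<noteq> \<zeta>" using n \<zeta> by (metis less_irrefl)
  qed
  have "at \<zeta> within B \<noteq> bot"
  proof
    assume "at \<zeta> within B = bot"
    then have "filterlim (\<lambda>n. rad n *\<^sub>R \<zeta>) bot sequentially" using lim by simp
    then show False unfolding filterlim_def by (simp add: bot_unique filtermap_bot_iff)
  qed
  then have "boundary_value f \<zeta> = l" unfolding boundary_value_def using l by (intro tendsto_Lim)
  then show ?thesis using filterlim_compose[OF l lim] by simp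
qed

lemma boundary_value_bound: assumes f: "f \<in> \<A>" and \<zeta>: "norm \<zeta> = 1" shows "cmod (boundary_value f \<zeta>) \<le> mnorm f"
proof (rule LIMSEQ_le_const2[OF tendsto_norm[OF boundary_value_limit[OF assms]]])
  have "rad n *\<^sub>R \<zeta> \<in> B" for n using rad(1)[of n] rad(2)[of n] \<zeta> by simp
  then show "\<exists>N. \<forall>n\<ge>N. norm (f (rad n *\<^sub>R \<zeta>)) \<le> mnorm f"
    using mult_eval[OF multiplierD(1)[OF A_multiplier[OF f]]] by blast
qed

end

locale drury_arveson_sphere = drury_arveson_space H ip + sphere_measure \<sigma>
  for H :: "(complex ^ 'n \<Rightarrow> complex) set" and ip and \<sigma> :: "(complex ^ 'n) measure"
begin

lemma dilate_measurable: assumes f: "f \<in> \<A>" and r: "0 \<le> r" "r < 1"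
  shows "(\<lambda>\<zeta>. f (r *\<^sub>R \<zeta>)) \<in> borel_measurable \<sigma>"
proof (rule continuous_measurable)
  have "continuous_on B f" by (rule uniformly_continuous_imp_continuous[OF A_uniformly_continuous[OF f]])
  then show "continuous_on (sphere 0 1) (\<lambda>\<zeta>. f (r *\<^sub>R \<zeta>))"
    by (rule continuous_on_compose2) (use r in \<open>auto intro!: continuous_intros\<close>)
qed

lemma boundary_value_measurable: assumes f: "f \<in> \<A>" shows "boundary_value f \<in> borel_measurable \<sigma>"
proof (rule borel_measurable_LIMSEQ_metric)
  show "(\<lambda>\<zeta>. f (rad n *\<^sub>R \<zeta>)) \<in> borel_measurable \<sigma>" for n by (rule dilate_measurable[OF f rad(1,2)])
  show "(\<lambda>n. f (rad n *\<^sub>R \<zeta>)) \<longlonglongrightarrow> boundary_value f \<zeta>" if "\<zeta> \<in> space \<sigma>" for \<zeta>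
    using that by (intro boundary_value_limit f) (simp add: space_\<sigma>)
qed

text \<open>Of the homogeneous expansion, only the term of degree \<open>m\<close> survives the integration.\<close>

lemma dilate_integral:
  assumes f: "f \<in> \<A>" and r: "0 \<le> r" "r < 1"
  shows "(\<integral>\<zeta>. f (r *\<^sub>R \<zeta>) * cinner_vec z \<zeta> ^ m \<partial>\<sigma>) = of_real (r ^ m * moment m) * hpart m f z"
proof -
  let ?F = "\<lambda>j \<zeta>. of_real (r ^ j) * (hpart j f \<zeta> * cinner_vec z \<zeta> ^ m)"
  have fH: "f \<in> H" using multiplierD(3)[OF A_multiplier[OF f]] .
  have bd: "norm (?F j \<zeta>) \<le> r ^ j * (nrm f * norm z ^ m)" if "norm \<zeta> = 1" for j \<zeta>
  proof -
    have "cmod (hpart j f \<zeta>) \<le> nrm f" using hpart_bound[OF fH, of j \<zeta>] that by simp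
    moreover have "cmod (cinner_vec z \<zeta>) ^ m \<le> norm z ^ m"
      using cinner_bound[of z \<zeta>] that by (intro power_mono) auto
    ultimately have "cmod (hpart j f \<zeta>) * cmod (cinner_vec z \<zeta>) ^ m \<le> nrm f * norm z ^ m"
      using fH by (intro mult_mono) auto
    then show ?thesis using r by (simp add: norm_mult norm_power mult_left_mono)
  qed
  have geo: "summable (\<lambda>j. r ^ j * (nrm f * norm z ^ m))"
    using r by (intro summable_mult2 summable_geometric) simp
  have int: "integrable \<sigma> (?F j)" for j
    unfolding hpart_def by (intro continuous_integrable continuous_intros)
  have "(\<lambda>j. integral\<^sup>L \<sigma> (?F j)) sums (\<integral>\<zeta>. f (r *\<^sub>R \<zeta>) * cinner_vec z \<zeta> ^ m \<partial>\<sigma>)"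
  proof (rule integral_bounded_series[OF int bd geo])
    fix \<zeta> :: "complex ^ 'n" assume "norm \<zeta> = 1"
    then have "r *\<^sub>R \<zeta> \<in> B" using r by simp
    then have "(\<lambda>j. hpart j f (r *\<^sub>R \<zeta>) * cinner_vec z \<zeta> ^ m) sums (f (r *\<^sub>R \<zeta>) * cinner_vec z \<zeta> ^ m)"
      by (intro sums_mult2 hpart_sums fH)
    then show "(\<lambda>j. ?F j \<zeta>) sums (f (r *\<^sub>R \<zeta>) * cinner_vec z \<zeta> ^ m)"
      by (simp only: hpart_scaleR mult.assoc)
  qed
  also have "(\<lambda>j. integral\<^sup>L \<sigma> (?F j)) = (\<lambda>j. if j = m then of_real (r ^ m * moment m) * hpart m f z else 0)"
    unfolding integral_mult_right_zero hpart_def homog_integral by (auto simp: fun_eq_iff)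
  finally have "(\<lambda>j. if j = m then of_real (r ^ m * moment m) * hpart m f z else 0) sums
      (\<integral>\<zeta>. f (r *\<^sub>R \<zeta>) * cinner_vec z \<zeta> ^ m \<partial>\<sigma>)" .
  from sums_unique2[OF this sums_single] show ?thesis .
qed

text \<open>The Cauchy--Szego formula, one degree at a time. It is the limit of \<open>dilate_integral\<close> as the radius tends
  to one.\<close>

lemma szego:
  assumes f: "f \<in> \<A>"
  shows "(\<integral>\<zeta>. boundary_value f \<zeta> * cinner_vec z \<zeta> ^ m \<partial>\<sigma>) = of_real (moment m) * hpart m f z"
proof -
  have m: "mult f" by (rule multiplierD(1)[OF A_multiplier[OF f]])
  have mc: "(\<lambda>\<zeta>. cinner_vec z \<zeta> ^ m) \<in> borel_measurable \<sigma>" by (intro continuous_measurable continuous_intros)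
  have "(\<lambda>n. \<integral>\<zeta>. f (rad n *\<^sub>R \<zeta>) * cinner_vec z \<zeta> ^ m \<partial>\<sigma>) \<longlonglongrightarrow> (\<integral>\<zeta>. boundary_value f \<zeta> * cinner_vec z \<zeta> ^ m \<partial>\<sigma>)"
  proof (rule integral_dominated_convergence[where w = "\<lambda>_. mnorm f * norm z ^ m"])
    show "(\<lambda>\<zeta>. boundary_value f \<zeta> * cinner_vec z \<zeta> ^ m) \<in> borel_measurable \<sigma>"
      by (intro borel_measurable_times boundary_value_measurable f mc)
    show "(\<lambda>\<zeta>. f (rad n *\<^sub>R \<zeta>) * cinner_vec z \<zeta> ^ m) \<in> borel_measurable \<sigma>" for n
      by (intro borel_measurable_times dilate_measurable f mc rad)
    show "AE \<zeta> in \<sigma>. (\<lambda>n. f (rad n *\<^sub>R \<zeta>) * cinner_vec z \<zeta> ^ m) \<longlonglongrightarrow> boundary_value f \<zeta> * cinner_vec z \<zeta> ^ m"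
      by (rule AE_I2) (auto intro!: tendsto_mult_right boundary_value_limit f simp: space_\<sigma>)
    show "AE \<zeta> in \<sigma>. norm (f (rad n *\<^sub>R \<zeta>) * cinner_vec z \<zeta> ^ m) \<le> mnorm f * norm z ^ m" for n
    proof (rule AE_I2)
      fix \<zeta> assume "\<zeta> \<in> space \<sigma>"
      then have \<zeta>: "norm \<zeta> = 1" by (simp add: space_\<sigma>)
      have "cmod (f (rad n *\<^sub>R \<zeta>)) \<le> mnorm f" using rad(1)[of n] rad(2)[of n] \<zeta> by (intro mult_eval m) simp
      moreover have "cmod (cinner_vec z \<zeta>) ^ m \<le> norm z ^ m"
        using cinner_bound[of z \<zeta>] \<zeta> by (intro power_mono) auto
      ultimately show "norm (f (rad n *\<^sub>R \<zeta>) * cinner_vec z \<zeta> ^ m) \<le> mnorm f * norm z ^ m"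
        unfolding norm_mult norm_power by (intro mult_mono mnorm_ge0 m) auto
    qed
  qed simp
  then have "(\<lambda>n. of_real (rad n ^ m * moment m) * hpart m f z) \<longlonglongrightarrow> (\<integral>\<zeta>. boundary_value f \<zeta> * cinner_vec z \<zeta> ^ m \<partial>\<sigma>)"
    unfolding dilate_integral[OF f rad(1,2)] .
  moreover have "(\<lambda>n. of_real (rad n ^ m * moment m) * hpart m f z) \<longlonglongrightarrow> of_real (1 ^ m * moment m) * hpart m f z"
    by (intro tendsto_intros rad)
  ultimately show ?thesis using LIMSEQ_unique by fastforce
qed

end

section \<open>The representing antiholomorphic function\<close>

locale henkin_sphere = henkin H ip \<Phi> + drury_arveson_sphere H ip \<sigma>
  for H :: "(complex ^ 'n \<Rightarrow> complex) set" and ip and \<Phi> and \<sigma> :: "(complex ^ 'n) measure"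
begin

text \<open>As \<open>cnj (Q m z) = \<Phi> (\<langle>\<cdot>, z\<rangle>^m)\<close>, this is \<open>\<Phi>\<close> applied to the Cauchy--Szego kernel, expanded into
  homogeneous terms.\<close>

definition \<phi> :: "complex ^ 'n \<Rightarrow> complex" where
  "\<phi> z = (\<Sum>m. of_real (1 / moment m) * cnj (Q m z))"

lemma Q_bound: "cmod (Q m z) \<le> dnorm \<Phi> * norm z ^ m"
proof -
  have "cnj (Q m z) = \<Phi> (res (homog m (\<lambda>l. cnj (wmon l z))))"
    unfolding \<Phi>_homog by (simp add: Q_def homog_def mult.commute)
  then have "cmod (Q m z) = cmod (\<Phi> (res (homog m (\<lambda>l. cnj (wmon l z)))))"
    by (metis complex_mod_cnj)
  also have "\<dots> \<le> dnorm \<Phi> * mnorm (res (homog m (\<lambda>l. cnj (wmon l z))))" by (intro \<Phi>_bound homog_A)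
  also have "\<dots> \<le> dnorm \<Phi> * norm z ^ m"
    using cinner_pow_mult(2)[of z m] unfolding mnorm_restrict0 homog_cinner[abs_def]
    by (intro mult_left_mono dnorm_\<Phi>_ge0)
  finally show ?thesis .
qed

lemma Q_smult: "Q m (a *s z) = a ^ m * Q m z"
  by (simp add: Q_def homog_scale)

lemma \<phi>_summable: assumes "norm z < 1" shows "summable (\<lambda>m. of_real (1 / moment m) * cnj (Q m z))"
proof (rule summable_comparison_test'[of _ 0])
  show "summable (\<lambda>m. dnorm \<Phi> * (norm z ^ m / moment m))" using assms by (intro summable_mult moment_summable) auto
  fix m
  have "(1 / moment m) * cmod (Q m z) \<le> (1 / moment m) * (dnorm \<Phi> * norm z ^ m)"
    using moment_pos[of m] by (intro mult_left_mono Q_bound) auto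
  then show "norm (of_real (1 / moment m) * cnj (Q m z)) \<le> dnorm \<Phi> * (norm z ^ m / moment m)"
    using moment_pos[of m] by (simp add: norm_mult norm_divide)
qed

text \<open>On each smaller ball of radius \<open>s\<close>, the conjugate of \<open>\<phi>\<close> is the dilate of an element of \<open>H\<close>,
  because the polynomials \<open>Q m\<close> are bounded in \<open>H\<close>.\<close>

lemma \<phi>_antiholomorphic: "antiholomorphic_on_ball \<phi>"
  unfolding antiholomorphic_on_ball_def analytic_on_ball_def
proof
  fix z0 :: "complex ^ 'n" assume z0: "z0 \<in> ball 0 1"
  define s where "s = (1 + norm z0) / 2"
  have s: "0 < s" "norm z0 < s" "s < 1" using z0 by (auto simp: s_def add_pos_nonneg)
  let ?v = "\<lambda>m. cscale (of_real (s ^ m / moment m)) (res (Q m))"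
  have v: "?v m \<in> H" for m by (intro scale_mem Q_mem)
  have "summable (\<lambda>m. nrm (?v m))"
  proof (rule summable_comparison_test'[of _ 0])
    show "summable (\<lambda>m. (s ^ m / moment m) * dnorm \<Phi>)" using s by (intro summable_mult2 moment_summable) auto
    fix m
    have "nrm (?v m) = s ^ m / moment m * nrm (res (Q m))"
      using s moment_pos[of m] unfolding nrm_scale[OF Q_mem] by (simp add: norm_divide norm_power)
    also have "\<dots> \<le> s ^ m / moment m * dnorm \<Phi>" using s moment_pos[of m] by (intro mult_left_mono Q_nrm) auto
    finally show "norm (nrm (?v m)) \<le> s ^ m / moment m * dnorm \<Phi>" using nrm_ge0[OF v] by simp
  qed
  then obtain y where y: "y \<in> H" "(\<lambda>n. nrm ((\<Sum>m<n. ?v m) - y)) \<longlonglongrightarrow> 0"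
    using abs_convergent_series[of ?v] v by blast
  have eq: "y (inverse s *\<^sub>R z) = cnj (\<phi> z)" if z: "z \<in> ball 0 s" for z
  proof -
    have zB: "inverse s *\<^sub>R z \<in> B" using z s by (simp add: field_simps)
    have "(\<lambda>n. (\<Sum>m<n. ?v m) (inverse s *\<^sub>R z)) \<longlonglongrightarrow> y (inverse s *\<^sub>R z)"
      by (rule tendsto_eval[OF sum_mem[OF v] y])
    moreover have "(\<Sum>m<n. ?v m) (inverse s *\<^sub>R z) = (\<Sum>m<n. of_real (1 / moment m) * Q m z)" for n
      unfolding sum_fun_apply
    proof (intro sum.cong refl)
      fix m
      have "s ^ m / moment m * inverse s ^ m = 1 / moment m" using s by (simp add: power_inverse)
      then have "of_real (s ^ m / moment m) * (of_real (inverse s) ^ m * Q m z) = of_real (1 / moment m) * Q m z"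
        by (simp only: mult.assoc[symmetric] of_real_mult[symmetric] of_real_power[symmetric])
      then show "?v m (inverse s *\<^sub>R z) = of_real (1 / moment m) * Q m z"
        using zB by (simp only: fun_apply restrict0_def scaleR_smult Q_smult if_True)
    qed
    moreover have "(\<lambda>n. \<Sum>m<n. of_real (1 / moment m) * Q m z) \<longlonglongrightarrow> cnj (\<phi> z)"
    proof -
      have "norm z < 1" using z s by simp
      from sums_cnj[THEN iffD2, OF summable_sums[OF \<phi>_summable[OF this]]]
      show ?thesis unfolding sums_def \<phi>_def by simp
    qed
    ultimately show ?thesis using LIMSEQ_unique by (simp only:)
  qed
  have "inverse s *\<^sub>R z0 \<in> ball 0 1" using s by (simp add: field_simps)
  moreover have "analytic_on_ball y" using da y(1) by (simp add: drury_arveson_def)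
  ultimately obtain y' where y': "(y has_derivative y') (at (inverse s *\<^sub>R z0))" "\<And>c v. y' (c *s v) = c * y' v"
    unfolding analytic_on_ball_def by blast
  have "((\<lambda>z. inverse s *\<^sub>R z) has_derivative (\<lambda>v. inverse s *\<^sub>R v)) (at z0)"
    by (intro derivative_intros)
  from has_derivative_compose[OF this y'(1)]
  have "((\<lambda>z. y (inverse s *\<^sub>R z)) has_derivative (\<lambda>v. y' (inverse s *\<^sub>R v))) (at z0)" .
  then have "((\<lambda>z. cnj (\<phi> z)) has_derivative (\<lambda>v. y' (inverse s *\<^sub>R v))) (at z0)"
    by (rule has_derivative_transform_within_open[of _ _ _ _ "ball 0 s"]) (use s eq in auto)
  moreover have "y' (inverse s *\<^sub>R (c *s v)) = c * y' (inverse s *\<^sub>R v)" for c v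
  proof -
    have "inverse s *\<^sub>R (c *s v) = c *s (inverse s *\<^sub>R v)" by (simp add: vec_eq_iff)
    then show ?thesis by (simp only: y'(2))
  qed
  ultimately show "\<exists>f'. ((\<lambda>z. cnj (\<phi> z)) has_derivative f') (at z0) \<and> (\<forall>c v. f' (c *s v) = c * f' v)"
    by (intro exI[of _ "\<lambda>v. y' (inverse s *\<^sub>R v)"]) simp
qed

lemma boundary_integrable:
  assumes f: "f \<in> \<A>" and g: "continuous_on (sphere 0 1) g"
  shows "integrable \<sigma> (\<lambda>\<zeta>. boundary_value f \<zeta> * g \<zeta>)"
proof -
  have "bounded (g ` sphere 0 1)" by (intro compact_imp_bounded compact_continuous_image g) simp
  then obtain K where K: "\<And>z. z \<in> sphere 0 1 \<Longrightarrow> norm (g z) \<le> K" unfolding bounded_iff by blast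
  show ?thesis
  proof (rule integrable_const_bound[of _ "mnorm f * K"])
    show "(\<lambda>\<zeta>. boundary_value f \<zeta> * g \<zeta>) \<in> borel_measurable \<sigma>"
      by (intro borel_measurable_times boundary_value_measurable f continuous_measurable g)
    show "AE \<zeta> in \<sigma>. norm (boundary_value f \<zeta> * g \<zeta>) \<le> mnorm f * K"
    proof (rule AE_I2)
      fix \<zeta> assume "\<zeta> \<in> space \<sigma>"
      then have "norm \<zeta> = 1" by (simp add: space_\<sigma>)
      then show "norm (boundary_value f \<zeta> * g \<zeta>) \<le> mnorm f * K"
        unfolding norm_mult using K[of \<zeta>] boundary_value_bound[OF f, of \<zeta>] mnorm_ge0[OF A_mult[OF f]]
        by (intro mult_mono) auto
    qed
  qed
qed

text \<open>Both \<open>\<Phi>\<close> and the integral are linear, so the functional can be moved through the integral once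
  \<open>\<langle>z, \<zeta>\<rangle>^m\<close> is expanded into monomials. The two sides of the Cauchy--Szego formula
  are compared as polynomials, not by coefficients; this suffices, since \<open>\<Phi>\<close> only depends on the
  polynomials.\<close>

lemma Q_integral:
  assumes f: "f \<in> \<A>"
  shows "(\<integral>\<zeta>. boundary_value f \<zeta> * cnj (Q m \<zeta>) \<partial>\<sigma>) = of_real (moment m) * \<Phi> (res (hpart m f))"
proof -
  define b where "b l = (\<integral>\<zeta>. boundary_value f \<zeta> * cnj (wmon l \<zeta>) \<partial>\<sigma>)" for l
  have int: "integrable \<sigma> (\<lambda>\<zeta>. boundary_value f \<zeta> * cnj (wmon l \<zeta>))" for l
    by (intro boundary_integrable f continuous_intros)
  have pull: "(\<Sum>l\<in>words m. c l * b l) = (\<integral>\<zeta>. boundary_value f \<zeta> * (\<Sum>l\<in>words m. c l * cnj (wmon l \<zeta>)) \<partial>\<sigma>)" for c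
  proof -
    have "(\<Sum>l\<in>words m. c l * b l) = (\<Sum>l\<in>words m. \<integral>\<zeta>. c l * (boundary_value f \<zeta> * cnj (wmon l \<zeta>)) \<partial>\<sigma>)"
      by (simp only: b_def integral_mult_right_zero)
    also have "\<dots> = (\<integral>\<zeta>. (\<Sum>l\<in>words m. c l * (boundary_value f \<zeta> * cnj (wmon l \<zeta>))) \<partial>\<sigma>)"
      by (rule Bochner_Integration.integral_sum[symmetric]) (intro integrable_mult_right int)
    finally show ?thesis by (simp only: sum_distrib_left mult.left_commute)
  qed
  have "homog m b z = homog m (\<lambda>l. of_real (moment m) * hcoef f l) z" for z
  proof -
    have "homog m b z = (\<integral>\<zeta>. boundary_value f \<zeta> * cinner_vec z \<zeta> ^ m \<partial>\<sigma>)"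
      unfolding cinner_pow pull[symmetric] homog_def by (simp only: mult.commute)
    also have "\<dots> = homog m (\<lambda>l. of_real (moment m) * hcoef f l) z"
      unfolding szego[OF f] hpart_def homog_def by (simp only: sum_distrib_left mult.assoc)
    finally show ?thesis .
  qed
  then have "homog m b = homog m (\<lambda>l. of_real (moment m) * hcoef f l)" by blast
  then have "\<Phi> (res (homog m b)) = \<Phi> (res (homog m (\<lambda>l. of_real (moment m) * hcoef f l)))" by simp
  also have "\<dots> = of_real (moment m) * \<Phi> (res (hpart m f))"
    unfolding hpart_def \<Phi>_homog by (simp only: sum_distrib_left mult.assoc)
  also have "\<Phi> (res (homog m b)) = (\<integral>\<zeta>. boundary_value f \<zeta> * cnj (Q m \<zeta>) \<partial>\<sigma>)"
    unfolding \<Phi>_homog using pull[of "\<lambda>l. \<Phi> (mon l)"] by (simp add: Q_def homog_def mult.commute)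
  finally show ?thesis .
qed

lemma integration_functional_dil:
  assumes f: "f \<in> \<A>" and r: "0 \<le> r" "r < 1"
  shows "integration_functional \<sigma> (\<lambda>z. \<phi> (r *\<^sub>R z)) f = \<Phi> (dil r f)"
proof -
  let ?F = "\<lambda>m \<zeta>. of_real (r ^ m / moment m) * (boundary_value f \<zeta> * cnj (Q m \<zeta>))"
  have bd: "norm (?F m \<zeta>) \<le> (r ^ m / moment m) * (mnorm f * dnorm \<Phi>)" if "norm \<zeta> = 1" for m \<zeta>
  proof -
    have "cmod (boundary_value f \<zeta>) * cmod (Q m \<zeta>) \<le> mnorm f * dnorm \<Phi>"
      using boundary_value_bound[OF f that] Q_bound[of m \<zeta>] that mnorm_ge0[OF A_mult[OF f]]
      by (intro mult_mono) auto
    moreover have "0 \<le> r ^ m / moment m" using r moment_pos[of m] by simp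
    ultimately have "(r ^ m / moment m) * (cmod (boundary_value f \<zeta>) * cmod (Q m \<zeta>)) \<le> (r ^ m / moment m) * (mnorm f * dnorm \<Phi>)"
      by (rule mult_left_mono)
    moreover have "norm (?F m \<zeta>) = (r ^ m / moment m) * (cmod (boundary_value f \<zeta>) * cmod (Q m \<zeta>))"
      using r moment_pos[of m] by (simp add: norm_mult norm_divide norm_power)
    ultimately show ?thesis by simp
  qed
  have sm: "summable (\<lambda>m. (r ^ m / moment m) * (mnorm f * dnorm \<Phi>))"
    by (intro summable_mult2 moment_summable r)
  have int: "integrable \<sigma> (?F m)" for m
    unfolding Q_def by (intro integrable_mult_right boundary_integrable f continuous_intros)
  have "(\<lambda>m. integral\<^sup>L \<sigma> (?F m)) sums (\<integral>\<zeta>. boundary_value f \<zeta> * \<phi> (r *\<^sub>R \<zeta>) \<partial>\<sigma>)"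
  proof (rule integral_bounded_series[OF int bd sm])
    fix \<zeta> :: "complex ^ 'n" assume "norm \<zeta> = 1"
    then have "norm (r *\<^sub>R \<zeta>) < 1" using r by simp
    from sums_mult[OF summable_sums[OF \<phi>_summable[OF this]], of "boundary_value f \<zeta>"]
    have "(\<lambda>m. boundary_value f \<zeta> * (of_real (1 / moment m) * cnj (Q m (r *\<^sub>R \<zeta>)))) sums (boundary_value f \<zeta> * \<phi> (r *\<^sub>R \<zeta>))"
      by (simp only: \<phi>_def)
    moreover have "boundary_value f \<zeta> * (of_real (1 / moment m) * cnj (Q m (r *\<^sub>R \<zeta>))) = ?F m \<zeta>" for m
      by (simp add: scaleR_smult Q_smult)
    ultimately show "(\<lambda>m. ?F m \<zeta>) sums (boundary_value f \<zeta> * \<phi> (r *\<^sub>R \<zeta>))" by (simp only:)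
  qed
  also have "(\<lambda>m. integral\<^sup>L \<sigma> (?F m)) = (\<lambda>m. of_real (r ^ m) * \<Phi> (res (hpart m f)))"
  proof
    fix m
    show "integral\<^sup>L \<sigma> (?F m) = of_real (r ^ m) * \<Phi> (res (hpart m f))"
      unfolding integral_mult_right_zero Q_integral[OF f] using moment_pos[of m] by simp
  qed
  finally show ?thesis
    unfolding integration_functional_def using sums_unique2 \<Phi>_dil_sums[OF multiplierD(3)[OF A_multiplier[OF f]] r] by blast
qed

end

section \<open>The weak-* continuous extension\<close>

context henkin
begin

lemma defect_bound_norm:
  assumes r: "0 \<le> r" "r < 1" and f: "f \<in> \<A>"
  shows "cmod (\<Phi> f - \<Phi> (dil r f)) \<le> defect r * mnorm f"
  unfolding defect_def
proof (rule dual_norm_bound[where \<Psi> = "\<lambda>f. \<Phi> f - \<Phi> (dil r f)", OF A_mult A_scale _ f])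
  show "(\<lambda>f. \<Phi> f - \<Phi> (dil r f)) \<in> dual_space \<A> mnorm"
    unfolding dual_space_def
  proof (intro CollectI conjI ballI allI)
    fix f g assume fg: "f \<in> \<A>" "g \<in> \<A>"
    have "dil r f \<in> \<A>" "dil r g \<in> \<A>" by (intro dil_A A_H fg r)+
    then show "\<Phi> (f + g) - \<Phi> (dil r (f + g)) = \<Phi> f - \<Phi> (dil r f) + (\<Phi> g - \<Phi> (dil r g))"
      by (simp add: dil_add \<Phi>_add fg)
  next
    fix c f assume f: "f \<in> \<A>"
    have "dil r f \<in> \<A>" by (intro dil_A A_H f r)
    then show "\<Phi> (cscale c f) - \<Phi> (dil r (cscale c f)) = c * (\<Phi> f - \<Phi> (dil r f))"
      by (simp add: dil_scale \<Phi>_scale f right_diff_distrib)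
  next
    show "\<exists>C. \<forall>f\<in>\<A>. cmod (\<Phi> f - \<Phi> (dil r f)) \<le> C * mnorm f"
      using diff_dil_bound(4)[OF r] by blast
  qed
qed

lemma \<Phi>_dil_continuous:
  assumes f: "f \<in> H" and r: "0 \<le> r" "r < 1"
  shows "(\<lambda>n. \<Phi> (dil (rad n * r) f)) \<longlonglongrightarrow> \<Phi> (dil r f)"
proof -
  define a where "a m = \<Phi> (res (hpart m f))" for m
  define K where "K = (1 + r) / 2"
  have K: "0 \<le> K" "K < 1" "r < K" using r by (auto simp: K_def)
  have val: "(\<Sum>m. a m * of_real t ^ m) = \<Phi> (dil t f)" if "0 \<le> t" "t < 1" for t
    using sums_unique[OF \<Phi>_dil_sums[OF f that]] by (simp add: a_def mult.commute)
  have "summable (\<lambda>m. a m * of_real K ^ m)"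
    using sums_summable[OF \<Phi>_dil_sums[OF f K(1,2)]] by (simp add: a_def mult.commute)
  then have "isCont (\<lambda>x. \<Sum>m. a m * x ^ m) (of_real r)"
    by (rule isCont_powser) (use K r in simp)
  moreover have "(\<lambda>n. of_real (rad n * r) :: complex) \<longlonglongrightarrow> of_real (1 * r)" by (intro tendsto_intros rad)
  ultimately have "(\<lambda>n. \<Sum>m. a m * of_real (rad n * r) ^ m) \<longlonglongrightarrow> (\<Sum>m. a m * of_real r ^ m)"
    using isCont_tendsto_compose[of "of_real r" "\<lambda>x. \<Sum>m. a m * x ^ m"] by simp
  moreover have "0 \<le> rad n * r" "rad n * r < 1" for n
  proof -
    show "0 \<le> rad n * r" using rad(1)[of n] r by simp
    have "rad n * r \<le> 1 * r" using rad(2)[of n] r by (intro mult_right_mono) auto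
    then show "rad n * r < 1" using r by simp
  qed
  ultimately show ?thesis by (simp only: val r)
qed

text \<open>On the ball algebra this is the triangle inequality through \<open>\<Phi>\<close>. A multiplier is first dilated into the
  ball algebra by a factor that then tends to one.\<close>

lemma \<Phi>_dil_diff_bound:
  assumes f: "f \<in> \<M>" and r: "0 \<le> r" "r < 1" and s: "0 \<le> s" "s < 1"
  shows "cmod (\<Phi> (dil r f) - \<Phi> (dil s f)) \<le> (defect r + defect s) * mnorm f"
proof (rule LIMSEQ_le_const2)
  have fH: "f \<in> H" by (rule multiplierD(3)[OF f])
  show "(\<lambda>n. cmod (\<Phi> (dil (rad n * r) f) - \<Phi> (dil (rad n * s) f))) \<longlonglongrightarrow> cmod (\<Phi> (dil r f) - \<Phi> (dil s f))"
    by (intro tendsto_intros \<Phi>_dil_continuous fH r s)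
  have "cmod (\<Phi> (dil (rad n * r) f) - \<Phi> (dil (rad n * s) f)) \<le> (defect r + defect s) * mnorm f" for n
  proof -
    define g where "g = dil (rad n) f"
    have g: "g \<in> \<A>" unfolding g_def by (intro dil_A fH rad)
    have gn: "mnorm g \<le> mnorm f" unfolding g_def by (intro dil_mnorm multiplierD f rad)
    have "dil (rad n * r) f = dil r g" "dil (rad n * s) f = dil s g"
      unfolding g_def using r s by (simp_all add: dil_dil)
    then have "\<Phi> (dil (rad n * r) f) - \<Phi> (dil (rad n * s) f) = (\<Phi> g - \<Phi> (dil s g)) - (\<Phi> g - \<Phi> (dil r g))" by simp
    then have "cmod (\<Phi> (dil (rad n * r) f) - \<Phi> (dil (rad n * s) f)) \<le>
        cmod (\<Phi> g - \<Phi> (dil s g)) + cmod (\<Phi> g - \<Phi> (dil r g))"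
      by (simp only: norm_triangle_ineq4)
    also have "\<dots> \<le> defect s * mnorm g + defect r * mnorm g"
      by (intro add_mono defect_bound_norm r s g)
    also have "\<dots> = (defect r + defect s) * mnorm g" by (simp add: algebra_simps)
    also have "\<dots> \<le> (defect r + defect s) * mnorm f"
      using defect_ge0[OF r] defect_ge0[OF s] by (intro mult_left_mono gn) auto
    finally show ?thesis .
  qed
  then show "\<exists>N. \<forall>n\<ge>N. cmod (\<Phi> (dil (rad n * r) f) - \<Phi> (dil (rad n * s) f)) \<le> (defect r + defect s) * mnorm f"
    by blast
qed

lemma small_defect: assumes "e > 0" obtains r where "0 \<le> r" "r < 1" "defect r < e"
proof -
  have 1: "\<forall>\<^sub>F r in at_left 1. defect r < e" using order_tendstoD(2)[OF defect_tendsto assms] .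
  have 2: "\<forall>\<^sub>F r in at_left 1. r \<in> {0<..<1::real}" by (rule eventually_at_left_real) simp
  have "\<forall>\<^sub>F r in at_left 1. 0 \<le> r \<and> r < 1 \<and> defect r < e"
    using 1 2 by eventually_elim simp
  then have "\<exists>r. 0 \<le> r \<and> r < 1 \<and> defect r < e" by (rule eventually_happens'[OF trivial_limit_at_left_real])
  then show ?thesis using that by blast
qed

text \<open>The functionals \<open>f \<mapsto> \<Phi> (dil (r n) f)\<close> form a Cauchy sequence over the multipliers. Their differences have
  representations of finite rank with summable costs, by \<open>quotient_norm\<close>, so the limit is
  normal.\<close>

lemma weakstar_extension:
  "\<exists>\<Psi>\<in>multiplier_predual H ip. (\<forall>f\<in>\<A>. \<Psi> f = \<Phi> f) \<and> dual_norm \<M> mnorm \<Psi> = dnorm \<Phi>"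
proof -
  \<comment> \<open>radii for which the telescoping series of functionals converges geometrically\<close>
  have "\<forall>j. \<exists>r. 0 \<le> r \<and> r < 1 \<and> defect r < (1/2) ^ j"
  proof
    fix j :: nat
    obtain r where "0 \<le> r" "r < 1" "defect r < (1/2) ^ j" using small_defect[of "(1/2) ^ j"] by auto
    then show "\<exists>r. 0 \<le> r \<and> r < 1 \<and> defect r < (1/2) ^ j" by blast
  qed
  from choice[OF this] obtain r where r': "\<forall>j. 0 \<le> r j \<and> r j < 1 \<and> defect (r j) < (1/2) ^ j" by (rule exE)
  then have r: "0 \<le> r j" "r j < 1" "defect (r j) < (1/2) ^ j" for j by simp_all
  have "\<forall>j. \<exists>y. y \<in> H \<and> (\<forall>f\<in>H. \<Phi> (dil (r j) f) = ip f y)"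
  proof
    fix j
    show "\<exists>y. y \<in> H \<and> (\<forall>f\<in>H. \<Phi> (dil (r j) f) = ip f y)"
    proof (rule \<Phi>_dil_rep[OF r(1,2)[of j]])
      fix y assume "y \<in> H" "\<And>f. f \<in> H \<Longrightarrow> \<Phi> (dil (r j) f) = ip f y"
      then show ?thesis by (intro exI[of _ y]) simp
    qed
  qed
  from choice[OF this] obtain y where y': "\<forall>j. y j \<in> H \<and> (\<forall>f\<in>H. \<Phi> (dil (r j) f) = ip f (y j))" by (rule exE)
  have y: "y j \<in> H" for j using y' by simp
  have rep: "\<Phi> (dil (r j) f) = ip f (y j)" if "f \<in> H" for f j using y' that by simp
  have one_rank: "rank_functional [(one, v)] f = ip f v" if "f \<in> \<M>" for f v
    using that multiplierD(2)[OF that] by (simp add: rank_functional_def times_one restrict0_id)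
  have ex: "\<exists>L. vecs L \<and> rank_functional L = rank_functional [(one, y (Suc j) - y j)] \<and> cost L \<le> 3 * (1/2) ^ j" for j
  proof -
    let ?\<psi> = "rank_functional [(one, y (Suc j) - y j)]"
    have finite_rank: "?\<psi> \<in> finite_rank" unfolding finite_rank_def by (rule imageI) (simp add: vecs_def y)
    have "qnorm ?\<psi> \<le> 2 * (1/2) ^ j"
    proof (rule quotient_norm[OF finite_rank])
      fix f assume f: "f \<in> \<M>"
      have fH: "f \<in> H" by (rule multiplierD(3)[OF f])
      have "cmod (?\<psi> f) = cmod (\<Phi> (dil (r (Suc j)) f) - \<Phi> (dil (r j) f))"
        by (simp only: one_rank[OF f] rep[OF fH] ip_diff_right y fH)
      also have "\<dots> \<le> (defect (r (Suc j)) + defect (r j)) * mnorm f" by (intro \<Phi>_dil_diff_bound f r)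
      also have "\<dots> \<le> (2 * (1/2) ^ j) * mnorm f"
      proof (intro mult_right_mono mnorm_ge0 multiplierD f)
        have "(1/2 :: real) ^ Suc j \<le> (1/2) ^ j" by simp
        then show "defect (r (Suc j)) + defect (r j) \<le> 2 * (1/2) ^ j" using r(3)[of j] r(3)[of "Suc j"] by linarith
      qed
      finally show "cmod (?\<psi> f) \<le> (2 * (1/2) ^ j) * mnorm f" .
    qed simp
    moreover obtain L where "vecs L" "rank_functional L = ?\<psi>" "cost L < qnorm ?\<psi> + (1/2) ^ j"
      using qnorm_approx[OF finite_rank, of "(1/2) ^ j"] by auto
    ultimately show ?thesis by (intro exI[of _ L]) simp
  qed
  have "\<forall>j. \<exists>L. vecs L \<and> rank_functional L = rank_functional [(one, y (Suc j) - y j)] \<and> cost L \<le> 3 * (1/2) ^ j"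
    by (intro allI ex)
  from choice[OF this] obtain L where
    L': "\<forall>j. vecs (L j) \<and> rank_functional (L j) = rank_functional [(one, y (Suc j) - y j)] \<and> cost (L j) \<le> 3 * (1/2) ^ j" by (rule exE)
  have L: "vecs (L j)" "rank_functional (L j) = rank_functional [(one, y (Suc j) - y j)]" "cost (L j) \<le> 3 * (1/2) ^ j" for j
    using L' by blast+
  define L1 where "L1 j = (case j of 0 \<Rightarrow> [(one, y 0)] | Suc i \<Rightarrow> L i)" for j
  have v1: "vecs (L1 j)" for j using L(1) y by (cases j) (simp_all add: L1_def vecs_def)
  have "summable (\<lambda>j. 3 * (1/2 :: real) ^ j)" by (intro summable_mult summable_geometric) simp
  then have "summable (\<lambda>j. cost (L j))"
    by (rule summable_comparison_test'[of _ 0]) (simp add: cost_ge0 L(3))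
  then have "summable (\<lambda>j. cost (L1 (Suc j)))" by (simp add: L1_def)
  then have s1: "summable (\<lambda>j. cost (L1 j))" by (rule iffD1[OF summable_Suc_iff])
  obtain \<Lambda> where \<Lambda>: "\<Lambda> \<in> operators_predual H ip"
    and \<Lambda>f: "\<forall>f\<in>\<M>. (\<lambda>j. rank_functional (L1 j) f) sums \<Lambda> (multiplication_op f)"
    using normal_series[OF v1 s1] by (rule bexE)
  have lim: "(\<lambda>n. \<Phi> (dil (r n) f)) \<longlonglongrightarrow> \<Lambda> (multiplication_op f)" if f: "f \<in> \<M>" for f
  proof -
    have fH: "f \<in> H" by (rule multiplierD(3)[OF f])
    have "(\<Sum>j<Suc n. rank_functional (L1 j) f) = ip f (y n)" for n
    proof (induction n)
      case 0
      show ?case by (simp add: L1_def one_rank[OF f])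
    next
      case (Suc n)
      have "rank_functional (L1 (Suc n)) f = ip f (y (Suc n)) - ip f (y n)"
        by (simp add: L1_def L(2) one_rank[OF f] ip_diff_right y fH)
      then show ?case using Suc by simp
    qed
    then have "(\<lambda>n. \<Phi> (dil (r n) f)) = (\<lambda>n. \<Sum>j<Suc n. rank_functional (L1 j) f)" by (simp only: rep[OF fH])
    then show ?thesis using LIMSEQ_Suc[OF bspec[OF \<Lambda>f f, unfolded sums_def]] by (simp only:)
  qed
  define \<Psi> where "\<Psi> f = \<Lambda> (multiplication_op f)" for f
  have "\<Psi> \<in> multiplier_predual H ip" unfolding multiplier_predual_def \<Psi>_def using \<Lambda> by blast
  moreover have ext: "\<Psi> f = \<Phi> f" if f: "f \<in> \<A>" for f
  proof -
    have "(\<lambda>n. \<Phi> f - \<Phi> (dil (r n) f)) \<longlonglongrightarrow> 0"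
    proof (rule Lim_null_comparison[OF always_eventually[OF allI]])
      show "(\<lambda>n. (1/2) ^ n * mnorm f) \<longlonglongrightarrow> 0" by (intro tendsto_mult_left_zero LIMSEQ_power_zero) simp
      fix n
      have "cmod (\<Phi> f - \<Phi> (dil (r n) f)) \<le> defect (r n) * mnorm f" by (rule defect_bound_norm[OF r(1,2) f])
      also have "\<dots> \<le> (1/2) ^ n * mnorm f" using r(3)[of n] by (intro mult_right_mono mnorm_ge0 A_mult f) auto
      finally show "norm (\<Phi> f - \<Phi> (dil (r n) f)) \<le> (1/2) ^ n * mnorm f" .
    qed
    then have "(\<lambda>n. \<Phi> f - (\<Phi> f - \<Phi> (dil (r n) f))) \<longlonglongrightarrow> \<Phi> f - 0" by (intro tendsto_intros)
    then have "(\<lambda>n. \<Phi> (dil (r n) f)) \<longlonglongrightarrow> \<Phi> f" by simp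
    then show ?thesis unfolding \<Psi>_def using lim[OF A_multiplier[OF f]] LIMSEQ_unique by blast
  qed
  moreover have "dual_norm \<M> mnorm \<Psi> = dnorm \<Phi>"
  proof (rule antisym)
    have bd: "cmod (\<Psi> f) \<le> dnorm \<Phi> * mnorm f" if f: "f \<in> \<M>" for f
      unfolding \<Psi>_def
    proof (rule LIMSEQ_le_const2[OF tendsto_norm[OF lim[OF f]]])
      have "cmod (\<Phi> (dil (r n) f)) \<le> dnorm \<Phi> * mnorm f" for n
      proof -
        have "cmod (\<Phi> (dil (r n) f)) \<le> dnorm \<Phi> * mnorm (dil (r n) f)" by (intro \<Phi>_bound dil_A multiplierD f r)
        also have "\<dots> \<le> dnorm \<Phi> * mnorm f" by (intro mult_left_mono dil_mnorm multiplierD f r dnorm_\<Phi>_ge0)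
        finally show ?thesis .
      qed
      then show "\<exists>N. \<forall>n\<ge>N. norm (\<Phi> (dil (r n) f)) \<le> dnorm \<Phi> * mnorm f" by blast
    qed
    show "dual_norm \<M> mnorm \<Psi> \<le> dnorm \<Phi>"
    proof (rule dual_norm_le[OF A_multiplier[OF A_zero]])
      fix f assume f: "f \<in> \<M>" "mnorm f \<le> 1"
      have "dnorm \<Phi> * mnorm f \<le> dnorm \<Phi> * 1" by (intro mult_left_mono f dnorm_\<Phi>_ge0)
      then show "cmod (\<Psi> f) \<le> dnorm \<Phi>" using bd[OF f(1)] by simp
    qed
    show "dnorm \<Phi> \<le> dual_norm \<M> mnorm \<Psi>"
    proof (rule dual_norm_le[OF A_zero])
      fix f assume f: "f \<in> \<A>" "mnorm f \<le> 1"
      have "cmod (\<Psi> f) \<le> dual_norm \<M> mnorm \<Psi>" by (rule dual_norm_upper[OF multiplierD(1) bd A_multiplier[OF f(1)] f(2)])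
      then show "cmod (\<Phi> f) \<le> dual_norm \<M> mnorm \<Psi>" by (simp only: ext[OF f(1)])
    qed
  qed
  ultimately show ?thesis by blast
qed

end

theorem theorem3p3:
  fixes H :: "(complex ^ 'n \<Rightarrow> complex) set"
    and ip :: "(complex ^ 'n \<Rightarrow> complex) \<Rightarrow> (complex ^ 'n \<Rightarrow> complex) \<Rightarrow> complex"
    and \<sigma> :: "(complex ^ 'n) measure"
    and \<Phi> :: "(complex ^ 'n \<Rightarrow> complex) \<Rightarrow> complex"
  assumes "drury_arveson H ip"
    and "rotation_invariant_prob \<sigma>"
    and "henkin_functional H ip \<Phi>"
  shows "(\<exists>\<Psi>\<in>multiplier_predual H ip.
            (\<forall>f\<in>ball_algebra H ip. \<Psi> f = \<Phi> f) \<and>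
            dual_norm (multiplier_algebra H) (multiplier_norm H ip) \<Psi> =
            dual_norm (ball_algebra H ip) (multiplier_norm H ip) \<Phi>) \<and>
         (\<exists>\<phi>. antiholomorphic_on_ball \<phi> \<and>
            (\<forall>r\<in>{0..<1}. integration_functional \<sigma> (\<lambda>z. \<phi> (r *\<^sub>R z))
                \<in> dual_space (ball_algebra H ip) (multiplier_norm H ip)) \<and>
            ((\<lambda>r. dual_norm (ball_algebra H ip) (multiplier_norm H ip)
                    (\<lambda>f. \<Phi> f - integration_functional \<sigma> (\<lambda>z. \<phi> (r *\<^sub>R z)) f))
               \<longlongrightarrow> 0) (at_left (1 :: real)))"
proof -
  interpret henkin_sphere H ip \<Phi> \<sigma>
    by unfold_locales (rule assms)+
  have dual: "integration_functional \<sigma> (\<lambda>z. \<phi> (r *\<^sub>R z)) \<in> dual_space \<A> mnorm" if r: "0 \<le> r" "r < 1" for r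
    unfolding dual_space_def
  proof (intro CollectI conjI ballI allI)
    fix f g assume fg: "f \<in> \<A>" "g \<in> \<A>"
    have "dil r f \<in> \<A>" "dil r g \<in> \<A>" by (intro dil_A A_H fg r)+
    then show "integration_functional \<sigma> (\<lambda>z. \<phi> (r *\<^sub>R z)) (f + g) =
        integration_functional \<sigma> (\<lambda>z. \<phi> (r *\<^sub>R z)) f + integration_functional \<sigma> (\<lambda>z. \<phi> (r *\<^sub>R z)) g"
      by (simp only: integration_functional_dil[OF _ r] fg A_add dil_add \<Phi>_add)
  next
    fix c f assume f: "f \<in> \<A>"
    have "dil r f \<in> \<A>" by (intro dil_A A_H f r)
    then show "integration_functional \<sigma> (\<lambda>z. \<phi> (r *\<^sub>R z)) (cscale c f) =
        c * integration_functional \<sigma> (\<lambda>z. \<phi> (r *\<^sub>R z)) f"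
      by (simp only: integration_functional_dil[OF _ r] f A_scale dil_scale \<Phi>_scale)
  next
    have "cmod (\<Phi> (dil r f)) \<le> dnorm \<Phi> * mnorm f" if f: "f \<in> \<A>" for f
    proof -
      have "cmod (\<Phi> (dil r f)) \<le> dnorm \<Phi> * mnorm (dil r f)" by (intro \<Phi>_bound dil_A A_H f r)
      also have "\<dots> \<le> dnorm \<Phi> * mnorm f" by (intro mult_left_mono dil_mnorm A_mult f r dnorm_\<Phi>_ge0)
      finally show ?thesis .
    qed
    then show "\<exists>C. \<forall>f\<in>\<A>. cmod (integration_functional \<sigma> (\<lambda>z. \<phi> (r *\<^sub>R z)) f) \<le> C * mnorm f"
      using integration_functional_dil[OF _ r] by (intro exI[of _ "dnorm \<Phi>"]) simp
  qed
  have eq: "dnorm (\<lambda>f. \<Phi> f - integration_functional \<sigma> (\<lambda>z. \<phi> (r *\<^sub>R z)) f) = defect r"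
    if r: "0 \<le> r" "r < 1" for r
    unfolding defect_def dual_norm_def
    by (intro SUP_cong refl) (simp add: integration_functional_dil[OF _ r])
  have "\<forall>\<^sub>F r in at_left 1. r \<in> {0<..<1::real}" by (rule eventually_at_left_real) simp
  then have "\<forall>\<^sub>F r in at_left 1. defect r = dnorm (\<lambda>f. \<Phi> f - integration_functional \<sigma> (\<lambda>z. \<phi> (r *\<^sub>R z)) f)"
    by eventually_elim (simp add: eq)
  from Lim_transform_eventually[OF defect_tendsto this]
  have lim: "((\<lambda>r. dnorm (\<lambda>f. \<Phi> f - integration_functional \<sigma> (\<lambda>z. \<phi> (r *\<^sub>R z)) f)) \<longlongrightarrow> 0) (at_left 1)" .
  show ?thesis
    by (intro conjI weakstar_extension exI[of _ \<phi>] \<phi>_antiholomorphic lim ballI dual) auto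
qed

end
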